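(* Let $A=\begin{bmatrix}2&0\\0&1\end{bmatrix}$, $B=\begin{bmatrix}1&0\\0&2\end{bmatrix}$, and let $\phi\in L^2(\mathbb{R}^2)$ have Fourier transform $\hat\phi$ with the following properties. (a) For $(\xi_1,\xi_2)\in\mathbb{R}^2$, $0\le\hat\phi(\xi_1,\xi_2)\le\frac1{2\pi}$. (b) For $(\xi_1,\xi_2)\in(-\frac{2\pi}3,\frac{2\pi}3)^2$, $\hat\phi(\xi_1,\xi_2)=\frac1{2\pi}$. (c) For $(\xi_1,\xi_2)\notin(-\frac{4\pi}3,\frac{4\pi}3)^2$, $\hat\phi(\xi_1,\xi_2)=0$. (d) For $(\xi_1,\xi_2)\in(\frac{2\pi}3,\frac{4\pi}3)^2$, $\hat\phi(\xi_1,\xi_2)$ is nonzero and $$\sum_{i,j\in\{0,1\}}|\hat\phi(\xi_1-2\pi i,\xi_2-2\pi j)|^2=\frac1{4\pi^2}.$$ (e) For $i,j,k\in\{0,1\}$ and $(\xi_1,\xi_2)\in I_{(i,j,k)}$, one has $\theta_1(\xi_1,\xi_2)^2+\theta_2(\xi_1,\xi_2)^2\ne0$ and $$\hat\phi(\xi_1,\xi_2)^2=\left(\frac1{2\pi}\right)^2\frac{\theta_1(\xi_1,\xi_2)^2}{\theta_1(\xi_1,\xi_2)^2+\theta_2(\xi_1,\xi_2)^2},$$ where $\theta_1(\xi_1,\xi_2)=\hat\phi(2^{1-k}\xi_1,2^k\xi_2)$ and $\theta_2(\xi_1,\xi_2)=\hat\phi\left(2^{1-k}\xi_1-2\pi(-1)^ik,\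 2^k\xi_2-2\pi(-1)^j(1-k)\right)$. (f) For $i,j\in\{0,1\}$ and $(\xi_1,\xi_2)\in J_{(i,j)}$, $\hat\phi(\xi_1,\xi_2)=\hat\phi(2^{1-i}\xi_1,2^i\xi_2)$. (g) For $(\xi_1,\xi_2)\in(\frac{2\pi}3,\frac{4\pi}3)^2$, $$\left(\hat\phi(\xi_1,\xi_2)\hat\phi(\xi_1-2\pi,\xi_2-2\pi)\right)^2-\left(\hat\phi(\xi_1-2\pi,\xi_2)\hat\phi(\xi_1,\xi_2-2\pi)\right)^2=0.$$ Let $V_{0,0}$ be the closed linear span in $L^2(\mathbb{R}^2)$ of $\{\phi(x_1-k_1,x_2-k_2):k_1,k_2\in\mathbb{Z}\}$, let $V_{i,j}=D_A^iD_B^jV_{0,0}$ for $i,j\in\mathbb{Z}$, and let $\mathfrak{V}=\{V_{i,j}:i,j\in\mathbb{Z}\}$. Then $(\phi,\mathfrak{V})$ is a biscaled multiresolution analysis with respect to the dilation pair $(A,B)$.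
   Context: The Fourier transform on $L^2(\mathbb{R}^2)$ is the unitary extension of $\hat f(\xi)=\frac1{2\pi}\int_{\mathbb{R}^2}e^{-i\langle\xi,x\rangle}f(x)\,dx$. Pointwise conditions on $\hat\phi$ are understood almost everywhere. For $M\in\mathrm{GL}_2(\mathbb{R})$, $(D_Mf)(x)=|\det M|^{1/2}f(Mx)$. For $i,j,k\in\{0,1\}$ let $I_{(i,j,k)}$ be the open rectangle $$\left((-1)^i2^{i+k}\tfrac\pi3,\ (-1)^i2^{(1-i)+k}\tfrac\pi3\right)\times\left((-1)^j2^{j+(1-k)}\tfrac\pi3,\ (-1)^j2^{(1-j)+(1-k)}\tfrac\pi3\right),$$ and for $i,j\in\{0,1\}$ let $$J_{(i,j)}=\left(-\tfrac\pi3+i(-1)^j\pi,\ \tfrac\pi3+i(-1)^j\pi\right)\times\left(-\tfrac\pi3+(1-i)(-1)^j\pi,\ \tfrac\pi3+(1-i)(-1)^j\pi\right).$$ A biscaled multiresolution analysis (BMRA) with respect to $(A,B)$ is a pair $(\phi,\mathfrak{V})$ where $\phi\in L^2(\mathbb{R}^2)$ and $\mathfrak{V}=\{V_{i,j}:(i,j)\in\mathbb{Z}^2\}$ is a family of closed subspaces of $L^2(\mathbb{R}^2)$ such that: (i) $V_{i,j}\subseteq V_{l,m}$ for $i\le l$, $j\le m$; (ii) $D_A^iD_B^jV_{0,0}=V_{i,j}$ for all $i,j$; (iii) $\bigcap_{(i,j)\in\mathbb{Z}^2}V_{i,j}=\{0\}$; (iv) $\overline{\bigcup_{(i,j)\in\mathbb{Z}^2}V_{i,j}}=L^2(\mathbb{R}^2)$;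 (v) the orthogonal projections $P_{i,j}$ onto $V_{i,j}$ commute pairwise; (vi) $\{\phi(x-k):k\in\mathbb{Z}^2\}$ is an orthonormal basis of $V_{0,0}$. *)

theory Defs
  imports "HOL-Analysis.Analysis"
begin

section \<open>The Hilbert space of square integrable functions on the plane\<close>

definition square_integrable :: "(real^2 \<Rightarrow> complex) \<Rightarrow> bool" where
  "square_integrable f \<longleftrightarrow>
     f \<in> borel_measurable lborel \<and> integrable lborel (\<lambda>x. (cmod (f x))\<^sup>2)"

definition L2_eq :: "(real^2 \<Rightarrow> complex) \<Rightarrow> (real^2 \<Rightarrow> complex) \<Rightarrow> bool" where
  "L2_eq f g \<longleftrightarrow> square_integrable f \<and> square_integrable g \<and> (AE x in lborel. f x = g x)"

lemma square_integrable_0: "square_integrable (\<lambda>x. 0)"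
  by (simp add: square_integrable_def)

lemma square_integrable_mult:
  assumes "square_integrable f" "square_integrable g"
  shows "integrable lborel (\<lambda>x. f x * cnj (g x))"
proof (rule Bochner_Integration.integrable_bound)
  show "integrable lborel (\<lambda>x. (cmod (f x))\<^sup>2 + (cmod (g x))\<^sup>2)"
    using assms by (simp add: square_integrable_def)
  have "f \<in> borel_measurable lborel" "g \<in> borel_measurable lborel"
    using assms by (simp_all add: square_integrable_def)
  then show "(\<lambda>x. f x * cnj (g x)) \<in> borel_measurable lborel"
    by (intro borel_measurable_times borel_measurable_continuous_on[where f = cnj])
       (auto intro!: continuous_intros)
  have "a * b \<le> a\<^sup>2 + b\<^sup>2" if "a \<ge> 0" "b \<ge> 0" for a b :: real
    using sum_squares_bound[of a b] mult_nonneg_nonneg[OF that] by linarith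
  then show "AE x in lborel. norm (f x * cnj (g x)) \<le> norm ((cmod (f x))\<^sup>2 + (cmod (g x))\<^sup>2)"
    by (simp add: norm_mult)
qed

lemma square_integrable_add:
  assumes "square_integrable f" "square_integrable g"
  shows "square_integrable (\<lambda>x. f x + g x)"
  unfolding square_integrable_def
proof
  have m [measurable]: "f \<in> borel_measurable lborel" "g \<in> borel_measurable lborel"
    using assms by (simp_all add: square_integrable_def)
  show "(\<lambda>x. f x + g x) \<in> borel_measurable lborel"
    using m by simp
  show "integrable lborel (\<lambda>x. (cmod (f x + g x))\<^sup>2)"
  proof (rule Bochner_Integration.integrable_bound)
    show "integrable lborel (\<lambda>x. 2 * (cmod (f x))\<^sup>2 + 2 * (cmod (g x))\<^sup>2)"
      using assms by (simp add: square_integrable_def)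
    show "(\<lambda>x. (cmod (f x + g x))\<^sup>2) \<in> borel_measurable lborel"
      using m by measurable
    have "(cmod (a + b))\<^sup>2 \<le> 2 * (cmod a)\<^sup>2 + 2 * (cmod b)\<^sup>2" for a b
    proof -
      have "(cmod (a + b))\<^sup>2 \<le> (cmod a + cmod b)\<^sup>2"
        by (intro power_mono norm_triangle_ineq) auto
      also have "\<dots> \<le> 2 * (cmod a)\<^sup>2 + 2 * (cmod b)\<^sup>2"
        using sum_squares_bound[of "cmod a" "cmod b"] by (simp add: power2_sum)
      finally show ?thesis .
    qed
    then show "AE x in lborel. norm ((cmod (f x + g x))\<^sup>2)
        \<le> norm (2 * (cmod (f x))\<^sup>2 + 2 * (cmod (g x))\<^sup>2)"
      by simp
  qed
qed

lemma square_integrable_scale: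
  assumes "square_integrable f"
  shows "square_integrable (\<lambda>x. c * f x)"
  unfolding square_integrable_def
proof
  show "(\<lambda>x. c * f x) \<in> borel_measurable lborel"
    using assms by (intro borel_measurable_times) (auto simp: square_integrable_def)
  show "integrable lborel (\<lambda>x. (cmod (c * f x))\<^sup>2)"
    using assms by (simp add: square_integrable_def norm_mult power_mult_distrib)
qed

lemma square_integrable_uminus:
  "square_integrable f \<Longrightarrow> square_integrable (\<lambda>x. - f x)"
  using square_integrable_scale[of f "-1"] by simp

quotient_type L2 = "real^2 \<Rightarrow> complex" / partial: L2_eq
proof (rule part_equivpI)
  show "\<exists>f. L2_eq f f"
    by (rule exI[of _ "\<lambda>x. 0"]) (simp add: L2_eq_def square_integrable_0)
  show "symp L2_eq"
    by (rule sympI) (auto simp: L2_eq_def)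
  show "transp L2_eq"
    by (rule transpI) (auto simp: L2_eq_def elim: AE_mp)
qed

instantiation L2 :: ab_group_add
begin

lift_definition zero_L2 :: L2 is "\<lambda>x. 0"
  by (simp add: L2_eq_def square_integrable_0)

lift_definition plus_L2 :: "L2 \<Rightarrow> L2 \<Rightarrow> L2" is "\<lambda>f g x. f x + g x"
  by (auto simp: L2_eq_def intro: square_integrable_add)

lift_definition uminus_L2 :: "L2 \<Rightarrow> L2" is "\<lambda>f x. - f x"
  by (auto simp: L2_eq_def intro: square_integrable_uminus)

definition minus_L2 :: "L2 \<Rightarrow> L2 \<Rightarrow> L2" where
  "f - g = f + - g" for f g :: L2

instance
proof
  fix a b c :: L2
  show "a + b + c = a + (b + c)"
    by transfer (auto simp: L2_eq_def add.assoc intro!: square_integrable_add)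
  show "a + b = b + a"
    by transfer (auto simp: L2_eq_def add.commute intro!: square_integrable_add)
  show "0 + a = a"
    by transfer (auto simp: L2_eq_def)
  show "- a + a = 0"
    by transfer (auto simp: L2_eq_def square_integrable_0)
  show "a - b = a + - b"
    by (fact minus_L2_def)
qed

end

lift_definition scaleC :: "complex \<Rightarrow> L2 \<Rightarrow> L2" (infixr "*\<^sub>C" 75) is "\<lambda>c f x. c * f x"
  by (auto simp: L2_eq_def intro: square_integrable_scale)

global_interpretation L2: vector_space scaleC
proof
  fix a b :: complex and x y :: L2
  show "a *\<^sub>C (x + y) = a *\<^sub>C x + a *\<^sub>C y"
    by transfer (auto simp: L2_eq_def distrib_left
        intro!: square_integrable_add square_integrable_scale)
  show "(a + b) *\<^sub>C x = a *\<^sub>C x + b *\<^sub>C x"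
    by transfer (auto simp: L2_eq_def distrib_right
        intro!: square_integrable_add square_integrable_scale)
  show "a *\<^sub>C b *\<^sub>C x = (a * b) *\<^sub>C x"
    by transfer (auto simp: L2_eq_def mult.assoc intro!: square_integrable_scale)
  show "1 *\<^sub>C x = x"
    by transfer (auto simp: L2_eq_def)
qed

lift_definition cinner :: "L2 \<Rightarrow> L2 \<Rightarrow> complex" is
  "\<lambda>f g. LINT x|lborel. f x * cnj (g x)"
proof -
  fix f f' g g' :: "real^2 \<Rightarrow> complex"
  assume *: "L2_eq f f'" "L2_eq g g'"
  show "(LINT x|lborel. f x * cnj (g x)) = (LINT x|lborel. f' x * cnj (g' x))"
  proof (rule integral_cong_AE)
    show "(\<lambda>x. f x * cnj (g x)) \<in> borel_measurable lborel"
      "(\<lambda>x. f' x * cnj (g' x)) \<in> borel_measurable lborel"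
      using * square_integrable_mult by (auto simp: L2_eq_def)
    show "AE x in lborel. f x * cnj (g x) = f' x * cnj (g' x)"
      using * by (auto simp: L2_eq_def elim: AE_mp)
  qed
qed

lemma cinner_add_left: "cinner (f + g) h = cinner f h + cinner g h"
  by transfer (simp add: L2_eq_def distrib_right square_integrable_mult)

lemma cinner_scaleC_left: "cinner (c *\<^sub>C f) h = c * cinner f h"
  by transfer (simp add: mult.assoc)

lemma cinner_commute: "cinner f g = cnj (cinner g f)"
  by transfer (subst Bochner_Integration.integral_cnj[symmetric], simp add: mult.commute)

lift_definition L2_norm_sq :: "L2 \<Rightarrow> real" is "\<lambda>f. LINT x|lborel. (cmod (f x))\<^sup>2"
proof -
  fix f f' :: "real^2 \<Rightarrow> complex"
  assume *: "L2_eq f f'"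
  show "(LINT x|lborel. (cmod (f x))\<^sup>2) = (LINT x|lborel. (cmod (f' x))\<^sup>2)"
    using * by (intro integral_cong_AE) (auto simp: L2_eq_def square_integrable_def elim: AE_mp)
qed

lemma cinner_self: "cinner f f = of_real (L2_norm_sq f)"
proof transfer
  fix f :: "real^2 \<Rightarrow> complex"
  have "(LINT x|lborel. f x * cnj (f x)) = (LINT x|lborel. complex_of_real ((cmod (f x))\<^sup>2))"
    by (rule Bochner_Integration.integral_cong) (auto simp: complex_norm_square[symmetric])
  then show "(LINT x|lborel. f x * cnj (f x)) = of_real (LINT x|lborel. (cmod (f x))\<^sup>2)"
    by (simp only: integral_complex_of_real)
qed

lemma L2_norm_sq_nonneg: "0 \<le> L2_norm_sq f"
  by transfer (simp add: integral_nonneg_AE)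

lemma L2_norm_sq_eq_0: "L2_norm_sq f = 0 \<longleftrightarrow> f = 0"
  by transfer (auto simp: L2_eq_def square_integrable_0 square_integrable_def
      integral_nonneg_eq_0_iff_AE)

text \<open>
  The type class inner product is the real part of the complex one; it induces the same
  norm and hence the same topology.
\<close>

instantiation L2 :: real_inner
begin

definition scaleR_L2 :: "real \<Rightarrow> L2 \<Rightarrow> L2" where
  "scaleR_L2 r f = of_real r *\<^sub>C f"

definition inner_L2 :: "L2 \<Rightarrow> L2 \<Rightarrow> real" where
  "inner_L2 f g = Re (cinner f g)"

definition norm_L2 :: "L2 \<Rightarrow> real" where
  "norm_L2 f = sqrt (inner f f)"

definition sgn_L2 :: "L2 \<Rightarrow> L2" where
  "sgn_L2 f = inverse (norm f) *\<^sub>R f"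

definition dist_L2 :: "L2 \<Rightarrow> L2 \<Rightarrow> real" where
  "dist_L2 f g = norm (f - g)"

definition uniformity_L2 :: "(L2 \<times> L2) filter" where
  "uniformity_L2 = (INF e\<in>{0<..}. principal {(x, y). dist x y < e})"

definition open_L2 :: "L2 set \<Rightarrow> bool" where
  "open_L2 U \<longleftrightarrow> (\<forall>x\<in>U. eventually (\<lambda>(x', y). x' = x \<longrightarrow> y \<in> U) uniformity)"

instance
proof
  fix x y z :: L2 and a b :: real and U :: "L2 set"
  show "a *\<^sub>R (x + y) = a *\<^sub>R x + a *\<^sub>R y"
    "(a + b) *\<^sub>R x = a *\<^sub>R x + b *\<^sub>R x"
    "a *\<^sub>R b *\<^sub>R x = (a * b) *\<^sub>R x"
    "1 *\<^sub>R x = x"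
    by (simp_all add: scaleR_L2_def L2.scale_right_distrib L2.scale_left_distrib)
  show "dist x y = norm (x - y)"
    by (fact dist_L2_def)
  show "sgn x = inverse (norm x) *\<^sub>R x"
    by (fact sgn_L2_def)
  show "uniformity = (INF e\<in>{0<..}. principal {(x, y::L2). dist x y < e})"
    by (fact uniformity_L2_def)
  show "open U \<longleftrightarrow> (\<forall>x\<in>U. eventually (\<lambda>(x', y). x' = x \<longrightarrow> y \<in> U) uniformity)"
    by (fact open_L2_def)
  show "inner x y = inner y x"
    unfolding inner_L2_def by (subst cinner_commute) simp
  show "inner (x + y) z = inner x z + inner y z"
    by (simp add: inner_L2_def cinner_add_left)
  show "inner (a *\<^sub>R x) y = a * inner x y"
    by (simp add: inner_L2_def scaleR_L2_def cinner_scaleC_left)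
  show "0 \<le> inner x x"
    by (simp add: inner_L2_def cinner_self L2_norm_sq_nonneg)
  show "inner x x = 0 \<longleftrightarrow> x = 0"
    by (simp add: inner_L2_def cinner_self L2_norm_sq_eq_0)
  show "norm x = sqrt (inner x x)"
    by (fact norm_L2_def)
qed

end


section \<open>Operators on \<open>L2\<close>\<close>

definition fourier_integral :: "(real^2 \<Rightarrow> complex) \<Rightarrow> real^2 \<Rightarrow> complex" where
  "fourier_integral f \<xi> = 1 / (2 * pi) * (LINT x|lborel. exp (- \<i> * of_real (inner \<xi> x)) * f x)"

definition unitary :: "(L2 \<Rightarrow> L2) \<Rightarrow> bool" where
  "unitary U \<longleftrightarrow> Vector_Spaces.linear scaleC scaleC U \<and> (\<forall>f. norm (U f) = norm f) \<and> surj U"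

text \<open>
  By Plancherel's theorem there is exactly one such operator, so the description is proper.
\<close>

definition fourier :: "L2 \<Rightarrow> L2" where
  "fourier = (THE U. unitary U \<and>
     (\<forall>f. integrable lborel f \<and> square_integrable f \<longrightarrow>
        (AE \<xi> in lborel. rep_L2 (U (abs_L2 f)) \<xi> = fourier_integral f \<xi>)))"

definition translation :: "real^2 \<Rightarrow> L2 \<Rightarrow> L2" where
  "translation a f = abs_L2 (\<lambda>x. rep_L2 f (x - a))"

definition dilation :: "real^2^2 \<Rightarrow> L2 \<Rightarrow> L2" where
  "dilation M f = abs_L2 (\<lambda>x. of_real (sqrt \<bar>det M\<bar>) * rep_L2 f (M *v x))"

definition op_power_int :: "(L2 \<Rightarrow> L2) \<Rightarrow> int \<Rightarrow> L2 \<Rightarrow> L2" where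
  "op_power_int T n = (if n \<ge> 0 then T ^^ nat n else inv T ^^ nat (- n))"

definition orth_proj :: "L2 set \<Rightarrow> L2 \<Rightarrow> L2" where
  "orth_proj V f = (THE g. g \<in> V \<and> (\<forall>h\<in>V. cinner (f - g) h = 0))"

definition orthonormal_basis_of :: "('i \<Rightarrow> L2) \<Rightarrow> L2 set \<Rightarrow> bool" where
  "orthonormal_basis_of e V \<longleftrightarrow>
     (\<forall>k l. cinner (e k) (e l) = (if k = l then 1 else 0)) \<and> closure (L2.span (range e)) = V"


section \<open>Biscaled multiresolution analyses\<close>

definition int_translate :: "L2 \<Rightarrow> int \<times> int \<Rightarrow> L2" where
  "int_translate \<phi> = (\<lambda>(k1, k2). translation (vector [of_int k1, of_int k2]) \<phi>)"

definition BMRA :: "real^2^2 \<Rightarrow> real^2^2 \<Rightarrow> L2 \<Rightarrow> (int \<Rightarrow> int \<Rightarrow> L2 set) \<Rightarrow> bool" where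
  "BMRA A B \<phi> V \<longleftrightarrow>
     (\<forall>i j. L2.subspace (V i j) \<and> closed (V i j)) \<and>
     (\<forall>i j l m. i \<le> l \<longrightarrow> j \<le> m \<longrightarrow> V i j \<subseteq> V l m) \<and>
     (\<forall>i j. (op_power_int (dilation A) i \<circ> op_power_int (dilation B) j) ` V 0 0 = V i j) \<and>
     (\<Inter>i. \<Inter>j. V i j) = {0} \<and>
     closure (\<Union>i. \<Union>j. V i j) = UNIV \<and>
     (\<forall>i j l m. orth_proj (V i j) \<circ> orth_proj (V l m) = orth_proj (V l m) \<circ> orth_proj (V i j)) \<and>
     orthonormal_basis_of (int_translate \<phi>) (V 0 0)"


section \<open>The rectangles\<close>

definition rect_I :: "nat \<Rightarrow> nat \<Rightarrow> nat \<Rightarrow> (real^2) set" where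
  "rect_I i j k = {\<xi>.
     \<xi>$1 \<in> {(-1)^i * 2^(i + k) * pi/3 <..< (-1)^i * 2^((1 - i) + k) * pi/3} \<and>
     \<xi>$2 \<in> {(-1)^j * 2^(j + (1 - k)) * pi/3 <..< (-1)^j * 2^((1 - j) + (1 - k)) * pi/3}}"

definition rect_J :: "nat \<Rightarrow> nat \<Rightarrow> (real^2) set" where
  "rect_J i j = {\<xi>.
     \<xi>$1 \<in> {- pi/3 + real i * (-1)^j * pi <..< pi/3 + real i * (-1)^j * pi} \<and>
     \<xi>$2 \<in> {- pi/3 + real (1 - i) * (-1)^j * pi <..< pi/3 + real (1 - i) * (-1)^j * pi}}"

definition open_square :: "real \<Rightarrow> real \<Rightarrow> (real^2) set" where
  "open_square a b = {\<xi>. \<xi>$1 \<in> {a<..<b} \<and> \<xi>$2 \<in> {a<..<b}}"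

end

theory Submission
  imports Defs
begin

text \<open>
  On the Fourier side \<open>V\<^sub>0\<^sub>,\<^sub>0\<close> becomes the space \<open>S\<close> of all products \<open>m \<Phi>\<close> with \<open>m\<close> periodic and
  \<open>\<Phi> = 2\<pi> \<phi>h\<close>. The conditions (b)--(f) give \<open>\<Sum>\<^sub>k \<Phi>(\<xi> + 2\<pi>k)\<^sup>2 = 1\<close>, hence orthonormality of the translates, and
  periodic filters \<open>m\<^sub>1\<close>, \<open>m\<^sub>2\<close> with \<open>\<Phi>(2x, y) = m\<^sub>1(x, y) \<Phi>(x, y)\<close> and \<open>\<Phi>(x, 2y) = m\<^sub>2(x, y) \<Phi>(x, y)\<close>,
  hence nestedness. The condition (g) says that on the corner squares \<open>\<Phi>\<^sup>2\<close> is the product of its two partial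
  periodizations; it yields \<open>m\<^sub>1(x, y) m\<^sub>2(x, y) = m\<^sub>2(2x, y) m\<^sub>1(x, 2y)\<close>. Since the orthogonal projection onto \<open>S\<close> is
  \<open>f \<mapsto> \<Sum>\<^sub>k \<Phi> \<Phi>(\<cdot> + 2\<pi>k) f(\<cdot> + 2\<pi>k)\<close>, this identity shows that the projection onto \<open>V\<^sub>i\<^sub>+\<^sub>1\<^sub>,\<^sub>j\<close> maps
  \<open>V\<^sub>i\<^sub>,\<^sub>j\<^sub>+\<^sub>1\<close> into \<open>V\<^sub>i\<^sub>,\<^sub>j\<close>, from which all projections commute. Plancherel's theorem is obtained from Parseval's
  identity for Fourier series, and completeness of the exponentials from the Stone-Weierstrass theorem.
\<close>

section \<open>Diagonal affine maps of the plane\<close>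

text \<open>The hypotheses hold only almost everywhere, yet the edge conditions are iterated along
  x, 2x, 4x, ... and the filters compare values at all lattice translates. So the exceptional null
  sets are enlarged by rational affine maps; off them everything is pointwise algebra. The scaling
  function need not be a product of functions of one variable, so the spaces need not be tensor
  products and commutation is not automatic. In the decisive projection each summand carries a
  factor m1 m2 evaluated at a translate (x', y'), where x' = x + 2 pi k and y' = y + pi l. The
  filter identity turns it into m2(2x', y') m1(x', 2y'); the second factor is the same for all
  translates, leaves the sum, and turns the outer value at (x, 2y) into the value at (2x, 2y), as
  membership in the smaller space demands. The bound 4 pi / 3 does two jobs: being below 2 pi it
  leaves at most two translates per coordinate in the support, and doubling a coordinate beyond 2 pi
  / 3 leaves the support, so the filters vanish off the central square modulo periods.\<close>

definition aff :: "real \<Rightarrow> real \<Rightarrow> real \<Rightarrow> real \<Rightarrow> real^2 \<Rightarrow> real^2" where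
  "aff a b p q x = vector [a * x$1 + p, b * x$2 + q]"

lemma vec2_eq_iff: "(x :: real^2) = y \<longleftrightarrow> x$1 = y$1 \<and> x$2 = y$2"
  by (simp add: vec_eq_iff forall_2)

lemma aff_nth [simp]: "aff a b p q x $ 1 = a * x$1 + p" "aff a b p q x $ 2 = b * x$2 + q"
  by (simp_all add: aff_def)

lemma aff_aff: "aff a b p q (aff a' b' p' q' x) = aff (a * a') (b * b') (a * p' + p) (b * q' + q) x"
  by (simp add: vec2_eq_iff algebra_simps)

lemma aff_id [simp]: "aff 1 1 0 0 x = x"
  by (simp add: vec2_eq_iff)

lemma measurable_aff [measurable]: "aff a b p q \<in> borel \<rightarrow>\<^sub>M borel"
proof -
  have "aff a b p q = (\<lambda>x. vector [p, q] + (a * x$1) *\<^sub>R axis 1 1 + (b * x$2) *\<^sub>R axis 2 1)"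
    by (auto simp: fun_eq_iff vec2_eq_iff axis_def)
  moreover have "continuous_on UNIV \<dots>"
    by (intro continuous_intros)
  ultimately show ?thesis
    by (simp add: borel_measurable_continuous_onI)
qed

lemma lborel_aff:
  assumes "a \<noteq> 0" "b \<noteq> 0"
  shows "lborel = density (distr lborel borel (aff a b p q)) (\<lambda>_. ennreal \<bar>a * b\<bar>)"
proof -
  define c :: "real^2 \<Rightarrow> real" where "c j = (if j = axis 1 1 then a else b)" for j
  have ne: "axis (2::2) (1::real) \<noteq> axis 1 1"
    by (simp add: axis_eq_axis)
  have B: "(Basis :: (real^2) set) = {axis 1 1, axis 2 1}"
    by (auto simp: Basis_vec_def UNIV_2)
  have T: "(\<lambda>x. vector [p, q] + (\<Sum>j\<in>Basis. (c j * (x \<bullet> j)) *\<^sub>R j)) = aff a b p q"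
  proof
    fix x :: "real^2"
    have "(\<Sum>j\<in>Basis. (c j * (x \<bullet> j)) *\<^sub>R j) = (a * x$1) *\<^sub>R axis 1 1 + (b * x$2) *\<^sub>R axis 2 1"
      using ne by (simp add: B c_def inner_axis)
    then show "vector [p, q] + (\<Sum>j\<in>Basis. (c j * (x \<bullet> j)) *\<^sub>R j) = aff a b p q x"
      by (simp add: vec2_eq_iff axis_def)
  qed
  have "lborel = density (distr lborel borel (\<lambda>x. vector [p, q] + (\<Sum>j\<in>Basis. (c j * (x \<bullet> j)) *\<^sub>R j)))
      (\<lambda>_. (\<Prod>j\<in>Basis. \<bar>c j\<bar>))"
    by (rule lborel_affine_euclidean) (use assms in \<open>auto simp: c_def\<close>)
  moreover have "(\<Prod>j\<in>Basis. \<bar>c j\<bar>) = \<bar>a * b\<bar>"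
    using ne by (simp add: B c_def abs_mult)
  ultimately show ?thesis
    unfolding T by simp
qed

text \<open>Lebesgue measure is a nonzero multiple of its image under the map, so null sets have
  null preimages. This lets almost everywhere identities be evaluated at shifted and rescaled
  points.\<close>

lemma AE_aff:
  assumes "AE x in lborel. P x" "a \<noteq> 0" "b \<noteq> 0"
  shows "AE x in lborel. P (aff a b p q x)"
proof -
  obtain N where N: "N \<in> null_sets lborel" "{x \<in> space lborel. \<not> P x} \<subseteq> N"
    using assms(1) by (auto simp: eventually_ae_filter)
  have [measurable]: "N \<in> sets borel"
    using N(1) by auto
  have "AE x in lborel. x \<notin> N"
    using N(1) by (rule AE_not_in)
  then have "AE x in density (distr lborel borel (aff a b p q)) (\<lambda>_. ennreal \<bar>a * b\<bar>). x \<notin> N"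
    using lborel_aff[OF assms(2,3), of p q] by metis
  then have "AE x in lborel. aff a b p q x \<notin> N"
    using assms(2,3) by (simp add: AE_density AE_distr_iff)
  then show ?thesis
    using N(2) by (auto elim!: eventually_mono)
qed

lemma nn_integral_aff:
  assumes [measurable]: "f \<in> borel_measurable borel" and "a \<noteq> 0" "b \<noteq> 0"
  shows "(\<integral>\<^sup>+x. f x \<partial>lborel) = ennreal \<bar>a * b\<bar> * (\<integral>\<^sup>+x. f (aff a b p q x) \<partial>lborel)"
  by (subst lborel_aff[OF assms(2,3), of p q])
     (simp add: nn_integral_density nn_integral_distr nn_integral_cmult)

lemma integrable_aff_iff:
  fixes f :: "real^2 \<Rightarrow> 'b::{banach, second_countable_topology}"
  assumes [measurable]: "f \<in> borel_measurable borel" and "a \<noteq> 0" "b \<noteq> 0"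
  shows "integrable lborel (\<lambda>x. f (aff a b p q x)) \<longleftrightarrow> integrable lborel f"
  unfolding integrable_iff_bounded nn_integral_aff[of "\<lambda>x. ennreal (norm (f x))" a b p q, simplified, OF assms(2,3)]
  using assms(2,3) by (auto simp: ennreal_mult_less_top)

lemma integral_aff:
  fixes f :: "real^2 \<Rightarrow> 'b::{banach, second_countable_topology}"
  assumes [measurable]: "f \<in> borel_measurable borel" and "a \<noteq> 0" "b \<noteq> 0"
  shows "(LINT x|lborel. f x) = \<bar>a * b\<bar> *\<^sub>R (LINT x|lborel. f (aff a b p q x))"
  by (subst lborel_aff[OF assms(2,3), of p q])
     (simp add: integral_density integral_distr)


section \<open>Representatives of elements of \<open>L2\<close>\<close>

lemma square_integrable_measurable [measurable_dest]:
  "square_integrable f \<Longrightarrow> f \<in> borel_measurable borel"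
  by (simp add: square_integrable_def)

lemma square_integrable_cong_AE:
  assumes "square_integrable f" "g \<in> borel_measurable borel" "AE x in lborel. f x = g x"
  shows "square_integrable g"
proof -
  have "integrable lborel (\<lambda>x. (cmod (f x))\<^sup>2) \<longleftrightarrow> integrable lborel (\<lambda>x. (cmod (g x))\<^sup>2)"
    using assms by (intro integrable_cong_AE) (auto elim!: eventually_mono)
  then show ?thesis
    using assms by (simp add: square_integrable_def)
qed

lemma L2_eq_self_iff: "L2_eq f f \<longleftrightarrow> square_integrable f"
  by (auto simp: L2_eq_def)

lemma square_integrable_rep_L2 [simp]: "square_integrable (rep_L2 f)"
  using Quotient3_rep_reflp[OF Quotient3_L2] by (simp add: L2_eq_self_iff)

lemma measurable_rep_L2 [measurable, simp]: "rep_L2 f \<in> borel_measurable borel"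
  using square_integrable_rep_L2[of f] by measurable

lemma abs_L2_rep_L2 [simp]: "abs_L2 (rep_L2 f) = f"
  by (rule Quotient3_abs_rep[OF Quotient3_L2])

lemma abs_L2_eq_iff:
  assumes "square_integrable f" "square_integrable g"
  shows "abs_L2 f = abs_L2 g \<longleftrightarrow> (AE x in lborel. f x = g x)"
  using Quotient3_rel[OF Quotient3_L2, of f g] assms by (auto simp: L2_eq_def)

text \<open>\<open>rep_L2\<close> picks an arbitrary member of the class, so every pointwise
  identity between representatives is only an almost everywhere one.\<close>

lemma rep_L2_abs_L2:
  assumes "square_integrable f"
  shows "AE x in lborel. rep_L2 (abs_L2 f) x = f x"
  using abs_L2_eq_iff[of "rep_L2 (abs_L2 f)" f] assms by simp

lemma L2_eq_iff: "f = g \<longleftrightarrow> (AE x in lborel. rep_L2 f x = rep_L2 g x)"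
  using abs_L2_eq_iff[of "rep_L2 f" "rep_L2 g"] by simp

lemma abs_L2_add:
  assumes "square_integrable f" "square_integrable g"
  shows "abs_L2 f + abs_L2 g = abs_L2 (\<lambda>x. f x + g x)"
  using assms by (intro plus_L2.abs_eq) (auto simp: L2_eq_self_iff)

lemma abs_L2_scaleC:
  assumes "square_integrable f"
  shows "c *\<^sub>C abs_L2 f = abs_L2 (\<lambda>x. c * f x)"
  using assms by (intro scaleC.abs_eq) (auto simp: L2_eq_self_iff)

lemma rep_L2_add: "AE x in lborel. rep_L2 (f + g) x = rep_L2 f x + rep_L2 g x"
  using rep_L2_abs_L2[of "\<lambda>x. rep_L2 f x + rep_L2 g x"] abs_L2_add[of "rep_L2 f" "rep_L2 g"]
  by (simp add: square_integrable_add)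

lemma rep_L2_scaleC: "AE x in lborel. rep_L2 (c *\<^sub>C f) x = c * rep_L2 f x"
  using rep_L2_abs_L2[of "\<lambda>x. c * rep_L2 f x"] abs_L2_scaleC[of "rep_L2 f" c]
  by (simp add: square_integrable_scale)

lemma rep_L2_diff: "AE x in lborel. rep_L2 (f - g) x = rep_L2 f x - rep_L2 g x"
proof -
  have "AE x in lborel. rep_L2 (f + (-1) *\<^sub>C g) x = rep_L2 f x + rep_L2 ((-1) *\<^sub>C g) x"
    by (rule rep_L2_add)
  moreover have "AE x in lborel. rep_L2 ((-1) *\<^sub>C g) x = - 1 * rep_L2 g x"
    by (rule rep_L2_scaleC)
  moreover have "f + (-1) *\<^sub>C g = f - g"
    by simp
  ultimately show ?thesis
    by (auto elim: AE_mp)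
qed

lemma rep_L2_0: "AE x in lborel. rep_L2 0 x = 0"
  using rep_L2_scaleC[of 0 0] by simp

lemma rep_L2_sum: "AE x in lborel. rep_L2 (\<Sum>i\<in>I. f i) x = (\<Sum>i\<in>I. rep_L2 (f i) x)"
proof (induction I rule: infinite_finite_induct)
  case (insert i I)
  then show ?case
    using rep_L2_add[of "f i" "sum f I"] by (auto elim: AE_mp)
qed (auto simp: rep_L2_0)

lemma L2_eq_0_iff: "f = 0 \<longleftrightarrow> (AE x in lborel. rep_L2 f x = 0)"
proof -
  have "AE x in lborel. (rep_L2 f x = rep_L2 0 x) = (rep_L2 f x = 0)"
    using rep_L2_0 by eventually_elim simp
  then show ?thesis
    unfolding L2_eq_iff[of f 0] by (rule eventually_subst)
qed

lemma cinner_rep: "cinner f g = (LINT x|lborel. rep_L2 f x * cnj (rep_L2 g x))"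
  using cinner.abs_eq[of "rep_L2 f" "rep_L2 g"] by (simp add: L2_eq_self_iff)

lemma cinner_abs:
  "square_integrable f \<Longrightarrow> square_integrable g \<Longrightarrow>
    cinner (abs_L2 f) (abs_L2 g) = (LINT x|lborel. f x * cnj (g x))"
  by (rule cinner.abs_eq) (simp_all add: L2_eq_self_iff)

lemma L2_norm_sq_norm: "L2_norm_sq f = (norm f)\<^sup>2"
proof -
  have "(norm f)\<^sup>2 = Re (cinner f f)"
    by (simp add: power2_norm_eq_inner inner_L2_def)
  then show ?thesis by (simp add: cinner_self)
qed

lemma cinner_self_norm: "cinner f f = of_real ((norm f)\<^sup>2)"
  by (simp only: cinner_self L2_norm_sq_norm)

lemma norm_abs_L2:
  assumes "square_integrable f"
  shows "(norm (abs_L2 f))\<^sup>2 = (LINT x|lborel. (cmod (f x))\<^sup>2)"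
  using L2_norm_sq.abs_eq[of f] assms by (simp add: L2_eq_self_iff L2_norm_sq_norm)

lemma norm_rep: "(norm f)\<^sup>2 = (LINT x|lborel. (cmod (rep_L2 f x))\<^sup>2)"
  using norm_abs_L2[of "rep_L2 f"] by simp

lemma ennreal_norm_abs_L2:
  assumes "square_integrable f"
  shows "ennreal ((norm (abs_L2 f))\<^sup>2) = (\<integral>\<^sup>+x. ennreal ((cmod (f x))\<^sup>2) \<partial>lborel)"
  unfolding norm_abs_L2[OF assms]
  using assms by (intro nn_integral_eq_integral[symmetric]) (auto simp: square_integrable_def)

lemma square_integrableI:
  assumes "f \<in> borel_measurable borel" "(\<integral>\<^sup>+x. ennreal ((cmod (f x))\<^sup>2) \<partial>lborel) < \<infinity>"
  shows "square_integrable f"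
  unfolding square_integrable_def integrable_iff_bounded using assms by auto

lemma square_integrable_nn:
  assumes "square_integrable f"
  shows "(\<integral>\<^sup>+x. ennreal ((cmod (f x))\<^sup>2) \<partial>lborel) < \<infinity>"
  using ennreal_norm_abs_L2[OF assms] by (metis ennreal_less_top infinity_ennreal_def)

lemma square_integrable_diff:
  "square_integrable f \<Longrightarrow> square_integrable g \<Longrightarrow> square_integrable (\<lambda>x. f x - g x)"
  using square_integrable_add[of f "\<lambda>x. - g x"] square_integrable_uminus[of g] by simp

lemma abs_L2_diff:
  assumes "square_integrable f" "square_integrable g"
  shows "abs_L2 f - abs_L2 g = abs_L2 (\<lambda>x. f x - g x)"
proof -
  have "abs_L2 f - abs_L2 g = abs_L2 f + (-1) *\<^sub>C abs_L2 g"
    by simp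
  also have "\<dots> = abs_L2 (\<lambda>x. f x + (-1) * g x)"
    unfolding abs_L2_scaleC[OF assms(2)]
    by (rule abs_L2_add[OF assms(1) square_integrable_scale[OF assms(2)]])
  finally show ?thesis by simp
qed

lemma square_integrable_bounded_mult:
  assumes "square_integrable f" and [measurable]: "u \<in> borel_measurable borel"
    and "\<And>x. cmod (u x) \<le> C"
  shows "square_integrable (\<lambda>x. u x * f x)"
proof (rule square_integrableI)
  note [measurable] = square_integrable_measurable[OF assms(1)]
  show "(\<lambda>x. u x * f x) \<in> borel_measurable borel" by measurable
  have "(\<integral>\<^sup>+x. ennreal ((cmod (u x * f x))\<^sup>2) \<partial>lborel) \<le> (\<integral>\<^sup>+x. ennreal ((C\<^sup>2) * (cmod (f x))\<^sup>2) \<partial>lborel)"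
    using assms(3) by (intro nn_integral_mono ennreal_leI)
      (auto simp: norm_mult power_mult_distrib intro!: mult_right_mono power_mono)
  also have "\<dots> = ennreal (C\<^sup>2) * (\<integral>\<^sup>+x. ennreal ((cmod (f x))\<^sup>2) \<partial>lborel)"
    by (subst nn_integral_cmult[symmetric]) (auto simp: ennreal_mult)
  also have "\<dots> < \<infinity>"
    using square_integrable_nn[OF assms(1)] by (simp add: ennreal_mult_less_top)
  finally show "(\<integral>\<^sup>+x. ennreal ((cmod (u x * f x))\<^sup>2) \<partial>lborel) < \<infinity>" .
qed

lemma cinner_diff_left: "cinner (f - g) h = cinner f h - cinner g h"
  using cinner_add_left[of "f - g" g h] by simp

lemma cinner_add_right: "cinner h (f + g) = cinner h f + cinner h g"
  by (metis cinner_add_left cinner_commute complex_cnj_add)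

lemma cinner_diff_right: "cinner h (f - g) = cinner h f - cinner h g"
  using cinner_add_right[of h "f - g" g] by simp

lemma cinner_scaleC_right: "cinner h (c *\<^sub>C f) = cnj c * cinner h f"
  by (metis cinner_scaleC_left cinner_commute complex_cnj_mult)

lemma cinner_zero [simp]: "cinner 0 f = 0" "cinner f 0 = 0"
  using cinner_diff_left[of f f f] cinner_diff_right[of f f f] by auto

lemma cinner_sum_left: "cinner (\<Sum>i\<in>I. f i) h = (\<Sum>i\<in>I. cinner (f i) h)"
  by (induction I rule: infinite_finite_induct) (auto simp: cinner_add_left)

lemma cinner_sum_right: "cinner h (\<Sum>i\<in>I. f i) = (\<Sum>i\<in>I. cinner h (f i))"
  by (induction I rule: infinite_finite_induct) (auto simp: cinner_add_right)

lemma norm_scaleC: "norm (c *\<^sub>C f) = cmod c * norm f"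
proof (rule power2_eq_imp_eq)
  have "complex_of_real ((norm (c *\<^sub>C f))\<^sup>2) = of_real ((cmod c)\<^sup>2 * (norm f)\<^sup>2)"
    unfolding cinner_self_norm[symmetric] cinner_scaleC_left cinner_scaleC_right of_real_mult
    by (simp only: complex_norm_square ac_simps)
  then show "(norm (c *\<^sub>C f))\<^sup>2 = (cmod c * norm f)\<^sup>2"
    unfolding of_real_eq_iff by (simp add: power_mult_distrib)
qed auto

lemma scaleR_eq_scaleC: "r *\<^sub>R f = of_real r *\<^sub>C (f :: L2)"
  by (fact scaleR_L2_def)

lemma norm_cinner_le: "cmod (cinner f g) \<le> norm f * norm g"
proof (cases "cinner f g = 0")
  case False
  \<comment> \<open>This phase makes the inner product real and nonnegative, which reduces the claim
    to the Cauchy-Schwarz inequality for its real part.\<close>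
  define u where "u = cnj (cinner f g) / of_real (cmod (cinner f g))"
  have u: "cmod u = 1" using False by (simp add: u_def norm_divide)
  have "u * cinner f g = of_real (cmod (cinner f g))"
    using False by (simp add: u_def complex_norm_square[symmetric] mult.commute power2_eq_square)
  then have "cmod (cinner f g) = inner (u *\<^sub>C f) g"
    by (simp add: inner_L2_def cinner_scaleC_left)
  also have "\<dots> \<le> norm (u *\<^sub>C f) * norm g"
    by (rule norm_cauchy_schwarz)
  finally show ?thesis using u by (simp add: norm_scaleC)
qed auto

lemma tendsto_cinner:
  assumes "(f \<longlongrightarrow> a) F" "(g \<longlongrightarrow> b) F"
  shows "((\<lambda>x. cinner (f x) (g x)) \<longlongrightarrow> cinner a b) F"
proof -
  interpret bounded_bilinear cinner
  proof
    show "\<exists>K. \<forall>a b. norm (cinner a b) \<le> norm a * norm b * K"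
      using norm_cinner_le by (intro exI[of _ 1]) auto
  qed (auto simp: cinner_add_left cinner_add_right scaleR_eq_scaleC cinner_scaleC_left
        cinner_scaleC_right scaleR_conv_of_real)
  show ?thesis by (rule tendsto[OF assms])
qed

lemma tendsto_scaleC: "(f \<longlongrightarrow> a) F \<Longrightarrow> ((\<lambda>x. c *\<^sub>C f x) \<longlongrightarrow> c *\<^sub>C a) F"
proof -
  interpret bounded_linear "\<lambda>f. c *\<^sub>C f"
    by standard (auto simp: L2.scale_right_distrib scaleR_eq_scaleC mult.commute norm_scaleC intro!: exI[of _ "cmod c"])
  show "(f \<longlongrightarrow> a) F \<Longrightarrow> ((\<lambda>x. c *\<^sub>C f x) \<longlongrightarrow> c *\<^sub>C a) F"
    by (rule tendsto)
qed

section \<open>Completeness and orthogonal projections\<close>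

lemma norm_abs_L2_le:
  assumes "f \<in> borel_measurable borel" "0 \<le> e"
    and "(\<integral>\<^sup>+x. ennreal ((cmod (f x))\<^sup>2) \<partial>lborel) \<le> ennreal (e\<^sup>2)"
  shows "square_integrable f" "norm (abs_L2 f) \<le> e"
proof -
  show sq: "square_integrable f"
    using assms by (intro square_integrableI) (auto simp: le_less_trans)
  have "ennreal ((norm (abs_L2 f))\<^sup>2) \<le> ennreal (e\<^sup>2)"
    using assms(3) ennreal_norm_abs_L2[OF sq] by simp
  then show "norm (abs_L2 f) \<le> e"
    using assms(2) by (auto simp: ennreal_le_iff intro: power2_le_imp_le)
qed

lemma ennreal_norm_diff:
  "(\<integral>\<^sup>+x. ennreal ((cmod (rep_L2 f x - rep_L2 g x))\<^sup>2) \<partial>lborel) = ennreal ((norm (f - g))\<^sup>2)"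
  using ennreal_norm_abs_L2[of "\<lambda>x. rep_L2 f x - rep_L2 g x"] abs_L2_diff[of "rep_L2 f" "rep_L2 g"]
  by (simp add: square_integrable_diff)

lemma Cauchy_fast_subseq:
  fixes X :: "nat \<Rightarrow> 'a::metric_space"
  assumes "Cauchy X" "\<And>n. 0 < e n"
  obtains r where "strict_mono r" "\<And>n. dist (X (r (Suc n))) (X (r n)) < e n"
proof -
  have "\<forall>n. \<exists>N. \<forall>m\<ge>N. \<forall>k\<ge>N. dist (X m) (X k) < e n"
    using assms by (simp add: Cauchy_def)
  then obtain N where N: "\<And>n m k. m \<ge> N n \<Longrightarrow> k \<ge> N n \<Longrightarrow> dist (X m) (X k) < e n"
    by metis
  \<comment> \<open>The partial sums dominate each \<open>N n\<close>; the summand \<open>n\<close>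
    makes \<open>r\<close> strictly increasing.\<close>
  define r where "r n = (\<Sum>i\<le>n. N i) + n" for n
  have "r n < r (Suc n)" for n by (simp add: r_def)
  then have r: "strict_mono r" by (simp add: strict_mono_Suc_iff)
  have "N n \<le> r n" for n
    using member_le_sum[of n "{..n}" N] by (simp add: r_def)
  moreover have "r n \<le> r (Suc n)" for n
    using r by (simp add: strict_mono_Suc_iff less_imp_le)
  ultimately have "dist (X (r (Suc n))) (X (r n)) < e n" for n
    using N[of n "r (Suc n)" "r n"] order_trans by blast
  with r that show thesis by blast
qed

text \<open>Weighting the squared increments by \<open>2\<^sup>n\<close> lets linearity of the integral replace Minkowski's inequality.\<close>

lemma L2_fast_Cauchy_AE:
  fixes X :: "nat \<Rightarrow> L2"
  assumes "\<And>n. dist (X (Suc n)) (X n) < (1/2) ^ n"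
  shows "AE x in lborel. convergent (\<lambda>n. rep_L2 (X n) x)"
proof -
  define D where "D n x = cmod (rep_L2 (X (Suc n)) x - rep_L2 (X n) x)" for n x
  have [measurable]: "D n \<in> borel_measurable borel" for n
    unfolding D_def by measurable
  have le: "(\<integral>\<^sup>+x. ennreal (2^n * (D n x)\<^sup>2) \<partial>lborel) \<le> ennreal ((1/2)^n)" for n
  proof -
    have "(\<integral>\<^sup>+x. ennreal (2^n * (D n x)\<^sup>2) \<partial>lborel) = ennreal (2^n) * (\<integral>\<^sup>+x. ennreal ((D n x)\<^sup>2) \<partial>lborel)"
      by (subst nn_integral_cmult[symmetric]) (auto simp: ennreal_mult)
    also have "\<dots> = ennreal (2^n * (norm (X (Suc n) - X n))\<^sup>2)"
      by (simp add: D_def ennreal_norm_diff ennreal_mult)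
    also have "\<dots> \<le> ennreal (2^n * ((1/2)^n)\<^sup>2)"
      using assms[of n] by (intro ennreal_leI mult_left_mono power_mono) (auto simp: dist_norm)
    \<comment> \<open>The weight uses up one of the two factors from the square: the weighted
      squares stay summable in the mean, and their boundedness at a point forces
      \<open>D n x\<close> to decay like 2^(-n/2).\<close>
    also have "2^n * ((1/2)^n)\<^sup>2 = (1/2::real)^n"
      by (simp add: power2_eq_square power_mult_distrib[symmetric] field_simps)
    finally show ?thesis .
  qed
  have "(\<integral>\<^sup>+x. (\<Sum>n. ennreal (2^n * (D n x)\<^sup>2)) \<partial>lborel) = (\<Sum>n. \<integral>\<^sup>+x. ennreal (2^n * (D n x)\<^sup>2) \<partial>lborel)"
    by (intro nn_integral_suminf) measurable
  also have "\<dots> \<le> (\<Sum>n. ennreal ((1/2)^n))"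
    by (intro suminf_le le) auto
  also have "\<dots> = ennreal (\<Sum>n. (1/2)^n)"
    by (intro suminf_ennreal2) auto
  also have "\<dots> < \<infinity>" by simp
  finally have "(\<integral>\<^sup>+x. (\<Sum>n. ennreal (2^n * (D n x)\<^sup>2)) \<partial>lborel) \<noteq> \<infinity>" by simp
  then have "AE x in lborel. (\<Sum>n. ennreal (2^n * (D n x)\<^sup>2)) \<noteq> \<infinity>"
    by (intro nn_integral_PInf_AE) auto
  then show ?thesis
  proof eventually_elim
    case (elim x)
    then have "summable (\<lambda>n. 2^n * (D n x)\<^sup>2)"
      by (intro summable_suminf_not_top) auto
    then have "Bseq (\<lambda>n. 2^n * (D n x)\<^sup>2)"
      using summable_LIMSEQ_zero convergentI Bseq_eq_bounded convergent_imp_Bseq by blast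
    then obtain C where C: "\<And>n. \<bar>2^n * (D n x)\<^sup>2\<bar> \<le> C" "C > 0"
      by (auto simp: Bseq_def)
    have "summable (\<lambda>n. D n x)"
    proof (rule summable_comparison_test')
      show "summable (\<lambda>n. sqrt C * (1 / sqrt 2) ^ n)"
        by (intro summable_mult summable_geometric) auto
      fix n
      have "(D n x)\<^sup>2 \<le> C * (1/2)^n"
        using C(1)[of n] by (simp add: field_simps)
      then have "D n x \<le> sqrt (C * (1/2)^n)"
        by (rule real_le_rsqrt)
      moreover have "0 \<le> D n x" by (simp add: D_def)
      ultimately show "norm (D n x) \<le> sqrt C * (1 / sqrt 2) ^ n"
        by (simp add: real_sqrt_mult real_sqrt_power real_sqrt_divide power_divide)
    qed
    then have "summable (\<lambda>n. rep_L2 (X (Suc n)) x - rep_L2 (X n) x)"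
      by (auto simp: D_def intro: summable_norm_cancel)
    then have "convergent (\<lambda>n. (\<Sum>k<n. rep_L2 (X (Suc k)) x - rep_L2 (X k) x))"
      by (simp add: summable_iff_convergent)
    moreover have "(\<Sum>k<n. rep_L2 (X (Suc k)) x - rep_L2 (X k) x) = rep_L2 (X n) x - rep_L2 (X 0) x" for n
      using sum_lessThan_telescope[of "\<lambda>n. rep_L2 (X n) x" n] by simp
    ultimately have "convergent (\<lambda>n. (rep_L2 (X n) x - rep_L2 (X 0) x) + rep_L2 (X 0) x)"
      by (intro convergent_add convergent_const) simp
    then show ?case by simp
  qed
qed

text \<open>Riesz-Fischer: a fast subsequence converges almost everywhere, Fatou's lemma upgrades
  this to convergence in norm, and the Cauchy property carries it to the whole sequence.\<close>

lemma L2_Cauchy_convergent: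
  fixes X :: "nat \<Rightarrow> L2"
  assumes "Cauchy X"
  shows "convergent X"
proof -
  obtain r where r: "strict_mono r" "\<And>n. dist (X (r (Suc n))) (X (r n)) < (1/2) ^ n"
    using Cauchy_fast_subseq[OF assms, of "\<lambda>n. (1/2)^n"] by auto
  define Y where "Y n = rep_L2 (X (r n))" for n
  have [measurable]: "Y n \<in> borel_measurable borel" for n
    by (simp add: Y_def)
  define f where "f x = lim (\<lambda>n. Y n x)" for x
  have [measurable]: "f \<in> borel_measurable borel"
    unfolding f_def by measurable
  have lim: "AE x in lborel. (\<lambda>n. Y n x) \<longlonglongrightarrow> f x"
    using L2_fast_Cauchy_AE[of "X \<circ> r"] r(2)
    by (auto simp: f_def Y_def convergent_LIMSEQ_iff elim!: eventually_mono)
  have CY: "Cauchy (\<lambda>n. X (r n))"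
    using Cauchy_subseq_Cauchy[OF assms r(1)] by (simp add: comp_def)
  have bound: "\<exists>N. \<forall>n\<ge>N. square_integrable (\<lambda>x. f x - Y n x) \<and> norm (abs_L2 (\<lambda>x. f x - Y n x)) \<le> e"
    if "e > 0" for e
  proof -
    obtain N where N: "\<And>m n. m \<ge> N \<Longrightarrow> n \<ge> N \<Longrightarrow> norm (X (r m) - X (r n)) < e"
      using CY \<open>e > 0\<close> unfolding Cauchy_def dist_norm by meson
    have "(\<integral>\<^sup>+x. ennreal ((cmod (f x - Y n x))\<^sup>2) \<partial>lborel) \<le> ennreal (e\<^sup>2)" if "n \<ge> N" for n
    proof -
      \<comment> \<open>Preparation for Fatou's lemma, with \<open>n\<close> fixed and
        \<open>m\<close> tending to infinity.\<close>
      have "AE x in lborel. ennreal ((cmod (f x - Y n x))\<^sup>2)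
          = liminf (\<lambda>m. ennreal ((cmod (Y m x - Y n x))\<^sup>2))"
        using lim
      proof eventually_elim
        case (elim x)
        have "(\<lambda>m. ennreal ((cmod (Y m x - Y n x))\<^sup>2)) \<longlonglongrightarrow> ennreal ((cmod (f x - Y n x))\<^sup>2)"
          by (intro tendsto_ennrealI tendsto_intros elim)
        then show ?case
          by (rule lim_imp_Liminf[OF trivial_limit_sequentially, symmetric])
      qed
      then have "(\<integral>\<^sup>+x. ennreal ((cmod (f x - Y n x))\<^sup>2) \<partial>lborel)
          = (\<integral>\<^sup>+x. liminf (\<lambda>m. ennreal ((cmod (Y m x - Y n x))\<^sup>2)) \<partial>lborel)"
        by (rule nn_integral_cong_AE)
      also have "\<dots> \<le> liminf (\<lambda>m. \<integral>\<^sup>+x. ennreal ((cmod (Y m x - Y n x))\<^sup>2) \<partial>lborel)"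
        by (rule nn_integral_liminf) measurable
      also have "\<dots> \<le> ennreal (e\<^sup>2)"
      proof (rule Liminf_le)
        have "(\<integral>\<^sup>+x. ennreal ((cmod (Y m x - Y n x))\<^sup>2) \<partial>lborel) \<le> ennreal (e\<^sup>2)" if "m \<ge> N" for m
          unfolding Y_def ennreal_norm_diff
          using N[OF that \<open>n \<ge> N\<close>] by (intro ennreal_leI power_mono) auto
        then show "\<forall>\<^sub>F m in sequentially. (\<integral>\<^sup>+x. ennreal ((cmod (Y m x - Y n x))\<^sup>2) \<partial>lborel) \<le> ennreal (e\<^sup>2)"
          by (auto simp: eventually_sequentially)
      qed auto
      finally show ?thesis .
    qed
    then show ?thesis
      using norm_abs_L2_le[of "\<lambda>x. f x - Y n x" e for n] \<open>e > 0\<close>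
      by (intro exI[of _ N] allI impI conjI) (auto simp: less_imp_le)
  qed
  \<comment> \<open>The limit is square integrable because it differs from some \<open>Y N\<close>
    by a square integrable function.\<close>
  obtain N where "square_integrable (\<lambda>x. f x - Y N x)"
    using bound[of 1] by auto
  then have "square_integrable (\<lambda>x. (f x - Y N x) + Y N x)"
    by (rule square_integrable_add) (simp add: Y_def)
  then have sq: "square_integrable f" by simp
  have "abs_L2 (\<lambda>x. f x - Y n x) = abs_L2 f - X (r n)" for n
    using abs_L2_diff[OF sq, of "Y n"] by (simp add: Y_def)
  then have bound': "\<exists>N. \<forall>n\<ge>N. norm (abs_L2 f - X (r n)) \<le> e" if "e > 0" for e
    using bound[OF that] by auto
  have "(X \<circ> r) \<longlonglongrightarrow> abs_L2 f"
  proof (rule LIMSEQ_I)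
    fix e :: real assume "e > 0"
    then obtain N where N: "\<And>n. n \<ge> N \<Longrightarrow> norm (abs_L2 f - X (r n)) \<le> e / 2"
      using bound'[of "e/2"] by auto
    have "norm ((X \<circ> r) n - abs_L2 f) < e" if "n \<ge> N" for n
      using N[OF that] norm_minus_commute[of "abs_L2 f" "X (r n)"] \<open>e > 0\<close> by simp
    then show "\<exists>N. \<forall>n\<ge>N. norm ((X \<circ> r) n - abs_L2 f) < e" by blast
  qed
  then have "X \<longlonglongrightarrow> abs_L2 f"
    using Cauchy_converges_subseq[OF assms r(1)] by (simp add: comp_def)
  then show ?thesis by (rule convergentI)
qed

instance L2 :: banach
  by standard (fact L2_Cauchy_convergent)

text \<open>Carries pointwise conditions on representatives over to norm limits, which is how
  subspaces cut out by such conditions are seen to be closed.\<close>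

lemma L2_AE_subseq:
  assumes "(f \<longlongrightarrow> a) sequentially"
  obtains r where "strict_mono r" "AE x in lborel. (\<lambda>n. rep_L2 (f (r n)) x) \<longlonglongrightarrow> rep_L2 a x"
proof -
  define u where "u n x = (cmod (rep_L2 (f n) x - rep_L2 a x))\<^sup>2" for n x
  have "\<exists>r. strict_mono r \<and> (AE x in lborel. (\<lambda>n. u (r n) x) \<longlonglongrightarrow> 0)"
  proof (rule tendsto_L1_AE_subseq)
    have "square_integrable (\<lambda>x. rep_L2 (f n) x - rep_L2 a x)" for n
      by (intro square_integrable_diff) auto
    then show "integrable lborel (u n)" for n
      by (simp add: u_def[abs_def] square_integrable_def)
    have "(LINT x|lborel. norm (u n x)) = (norm (f n - a))\<^sup>2" for n
      using norm_abs_L2[of "\<lambda>x. rep_L2 (f n) x - rep_L2 a x"] abs_L2_diff[of "rep_L2 (f n)" "rep_L2 a"]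
      by (simp add: u_def square_integrable_diff)
    moreover have "(\<lambda>n. (norm (f n - a))\<^sup>2) \<longlonglongrightarrow> 0\<^sup>2"
      using assms by (intro tendsto_power tendsto_norm_zero) (simp add: LIM_zero)
    ultimately show "(\<lambda>n. LINT x|lborel. norm (u n x)) \<longlonglongrightarrow> 0" by simp
  qed
  then obtain r where r: "strict_mono r" and lim: "AE x in lborel. (\<lambda>n. u (r n) x) \<longlonglongrightarrow> 0"
    by blast
  from lim have "AE x in lborel. (\<lambda>n. rep_L2 (f (r n)) x) \<longlonglongrightarrow> rep_L2 a x"
  proof eventually_elim
    case (elim x)
    then have "(\<lambda>n. sqrt (u (r n) x)) \<longlonglongrightarrow> sqrt 0"
      by (rule tendsto_real_sqrt)
    then show ?case
      by (simp add: u_def tendsto_norm_zero_iff LIM_zero_iff)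
  qed
  with r that show thesis by blast
qed

text \<open>Expanding \<open>\<parallel>f - g + c h\<parallel>\<^sup>2\<close> with \<open>c\<close> a small multiple of \<open>\<langle>f - g, h\<rangle>\<close> shows that a closest point is an orthogonal projection.\<close>

lemma closest_imp_orthogonal:
  assumes V: "L2.subspace V" and g: "g \<in> V" and min: "\<And>h. h \<in> V \<Longrightarrow> norm (f - g) \<le> norm (f - h)"
    and h: "h \<in> V"
  shows "cinner (f - g) h = 0"
proof -
  define z where "z = cinner (f - g) h"
  have key: "2 * t * (cmod z)\<^sup>2 \<le> t\<^sup>2 * (cmod z)\<^sup>2 * (norm h)\<^sup>2" for t :: real
  proof -
    define c where "c = of_real t * z"
    have "g + c *\<^sub>C h \<in> V"
      using V g h by (intro L2.subspace_add L2.subspace_scale)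
    then have "norm (f - g) \<le> norm (f - g - c *\<^sub>C h)"
      using min by (simp add: algebra_simps)
    then have "(norm (f - g))\<^sup>2 \<le> (norm (f - g - c *\<^sub>C h))\<^sup>2"
      by (intro power_mono) auto
    also have "\<dots> = (norm (f - g))\<^sup>2 - 2 * inner (f - g) (c *\<^sub>C h) + (norm (c *\<^sub>C h))\<^sup>2"
      by (simp add: power2_norm_eq_inner inner_diff inner_commute algebra_simps)
    also have "inner (f - g) (c *\<^sub>C h) = t * (cmod z)\<^sup>2"
      by (simp add: inner_L2_def cinner_scaleC_right c_def z_def[symmetric] cmod_power2) (simp add: power2_eq_square algebra_simps)
    finally show ?thesis
      by (simp add: norm_scaleC c_def norm_mult power_mult_distrib)
  qed
  have "(cmod z)\<^sup>2 \<le> 0"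
  proof (cases "norm h = 0")
    case True
    then show ?thesis using key[of 1] by simp
  next
    case False
    then have n: "(norm h)\<^sup>2 > 0" by simp
    \<comment> \<open>This \<open>t\<close> minimises t^2 (norm h)^2 - 2 t, so it gives the sharpest
      instance of \<open>key\<close>.\<close>
    from key[of "1 / (norm h)\<^sup>2"] show ?thesis
      using n False by (simp add: field_simps power2_eq_square)
  qed
  then show ?thesis by (simp add: z_def)
qed

text \<open>A minimising sequence is Cauchy by the parallelogram law, since midpoints stay in
  \<open>V\<close> and are no closer to \<open>f\<close> than the infimum. Its limit is a closest
  point.\<close>

lemma orthogonal_projection_exists:
  assumes V: "L2.subspace V" and cl: "closed V"
  obtains g where "g \<in> V" "\<And>h. h \<in> V \<Longrightarrow> cinner (f - g) h = 0"
proof -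
  define d where "d = infdist f V"
  have ne: "V \<noteq> {}" using V L2.subspace_0 by blast
  have ex: "\<exists>h\<in>V. norm (f - h) < d + inverse (Suc n)" for n
  proof (rule ccontr)
    assume "\<not> ?thesis"
    then have "d + inverse (Suc n) \<le> infdist f V"
      using ne by (auto simp: infdist_notempty dist_norm not_less intro!: cINF_greatest)
    then show False by (simp add: d_def)
  qed
  then obtain X where X: "\<And>n. X n \<in> V" "\<And>n. norm (f - X n) < d + inverse (Suc n)"
    by metis
  have d_le: "d \<le> norm (f - h)" if "h \<in> V" for h
    using infdist_le[OF that, of f] by (simp add: d_def dist_norm)
  have d0: "0 \<le> d" by (simp add: d_def infdist_nonneg)
  have par: "(norm (X m - X n))\<^sup>2 \<le> (4 * d + 2) * (inverse (Suc m) + inverse (Suc n))" for m n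
  proof -
    have "(1/2) *\<^sub>R (X m + X n) \<in> V"
      using V X(1) by (auto simp: scaleR_eq_scaleC intro!: L2.subspace_scale L2.subspace_add)
    then have "d \<le> norm (f - (1/2) *\<^sub>R (X m + X n))"
      by (rule d_le)
    then have "4 * d\<^sup>2 \<le> 4 * (norm (f - (1/2) *\<^sub>R (X m + X n)))\<^sup>2"
      using d0 by (intro mult_left_mono power_mono) auto
    also have "\<dots> = (norm ((f - X m) + (f - X n)))\<^sup>2"
    proof -
      have "(f - X m) + (f - X n) = 2 *\<^sub>R (f - (1/2) *\<^sub>R (X m + X n))"
        by (simp add: algebra_simps scaleR_2)
      then show ?thesis by (simp only: norm_scaleR power_mult_distrib) simp
    qed
    finally have 1: "4 * d\<^sup>2 \<le> (norm ((f - X m) + (f - X n)))\<^sup>2" .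
    have 2: "(norm ((f - X m) + (f - X n)))\<^sup>2 + (norm ((f - X n) - (f - X m)))\<^sup>2
        = 2 * (norm (f - X m))\<^sup>2 + 2 * (norm (f - X n))\<^sup>2"
      by (simp add: power2_norm_eq_inner inner_diff_left inner_diff_right inner_add_left inner_add_right inner_commute)
    have 3: "(norm (f - X k))\<^sup>2 \<le> d\<^sup>2 + (2 * d + 1) * inverse (Suc k)" for k
    proof -
      let ?i = "inverse (real (Suc k))"
      have i: "0 \<le> ?i" "?i \<le> 1" by (auto simp: field_simps)
      have "(norm (f - X k))\<^sup>2 \<le> (d + ?i)\<^sup>2"
        using X(2)[of k] by (intro power_mono) auto
      also have "\<dots> = d\<^sup>2 + (2 * d + ?i) * ?i"
        by (simp add: power2_eq_square algebra_simps)
      also have "\<dots> \<le> d\<^sup>2 + (2 * d + 1) * ?i"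
        using i by (intro add_left_mono mult_right_mono) auto
      finally show ?thesis .
    qed
    have "(f - X n) - (f - X m) = X m - X n" by simp
    then show ?thesis
      using 1 2 3[of m] 3[of n] by (simp add: algebra_simps)
  qed
  have "Cauchy X"
  proof (rule CauchyI)
    fix e :: real assume e: "e > 0"
    have "(\<lambda>n. (4 * d + 2) * (inverse (Suc n) + inverse (Suc n))) \<longlonglongrightarrow> (4 * d + 2) * (0 + 0)"
      by (intro tendsto_intros LIMSEQ_inverse_real_of_nat)
    then have "\<forall>\<^sub>F n in sequentially. (4 * d + 2) * (inverse (Suc n) + inverse (Suc n)) < e\<^sup>2"
      using e by (intro order_tendstoD) auto
    then obtain N where N: "(4 * d + 2) * (inverse (Suc N) + inverse (Suc N)) < e\<^sup>2"
      by (auto simp: eventually_sequentially)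
    have "norm (X m - X n) < e" if "m \<ge> N" "n \<ge> N" for m n
    proof (rule power2_less_imp_less)
      have "(norm (X m - X n))\<^sup>2 \<le> (4 * d + 2) * (inverse (Suc m) + inverse (Suc n))"
        by (rule par)
      also have "\<dots> \<le> (4 * d + 2) * (inverse (Suc N) + inverse (Suc N))"
        using that d0 by (intro mult_left_mono add_mono le_imp_inverse_le) auto
      finally show "(norm (X m - X n))\<^sup>2 < e\<^sup>2" using N by simp
    qed (use e in auto)
    then show "\<exists>M. \<forall>m\<ge>M. \<forall>n\<ge>M. norm (X m - X n) < e" by blast
  qed
  then obtain g where lim: "X \<longlonglongrightarrow> g"
    using Cauchy_convergent convergent_def by blast
  then have gV: "g \<in> V"
    using cl X(1) closed_sequentially by blast
  have "norm (f - g) \<le> d"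
  proof (rule LIMSEQ_le)
    show "(\<lambda>n. norm (f - X n)) \<longlonglongrightarrow> norm (f - g)"
      by (intro tendsto_intros lim)
    have "(\<lambda>n. d + inverse (real (Suc n))) \<longlonglongrightarrow> d + 0"
      by (intro tendsto_intros LIMSEQ_inverse_real_of_nat)
    then show "(\<lambda>n. d + inverse (real (Suc n))) \<longlonglongrightarrow> d" by simp
  qed (use X(2) less_imp_le in blast)
  then have "norm (f - g) \<le> norm (f - h)" if "h \<in> V" for h
    using d_le[OF that] by simp
  then show thesis
    using that[OF gV] closest_imp_orthogonal[OF V gV] by blast
qed

text \<open>Two candidates differ by an element of \<open>V\<close> that is orthogonal to itself.
  This uniqueness makes the description behind \<open>orth_proj\<close> proper.\<close>

lemma orth_proj_eqI:
  assumes V: "L2.subspace V" and "g \<in> V" "\<And>h. h \<in> V \<Longrightarrow> cinner (f - g) h = 0"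
  shows "orth_proj V f = g"
  unfolding orth_proj_def
proof (rule the_equality)
  fix g' assume g': "g' \<in> V \<and> (\<forall>h\<in>V. cinner (f - g') h = 0)"
  then have "g' - g \<in> V"
    using V assms(2) by (simp add: L2.subspace_diff)
  then have "cinner (f - g) (g' - g) = 0" "cinner (f - g') (g' - g) = 0"
    using assms(3) g' by auto
  then have "cinner (g' - g) (g' - g) = 0"
    using cinner_diff_left[of "f - g" "f - g'" "g' - g"] by simp
  then show "g' = g" by (simp add: cinner_self_norm)
qed (use assms in auto)

lemma orth_proj:
  assumes "L2.subspace V" "closed V"
  shows orth_proj_in: "orth_proj V f \<in> V"
    and orth_proj_orthogonal: "h \<in> V \<Longrightarrow> cinner (f - orth_proj V f) h = 0"
  using orthogonal_projection_exists[OF assms, of f] orth_proj_eqI[OF assms(1)] by metis+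

lemma subspace_closure:
  assumes "L2.subspace V"
  shows "L2.subspace (closure V)"
proof (rule L2.subspaceI)
  show "0 \<in> closure V"
    using assms L2.subspace_0 closure_subset by blast
next
  fix x y assume "x \<in> closure V" "y \<in> closure V"
  then obtain a b where "\<And>n. a n \<in> V" "a \<longlonglongrightarrow> x" "\<And>n. b n \<in> V" "b \<longlonglongrightarrow> y"
    unfolding closure_sequential by blast
  then show "x + y \<in> closure V"
    using assms unfolding closure_sequential
    by (intro exI[of _ "\<lambda>n. a n + b n"]) (auto intro: L2.subspace_add tendsto_add)
next
  fix c x assume "x \<in> closure V"
  then obtain a where "\<And>n. a n \<in> V" "a \<longlonglongrightarrow> x"
    unfolding closure_sequential by blast
  then show "c *\<^sub>C x \<in> closure V"
    using assms unfolding closure_sequential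
    by (intro exI[of _ "\<lambda>n. c *\<^sub>C a n"]) (auto intro: L2.subspace_scale tendsto_scaleC)
qed

text \<open>The residual of \<open>f\<close> after projection to the closed span lies in
  \<open>W\<close> and is orthogonal to every \<open>e k\<close>, hence vanishes.\<close>

lemma closed_span_eqI:
  assumes W: "L2.subspace W" "closed W" and e: "\<And>k. e k \<in> W"
    and compl: "\<And>f. f \<in> W \<Longrightarrow> (\<And>k. cinner f (e k) = 0) \<Longrightarrow> f = 0"
  shows "closure (L2.span (range e)) = W"
proof
  have "L2.span (range e) \<subseteq> W"
    using W(1) e by (intro L2.span_minimal) auto
  then show sub: "closure (L2.span (range e)) \<subseteq> W"
    using W(2) by (rule closure_minimal)
  show "W \<subseteq> closure (L2.span (range e))"
  proof
    fix f assume f: "f \<in> W"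
    let ?C = "closure (L2.span (range e))"
    have C: "L2.subspace ?C" "closed ?C"
      by (auto intro: subspace_closure L2.subspace_span)
    let ?g = "orth_proj ?C f"
    have "e k \<in> ?C" for k
      using closure_subset[of "L2.span (range e)"] L2.span_base[of "e k" "range e"] by blast
    then have "cinner (f - ?g) (e k) = 0" for k
      by (rule orth_proj_orthogonal[OF C])
    moreover have "f - ?g \<in> W"
      using f orth_proj_in[OF C, of f] sub W(1) by (auto intro: L2.subspace_diff)
    ultimately have "f - ?g = 0" by (intro compl) auto
    then show "f \<in> ?C" using orth_proj_in[OF C, of f] by simp
  qed
qed

lemma pythagoras:
  assumes "cinner f g = 0"
  shows "(norm (f + g))\<^sup>2 = (norm f)\<^sup>2 + (norm g)\<^sup>2"
proof -
  have "inner f g = 0" using assms by (simp add: inner_L2_def)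
  then show ?thesis by (simp add: power2_norm_eq_inner inner_add inner_commute)
qed

text \<open>Finite partial sums are best approximations from their span. Once the index set contains
  the indices of a span element close to \<open>f\<close>, the defect in Bessel's inequality is
  below the squared distance to that element.\<close>

lemma parseval:
  fixes e :: "'i \<Rightarrow> L2"
  assumes on: "\<And>k l. cinner (e k) (e l) = (if k = l then 1 else 0)"
    and f: "f \<in> closure (L2.span (range e))"
  shows "((\<lambda>k. (cmod (cinner f (e k)))\<^sup>2) has_sum (norm f)\<^sup>2) UNIV"
proof -
  define c where "c k = cinner f (e k)" for k
  define P where "P F = (\<Sum>k\<in>F. c k *\<^sub>C e k)" for F
  have orth: "cinner (f - P F) h = 0" if "h \<in> L2.span (e ` F)" "finite F" for F h
  proof -
    have "L2.span (e ` F) \<subseteq> {h. cinner (f - P F) h = 0}"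
    proof (rule L2.span_minimal)
      show "e ` F \<subseteq> {h. cinner (f - P F) h = 0}"
        using that(2) by (auto simp: P_def cinner_diff_left cinner_sum_left cinner_scaleC_left on c_def
            if_distrib cong: if_cong)
      show "L2.subspace {h. cinner (f - P F) h = 0}"
        by (auto simp: cinner_add_right cinner_scaleC_right intro!: L2.subspaceI)
    qed
    then show ?thesis using that(1) by blast
  qed
  have P_span: "P F \<in> L2.span (e ` F)" for F
    unfolding P_def by (intro L2.span_sum L2.span_scale L2.span_base) auto
  have normP: "(norm (P F))\<^sup>2 = (\<Sum>k\<in>F. (cmod (c k))\<^sup>2)" if "finite F" for F
  proof -
    have "cinner (P F) (e k) = c k" if "k \<in> F" for k
      using that \<open>finite F\<close>
      by (simp add: P_def cinner_sum_left cinner_scaleC_left on if_distrib cong: if_cong)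
    then have "complex_of_real ((norm (P F))\<^sup>2) = (\<Sum>k\<in>F. c k * cnj (c k))"
      unfolding cinner_self_norm[symmetric]
      by (subst (2) P_def) (simp add: cinner_sum_right cinner_scaleC_right mult.commute)
    also have "\<dots> = of_real (\<Sum>k\<in>F. (cmod (c k))\<^sup>2)"
      by (simp only: of_real_sum complex_norm_square)
    finally show ?thesis unfolding of_real_eq_iff .
  qed
  have split: "(norm f)\<^sup>2 = (norm (f - P F))\<^sup>2 + (\<Sum>k\<in>F. (cmod (c k))\<^sup>2)" if "finite F" for F
    using pythagoras[OF orth[OF P_span that]] normP[OF that] by simp
  have "((\<lambda>k. (cmod (c k))\<^sup>2) has_sum (norm f)\<^sup>2) UNIV"
    unfolding has_sum_def tendsto_iff eventually_finite_subsets_at_top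
  proof (intro allI impI)
    fix \<epsilon> :: real assume "\<epsilon> > 0"
    then obtain s where s: "s \<in> L2.span (range e)" "dist s f < sqrt \<epsilon>"
      using f unfolding closure_approachable by (meson real_sqrt_gt_zero)
    from s(1) obtain t r where t: "finite t" "t \<subseteq> range e" "s = (\<Sum>a\<in>t. r a *\<^sub>C a)"
      unfolding L2.span_explicit by blast
    then obtain X where X: "finite X" "t = e ` X"
      by (meson finite_subset_image)
    have "dist (\<Sum>k\<in>Y. (cmod (c k))\<^sup>2) ((norm f)\<^sup>2) < \<epsilon>" if Y: "finite Y" "X \<subseteq> Y" for Y
    proof -
      have "s \<in> L2.span (e ` Y)"
        unfolding t(3) using X(2) Y(2) by (intro L2.span_sum L2.span_scale L2.span_base) auto
      then have "P Y - s \<in> L2.span (e ` Y)"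
        by (intro L2.span_diff P_span)
      then have "(norm ((f - P Y) + (P Y - s)))\<^sup>2 = (norm (f - P Y))\<^sup>2 + (norm (P Y - s))\<^sup>2"
        using Y(1) by (intro pythagoras orth)
      then have "(norm (f - P Y))\<^sup>2 \<le> (norm (f - s))\<^sup>2"
        by simp
      also have "\<dots> < (sqrt \<epsilon>)\<^sup>2"
        using s(2) by (intro power_strict_mono) (auto simp: dist_norm norm_minus_commute)
      also have "(sqrt \<epsilon>)\<^sup>2 = \<epsilon>" using \<open>\<epsilon> > 0\<close> by simp
      finally show ?thesis
        using split[OF Y(1)] by (simp add: dist_real_def)
    qed
    then show "\<exists>X. finite X \<and> X \<subseteq> UNIV \<and> (\<forall>Y. finite Y \<and> X \<subseteq> Y \<and> Y \<subseteq> UNIV \<longrightarrow>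
        dist (\<Sum>k\<in>Y. (cmod (c k))\<^sup>2) ((norm f)\<^sup>2) < \<epsilon>)"
      using X(1) by blast
  qed
  then show ?thesis by (simp add: c_def)
qed

section \<open>Plane waves and Fourier series\<close>

definition wave :: "real^2 \<Rightarrow> real^2 \<Rightarrow> complex" where
  "wave \<xi> x = exp (\<i> * of_real (inner \<xi> x))"

definition lattice_vec :: "int \<times> int \<Rightarrow> real^2" where
  "lattice_vec k = vector [of_int (fst k), of_int (snd k)]"

text \<open>Half-open, so that the translates by the lattice of mesh \<open>L\<close> tile the plane
  exactly, without null sets to discard.\<close>

definition cell :: "real \<Rightarrow> (real^2) set" where
  "cell L = {x. x$1 \<in> {-L/2..<L/2} \<and> x$2 \<in> {-L/2..<L/2}}"

lemma inner_vec2: "inner (x :: real^2) y = x$1 * y$1 + x$2 * y$2"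
  by (simp add: inner_vec_def sum_2)

lemma lattice_vec_nth [simp]: "lattice_vec k $ 1 = of_int (fst k)" "lattice_vec k $ 2 = of_int (snd k)"
  by (simp_all add: lattice_vec_def)

lemma norm_wave [simp]: "cmod (wave \<xi> x) = 1"
  by (simp add: wave_def)

lemma wave_add_left: "wave (\<xi> + \<eta>) x = wave \<xi> x * wave \<eta> x"
  by (simp add: wave_def inner_add_left distrib_left exp_add)

lemma wave_add_right: "wave \<xi> (x + y) = wave \<xi> x * wave \<xi> y"
  by (simp add: wave_def inner_add_right distrib_left exp_add)

lemma wave_minus: "wave (- \<xi>) x = cnj (wave \<xi> x)" "wave \<xi> (- x) = cnj (wave \<xi> x)"
  by (simp_all add: wave_def exp_cnj)

lemma wave_diff_left: "wave (\<xi> - \<eta>) x = wave \<xi> x * cnj (wave \<eta> x)"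
  using wave_add_left[of \<xi> "- \<eta>" x] by (simp add: wave_minus)

lemma wave_zero [simp]: "wave 0 x = 1" "wave \<xi> 0 = 1"
  by (simp_all add: wave_def)

lemma continuous_wave [continuous_intros]: "continuous_on S (wave \<xi>)"
  unfolding wave_def by (intro continuous_intros)

lemma measurable_wave [measurable]: "wave \<xi> \<in> borel_measurable borel"
  by (intro borel_measurable_continuous_onI continuous_intros)

lemma integrable_wave_mult:
  assumes "integrable lborel p"
  shows "integrable lborel (\<lambda>x. p x * wave \<xi> x)"
proof -
  have [measurable]: "p \<in> borel_measurable borel" using assms by auto
  show ?thesis
    by (rule Bochner_Integration.integrable_bound[OF assms]) (auto simp: norm_mult)
qed

lemma cell_sets [measurable]: "cell L \<in> sets borel"
  unfolding cell_def by measurable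

lemma cell_bounded: "bounded (cell L)"
proof -
  have "norm x \<le> \<bar>L\<bar>" if "x \<in> cell L" for x
  proof -
    have "norm x \<le> \<bar>x$1\<bar> + \<bar>x$2\<bar>"
      using norm_le_l1_cart[of x] by (simp add: sum_2)
    also have "\<dots> \<le> \<bar>L\<bar>" using that by (auto simp: cell_def)
    finally show ?thesis .
  qed
  then show ?thesis by (rule boundedI)
qed

lemma cell_unique:
  assumes "L > 0"
  shows "x + L *\<^sub>R lattice_vec k \<in> cell L \<longleftrightarrow> k = (- \<lfloor>x$1 / L + 1/2\<rfloor>, - \<lfloor>x$2 / L + 1/2\<rfloor>)"
proof -
  have 1: "(t + L * of_int m \<in> {-L/2..<L/2}) \<longleftrightarrow> m = - \<lfloor>t / L + 1/2\<rfloor>" for t :: real and m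
  proof -
    have "(t + L * of_int m \<in> {-L/2..<L/2}) \<longleftrightarrow> of_int (- m) \<le> t / L + 1/2 \<and> t / L + 1/2 < of_int (- m) + 1"
      using assms by (auto simp: field_simps)
    also have "\<dots> \<longleftrightarrow> \<lfloor>t / L + 1/2\<rfloor> = - m"
      by (simp only: floor_eq_iff)
    finally show ?thesis by auto
  qed
  show ?thesis
    using 1[of "x$1" "fst k"] 1[of "x$2" "snd k"] by (auto simp: cell_def prod_eq_iff)
qed

text \<open>Guarantees that nine translates of the cell cover everything within twice its size, so
  that periodizations become finite sums.\<close>

lemma cell_index_bounds:
  assumes "-L \<le> t" "t < L"
  shows "\<lfloor>t / L + 1/2\<rfloor> \<in> {-1..1}"
proof -
  have "L > 0" using assms by linarith
  then have "-1 \<le> t / L" "t / L < 1" using assms by (auto simp: field_simps)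
  then show ?thesis by (auto simp: le_floor_iff floor_le_iff)
qed

lemma wave_periodic:
  assumes "L > 0"
  shows "wave ((2 * pi / L) *\<^sub>R lattice_vec k) (x + L *\<^sub>R lattice_vec l) = wave ((2 * pi / L) *\<^sub>R lattice_vec k) x"
proof -
  have "wave ((2 * pi / L) *\<^sub>R lattice_vec k) (L *\<^sub>R lattice_vec l) = exp (2 * pi * \<i> * of_int (fst k * fst l + snd k * snd l))"
    using assms by (simp add: wave_def inner_vec2 algebra_simps)
  also have "\<dots> = 1"
    unfolding exp_eq_1 by (auto intro!: exI[of _ "fst k * fst l + snd k * snd l"])
  finally show ?thesis by (simp add: wave_add_right)
qed

text \<open>Insert 1 as the sum over k of the indicators of the cell at x + L k, exchange sum and
  integral by Tonelli, and translate each term.\<close>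

lemma nn_integral_tiling:
  assumes L: "L > 0" and F [measurable]: "F \<in> borel_measurable borel"
  shows "(\<integral>\<^sup>+x. F x \<partial>lborel) =
    (\<integral>\<^sup>+t. (\<integral>\<^sup>+k. F (t + L *\<^sub>R lattice_vec k) \<partial>count_space UNIV) * indicator (cell L) t \<partial>lborel)"
proof -
  have shift: "t + L *\<^sub>R lattice_vec k = aff 1 1 (L * of_int (fst k)) (L * of_int (snd k)) t" for t k
    by (simp add: vec2_eq_iff)
  have [measurable]: "(\<lambda>t. t + L *\<^sub>R lattice_vec k) \<in> borel \<rightarrow>\<^sub>M borel" for k
    by measurable
  have "(\<integral>\<^sup>+x. F x \<partial>lborel) =
      (\<integral>\<^sup>+x. (\<integral>\<^sup>+k. F x * indicator (cell L) (x + L *\<^sub>R lattice_vec k) \<partial>count_space UNIV) \<partial>lborel)"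
  proof (rule nn_integral_cong)
    fix x :: "real^2"
    define k0 where "k0 = (- \<lfloor>x$1 / L + 1/2\<rfloor>, - \<lfloor>x$2 / L + 1/2\<rfloor>)"
    have "(\<integral>\<^sup>+k. F x * indicator (cell L) (x + L *\<^sub>R lattice_vec k) \<partial>count_space UNIV)
        = (\<integral>\<^sup>+k. F x * indicator {k0} k \<partial>count_space UNIV)"
      using cell_unique[OF L, of x] by (intro nn_integral_cong) (simp add: indicator_def k0_def)
    also have "\<dots> = F x" by (simp add: nn_integral_cmult_indicator)
    finally show "F x = (\<integral>\<^sup>+k. F x * indicator (cell L) (x + L *\<^sub>R lattice_vec k) \<partial>count_space UNIV)" ..
  qed
  also have "\<dots> = (\<integral>\<^sup>+k. (\<integral>\<^sup>+x. F x * indicator (cell L) (x + L *\<^sub>R lattice_vec k) \<partial>lborel) \<partial>count_space UNIV)"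
    by (intro nn_integral_count_space_nn_integral) auto
  also have "\<dots> = (\<integral>\<^sup>+k. (\<integral>\<^sup>+x. F x * indicator (cell L) (x + L *\<^sub>R lattice_vec (- k)) \<partial>lborel) \<partial>count_space UNIV)"
    by (intro nn_integral_bij_count_space[symmetric] bij_uminus)
  also have "\<dots> = (\<integral>\<^sup>+k. (\<integral>\<^sup>+t. F (t + L *\<^sub>R lattice_vec k) * indicator (cell L) t \<partial>lborel) \<partial>count_space UNIV)"
  proof (rule nn_integral_cong)
    fix k :: "int \<times> int"
    have cancel: "x + L *\<^sub>R lattice_vec k + L *\<^sub>R lattice_vec (- k) = x" for x
      by (simp add: vec2_eq_iff)
    have "(\<integral>\<^sup>+x. F x * indicator (cell L) (x + L *\<^sub>R lattice_vec (- k)) \<partial>lborel)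
      = (\<integral>\<^sup>+x. F (x + L *\<^sub>R lattice_vec k) * indicator (cell L) (x + L *\<^sub>R lattice_vec k + L *\<^sub>R lattice_vec (- k)) \<partial>lborel)"
      unfolding shift[of _ k] by (subst nn_integral_aff[where a=1 and b=1]) auto
    then show "(\<integral>\<^sup>+x. F x * indicator (cell L) (x + L *\<^sub>R lattice_vec (- k)) \<partial>lborel)
      = (\<integral>\<^sup>+t. F (t + L *\<^sub>R lattice_vec k) * indicator (cell L) t \<partial>lborel)"
      by (simp only: cancel)
  qed
  also have "\<dots> = (\<integral>\<^sup>+t. (\<integral>\<^sup>+k. F (t + L *\<^sub>R lattice_vec k) * indicator (cell L) t \<partial>count_space UNIV) \<partial>lborel)"
    by (intro nn_integral_count_space_nn_integral[symmetric]) auto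
  also have "\<dots> = (\<integral>\<^sup>+t. (\<integral>\<^sup>+k. F (t + L *\<^sub>R lattice_vec k) \<partial>count_space UNIV) * indicator (cell L) t \<partial>lborel)"
    by (intro nn_integral_cong nn_integral_multc) auto
  finally show ?thesis .
qed

section \<open>Density of trigonometric polynomials and uniqueness of Fourier coefficients\<close>

inductive trig_poly :: "real \<Rightarrow> (real^2 \<Rightarrow> complex) \<Rightarrow> bool" for r where
  monom: "trig_poly r (\<lambda>x. c * wave (r *\<^sub>R lattice_vec k) x)"
| add: "trig_poly r f \<Longrightarrow> trig_poly r g \<Longrightarrow> trig_poly r (\<lambda>x. f x + g x)"

lemma wave_lattice_mult:
  "wave (r *\<^sub>R lattice_vec k) x * wave (r *\<^sub>R lattice_vec l) x = wave (r *\<^sub>R lattice_vec (k + l)) x"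
proof -
  have "r *\<^sub>R lattice_vec (k + l) = r *\<^sub>R lattice_vec k + r *\<^sub>R lattice_vec l"
    by (simp add: vec2_eq_iff algebra_simps)
  then show ?thesis by (simp add: wave_add_left)
qed

lemma trig_poly_const: "trig_poly r (\<lambda>x. c)"
proof -
  have "lattice_vec 0 = 0" by (simp add: vec2_eq_iff)
  then show ?thesis using trig_poly.monom[of r c 0] by simp
qed

lemma trig_poly_mult:
  assumes "trig_poly r f" "trig_poly r g"
  shows "trig_poly r (\<lambda>x. f x * g x)"
  using assms
proof (induction f)
  case (monom c k)
  from monom show ?case
  proof (induction g)
    case (monom d l)
    have "(\<lambda>x. c * wave (r *\<^sub>R lattice_vec k) x * (d * wave (r *\<^sub>R lattice_vec l) x))
        = (\<lambda>x. (c * d) * wave (r *\<^sub>R lattice_vec (k + l)) x)"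
      by (simp add: wave_lattice_mult[symmetric] algebra_simps)
    then show ?case by (simp only: trig_poly.monom)
  next
    case (add f g)
    then show ?case by (simp add: distrib_left trig_poly.add)
  qed
next
  case (add f g)
  then show ?case by (simp add: distrib_right trig_poly.add)
qed

text \<open>Realises the torus as a product of two circles, a compact subset of a Euclidean space,
  where polynomial approximation of continuous functions is available.\<close>

definition torus_map :: "real \<Rightarrow> real^2 \<Rightarrow> complex \<times> complex" where
  "torus_map r x = (wave (r *\<^sub>R lattice_vec (1, 0)) x, wave (r *\<^sub>R lattice_vec (0, 1)) x)"

lemma cnj_wave_lattice: "cnj (wave (r *\<^sub>R lattice_vec k) x) = wave (r *\<^sub>R lattice_vec (- k)) x"
proof -
  have "r *\<^sub>R lattice_vec (- k) = - (r *\<^sub>R lattice_vec k)"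
    by (simp add: vec2_eq_iff)
  then show ?thesis by (simp add: wave_minus)
qed

lemma trig_poly_Re_Im:
  "trig_poly r (\<lambda>x. c * of_real (Re (wave (r *\<^sub>R lattice_vec k) x)))"
  "trig_poly r (\<lambda>x. c * of_real (Im (wave (r *\<^sub>R lattice_vec k) x)))"
proof -
  have "(\<lambda>x. c * of_real (Re (wave (r *\<^sub>R lattice_vec k) x))) =
      (\<lambda>x. c / 2 * wave (r *\<^sub>R lattice_vec k) x + c / 2 * wave (r *\<^sub>R lattice_vec (- k)) x)"
    by (simp add: cnj_wave_lattice[symmetric] fun_eq_iff add_divide_distrib[symmetric]
        distrib_left[symmetric] complex_add_cnj)
  then show "trig_poly r (\<lambda>x. c * of_real (Re (wave (r *\<^sub>R lattice_vec k) x)))"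
    by (simp only:) (intro trig_poly.intros)
  have "c * of_real (Im z) = - (\<i> * c) / 2 * z + \<i> * c / 2 * cnj z" for z
    by (simp add: complex_eq_iff field_simps)
  then have "(\<lambda>x. c * of_real (Im (wave (r *\<^sub>R lattice_vec k) x))) =
      (\<lambda>x. - (\<i> * c) / 2 * wave (r *\<^sub>R lattice_vec k) x + \<i> * c / 2 * wave (r *\<^sub>R lattice_vec (- k)) x)"
    by (simp only: cnj_wave_lattice)
  then show "trig_poly r (\<lambda>x. c * of_real (Im (wave (r *\<^sub>R lattice_vec k) x)))"
    by (simp only:) (intro trig_poly.intros)
qed

lemma trig_poly_polynomial:
  assumes "real_polynomial_function g"
  shows "trig_poly r (\<lambda>x. of_real (g (torus_map r x)))"
  using assms
proof (induction g)
  case (linear g)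
  interpret bounded_linear g by fact
  \<comment> \<open>A real-linear functional on pairs of complex numbers is determined by its values
    on four real basis vectors; real and imaginary parts of waves are trigonometric
    polynomials.\<close>
  have split: "g (z, w) = g (1, 0) * Re z + g (\<i>, 0) * Im z + g (0, 1) * Re w + g (0, \<i>) * Im w" for z w
  proof -
    have "(z, w) = Re z *\<^sub>R (1, 0) + Im z *\<^sub>R (\<i>, 0) + Re w *\<^sub>R (0, 1) + Im w *\<^sub>R (0, \<i>)"
      by (simp add: complex_eq_iff)
    then have "g (z, w) = Re z * g (1, 0) + Im z * g (\<i>, 0) + Re w * g (0, 1) + Im w * g (0, \<i>)"
      by (simp only: add scaleR real_scaleR_def)
    then show ?thesis by (simp only: mult.commute)
  qed
  have "(\<lambda>x. complex_of_real (g (torus_map r x))) = (\<lambda>x.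
      of_real (g (1, 0)) * of_real (Re (wave (r *\<^sub>R lattice_vec (1, 0)) x)) +
      of_real (g (\<i>, 0)) * of_real (Im (wave (r *\<^sub>R lattice_vec (1, 0)) x)) +
      of_real (g (0, 1)) * of_real (Re (wave (r *\<^sub>R lattice_vec (0, 1)) x)) +
      of_real (g (0, \<i>)) * of_real (Im (wave (r *\<^sub>R lattice_vec (0, 1)) x)))"
    unfolding torus_map_def by (subst split) (simp only: of_real_add of_real_mult)
  then show ?case
    by (simp only:) (intro trig_poly.add trig_poly_Re_Im)
next
  case (const c)
  show ?case by (rule trig_poly_const)
next
  case (add f g)
  then show ?case by (simp add: trig_poly.add)
next
  case (mult f g)
  then show ?case by (simp add: trig_poly_mult)
qed

lemma continuous_torus_map: "continuous_on S (torus_map r)"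
  unfolding torus_map_def by (intro continuous_intros)

text \<open>Equal torus points differ by multiples of \<open>L\<close> in each coordinate, while two
  points of the half-open cell differ by less than \<open>L\<close>.\<close>

lemma torus_map_inj:
  assumes "L > 0"
  shows "inj_on (torus_map (2 * pi / L)) (cell L)"
proof (rule inj_onI)
  fix x y assume xy: "x \<in> cell L" "y \<in> cell L" "torus_map (2 * pi / L) x = torus_map (2 * pi / L) y"
  have eq: "s = t" if w: "exp (\<i> * of_real (2 * pi / L * s)) = exp (\<i> * of_real (2 * pi / L * t))"
    and st: "s \<in> {-L/2..<L/2}" "t \<in> {-L/2..<L/2}" for s t :: real
  proof -
    obtain n :: int where "\<i> * of_real (2 * pi / L * s) = \<i> * of_real (2 * pi / L * t) + of_int (2 * n) * pi * \<i>"
      using w unfolding exp_eq by blast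
    then have "2 * pi / L * s = 2 * pi / L * t + of_int (2 * n) * pi"
      by (simp add: complex_eq_iff)
    then have "2 * pi * s = 2 * pi * (t + L * of_int n)"
      using assms by (simp add: field_simps)
    then have n: "s - t = L * of_int n"
      by (simp only: mult_cancel_left) simp
    have "\<bar>s - t\<bar> < L"
      using st by auto
    then have "L * \<bar>of_int n\<bar> < L * 1"
      using assms unfolding n by (simp add: abs_mult)
    then have "\<bar>n\<bar> < 1"
      using assms by (simp only: mult_less_cancel_left_pos)
    then show ?thesis using n by simp
  qed
  show "x = y"
    using xy eq[of "x$1" "y$1"] eq[of "x$2" "y$2"]
    by (simp add: vec2_eq_iff torus_map_def wave_def inner_vec2 cell_def)
qed

text \<open>Inner regularity: the set where \<open>q\<close> is positive is, up to measure e, a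
  closed and hence compact set \<open>T\<close>. A positive function with zero integral over
  \<open>T\<close> makes \<open>T\<close> null.\<close>

lemma AE_nonpos_if_compact_integrals_zero:
  fixes q :: "real^2 \<Rightarrow> real"
  assumes q: "integrable lborel q" and S: "bounded S" "\<And>x. x \<notin> S \<Longrightarrow> q x = 0"
    and z: "\<And>C. compact C \<Longrightarrow> C \<subseteq> S \<Longrightarrow> (LINT x|lborel. indicator C x * q x) = 0"
  shows "AE x in lborel. q x \<le> 0"
proof -
  have [measurable]: "q \<in> borel_measurable borel" using q by auto
  define E where "E = {x. q x > 0}"
  have [measurable]: "E \<in> sets borel" unfolding E_def by measurable
  have "emeasure lborel E \<le> ennreal e" if e: "e > 0" for e
  proof -
    have "E \<in> sets lebesgue" by simp
    then obtain T where T: "closed T" "T \<subseteq> E" "emeasure lebesgue (E - T) < ennreal e"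
      by (rule sets_lebesgue_inner_closed[OF _ e])
    have [measurable]: "T \<in> sets borel" using T(1) by auto
    have "T \<subseteq> S" using T(2) S(2) by (force simp: E_def)
    moreover from this have "compact T"
      using T(1) S(1) by (simp add: compact_eq_bounded_closed bounded_subset)
    ultimately have 0: "(LINT x|lborel. indicator T x * q x) = 0" by (intro z)
    have int: "integrable lborel (\<lambda>x. indicator T x * q x)"
      using integrable_real_mult_indicator[of T lborel q] q by (simp add: mult.commute)
    have "AE x in lborel. indicator T x * q x = 0"
      using 0 T(2) by (subst (asm) integral_nonneg_eq_0_iff_AE[OF int])
        (auto simp: E_def indicator_def intro!: AE_I2 less_imp_le)
    then have "AE x in lborel. x \<notin> T"
      by eventually_elim (use T(2) in \<open>auto simp: E_def indicator_def\<close>)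
    then have "emeasure lborel T = 0"
      using AE_iff_measurable[of T lborel "\<lambda>x. x \<notin> T"] by auto
    moreover have "emeasure lborel (E - T) < ennreal e"
      using T(3) by simp
    moreover have "emeasure lborel E \<le> emeasure lborel T + emeasure lborel (E - T)"
      using emeasure_subadditive[of T lborel "E - T"] T(2) by (simp add: Un_absorb1)
    ultimately show ?thesis by simp
  qed
  then have "emeasure lborel E = 0"
    using ennreal_le_epsilon[of 0 "emeasure lborel E"] by auto
  then have "AE x in lborel. x \<notin> E"
    using AE_iff_measurable[of E lborel "\<lambda>x. x \<notin> E"] by auto
  then show ?thesis by eventually_elim (simp add: E_def)
qed

lemma integral_zero_trig_poly:
  assumes p: "integrable lborel p"
    and z: "\<And>k. (LINT x|lborel. p x * wave (r *\<^sub>R lattice_vec k) x) = 0" and "trig_poly r h"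
  shows "integrable lborel (\<lambda>x. p x * h x) \<and> (LINT x|lborel. p x * h x) = 0"
  using assms(3)
proof induction
  case (monom c k)
  have "(\<lambda>x. p x * (c * wave (r *\<^sub>R lattice_vec k) x)) = (\<lambda>x. c * (p x * wave (r *\<^sub>R lattice_vec k) x))"
    by (simp add: ac_simps)
  then show ?case
    using integrable_wave_mult[OF p] z by simp
next
  case (add f g)
  then show ?case by (simp add: distrib_left)
qed

text \<open>By Stone-Weierstrass the continuous function is within e of a polynomial on the torus;
  the polynomial integrates to zero against \<open>p\<close>, and the error costs at most e times
  the L1 norm of \<open>p\<close>.\<close>

lemma integral_zero_continuous:
  fixes G :: "complex \<times> complex \<Rightarrow> real"
  assumes p: "integrable lborel p"
    and z: "\<And>k. (LINT x|lborel. p x * wave (r *\<^sub>R lattice_vec k) x) = 0"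
    and G: "continuous_on UNIV G" "\<And>z. \<bar>G z\<bar> \<le> 1"
  shows "(LINT x|lborel. p x * of_real (G (torus_map r x))) = 0"
proof -
  have [measurable]: "p \<in> borel_measurable borel" using p by auto
  have [measurable]: "G \<in> borel_measurable borel" "torus_map r \<in> borel \<rightarrow>\<^sub>M borel"
    using G(1) continuous_torus_map by (auto intro: borel_measurable_continuous_onI)
  let ?S = "sphere (0::complex) 1 \<times> sphere (0::complex) 1"
  have S: "torus_map r x \<in> ?S" for x
    by (simp add: torus_map_def)
  have int: "integrable lborel (\<lambda>x. p x * of_real (G (torus_map r x)))"
    by (rule Bochner_Integration.integrable_bound[OF p])
       (auto simp: norm_mult G(2) mult_left_le)
  have le: "norm (LINT x|lborel. p x * of_real (G (torus_map r x))) \<le> e * (LINT x|lborel. norm (p x))"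
    if e: "e > 0" for e
  proof -
    have "compact ?S" "continuous_on ?S G"
      using G(1) by (auto intro: compact_Times continuous_on_subset)
    then obtain g where g: "real_polynomial_function g" "\<And>z. z \<in> ?S \<Longrightarrow> \<bar>G z - g z\<bar> < e"
      using Stone_Weierstrass_real_polynomial_function[OF _ _ e] by blast
    note g0 = integral_zero_trig_poly[OF p z trig_poly_polynomial[OF g(1)]]
    have "(LINT x|lborel. p x * of_real (G (torus_map r x))) =
        (LINT x|lborel. p x * of_real (G (torus_map r x) - g (torus_map r x)))"
      using g0 int by (simp add: right_diff_distrib)
    also have "norm \<dots> \<le> (LINT x|lborel. e * norm (p x))"
    proof (rule Bochner_Integration.integral_norm_bound_integral)
      show "integrable lborel (\<lambda>x. p x * of_real (G (torus_map r x) - g (torus_map r x)))"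
        using g0 int by (simp add: right_diff_distrib)
      show "norm (p x * of_real (G (torus_map r x) - g (torus_map r x))) \<le> e * norm (p x)" for x
        using g(2)[OF S, of x] by (simp add: norm_mult mult.commute[of e] mult_left_mono less_imp_le del: of_real_diff)
    qed (use p in auto)
    finally show ?thesis by simp
  qed
  define I where "I = (LINT x|lborel. norm (p x))"
  have "norm (LINT x|lborel. p x * of_real (G (torus_map r x))) \<le> 0"
  proof (rule field_le_epsilon)
    fix e :: real assume "e > 0"
    have "I \<ge> 0" by (simp add: I_def)
    then have "e / (I + 1) * I \<le> e"
      using \<open>e > 0\<close> by (simp add: field_simps)
    then show "norm (LINT x|lborel. p x * of_real (G (torus_map r x))) \<le> 0 + e"
      using le[of "e / (I + 1)"] \<open>e > 0\<close> \<open>I \<ge> 0\<close> unfolding I_def[symmetric] by simp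
  qed
  then show ?thesis by simp
qed

text \<open>Continuous functions on the torus approximate indicators of compact subsets of the cell,
  so \<open>p\<close> has integral zero over every such set; signs of real and imaginary parts are
  then excluded one by one.\<close>

lemma fourier_coeffs_unique:
  assumes L: "L > 0" and p: "integrable lborel p" and supp: "\<And>x. x \<notin> cell L \<Longrightarrow> p x = 0"
    and z: "\<And>k. (LINT x|lborel. p x * wave ((2 * pi / L) *\<^sub>R lattice_vec k) x) = 0"
  shows "AE x in lborel. p x = 0"
proof -
  let ?\<tau> = "torus_map (2 * pi / L)"
  have [measurable]: "p \<in> borel_measurable borel" using p by auto
  have [measurable]: "?\<tau> \<in> borel \<rightarrow>\<^sub>M borel"
    using continuous_torus_map by (auto intro: borel_measurable_continuous_onI)
  have C0: "(LINT x|lborel. p x * of_real (indicator C x)) = 0" if C: "compact C" "C \<subseteq> cell L" for C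
  \<comment> \<open>The distance \<open>infdist\<close> to the empty set is 0, for which the
    functions \<open>G n\<close> below would be constantly 1.\<close>
  proof (cases "C = {}")
    case False
    define G where "G n z = max 0 (1 - real n * infdist z (?\<tau> ` C))" for n z
    have clos: "closed (?\<tau> ` C)"
      using C(1) continuous_torus_map compact_continuous_image compact_imp_closed by blast
    have Gc: "continuous_on UNIV (G n)" for n
      unfolding G_def by (intro continuous_intros)
    then have [measurable]: "G n \<in> borel_measurable borel" for n
      by (rule borel_measurable_continuous_onI)
    have G1: "\<bar>G n z\<bar> \<le> 1" for n z
      by (auto simp: G_def infdist_nonneg)
    have [measurable]: "C \<in> sets borel" using C(1) by (simp add: borel_compact)
    have "(\<lambda>n. LINT x|lborel. p x * of_real (G n (?\<tau> x))) \<longlonglongrightarrow> (LINT x|lborel. p x * of_real (indicator C x))"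
    proof (rule integral_dominated_convergence[where w = "\<lambda>x. norm (p x)"])
      show "AE x in lborel. (\<lambda>n. p x * of_real (G n (?\<tau> x))) \<longlonglongrightarrow> p x * of_real (indicator C x)"
      proof (rule AE_I2)
        fix x
        show "(\<lambda>n. p x * of_real (G n (?\<tau> x))) \<longlonglongrightarrow> p x * of_real (indicator C x)"
        proof (cases "x \<in> cell L")
          case xL: True
          show ?thesis
          proof (cases "x \<in> C")
            case True
            then show ?thesis by (simp add: G_def)
          next
            case xC: False
            then have "?\<tau> x \<notin> ?\<tau> ` C"
              using torus_map_inj[OF L] C(2) xL by (auto simp: inj_on_def)
            then have d: "infdist (?\<tau> x) (?\<tau> ` C) > 0"
              using clos False infdist_pos_not_in_closed by blast
            obtain N where N: "1 \<le> real N * infdist (?\<tau> x) (?\<tau> ` C)"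
              using reals_Archimedean3[OF d] by (meson less_imp_le)
            have "G n (?\<tau> x) = 0" if "n \<ge> N" for n
            proof -
              have "real N * infdist (?\<tau> x) (?\<tau> ` C) \<le> real n * infdist (?\<tau> x) (?\<tau> ` C)"
                using that d by (intro mult_right_mono) auto
              then show ?thesis using N by (simp add: G_def)
            qed
            then have "\<forall>\<^sub>F n in sequentially. p x * of_real (G n (?\<tau> x)) = p x * of_real (indicator C x)"
              using xC by (auto simp: eventually_sequentially)
            then show ?thesis by (rule tendsto_eventually)
          qed
        qed (simp add: supp)
      qed
      show "AE x in lborel. norm (p x * of_real (G n (?\<tau> x))) \<le> norm (p x)" for n
        using G1[of n] by (auto simp: norm_mult mult_left_le)
    qed (use p in auto)
    moreover have "(LINT x|lborel. p x * of_real (G n (?\<tau> x))) = 0" for n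
      by (rule integral_zero_continuous[OF p z Gc G1])
    ultimately show ?thesis
      by (simp add: LIMSEQ_const_iff)
  qed simp
  have ind: "integrable lborel (\<lambda>x. p x * of_real (indicator C x))" if "compact C" for C
  proof -
    have [measurable]: "C \<in> sets borel" using that by (simp add: borel_compact)
    show ?thesis
      by (rule Bochner_Integration.integrable_bound[OF p]) (auto simp: norm_mult indicator_def)
  qed
  have Re0: "(LINT x|lborel. indicator C x * Re (p x)) = 0" if "compact C" "C \<subseteq> cell L" for C
  proof -
    have "(LINT x|lborel. Re (p x * of_real (indicator C x))) = Re (LINT x|lborel. p x * of_real (indicator C x))"
      by (rule integral_Re[OF ind[OF that(1)]])
    then show ?thesis using C0[OF that] by (simp add: mult.commute)
  qed
  have Im0: "(LINT x|lborel. indicator C x * Im (p x)) = 0" if "compact C" "C \<subseteq> cell L" for C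
  proof -
    have "(LINT x|lborel. Im (p x * of_real (indicator C x))) = Im (LINT x|lborel. p x * of_real (indicator C x))"
      by (rule integral_Im[OF ind[OF that(1)]])
    then show ?thesis using C0[OF that] by (simp add: mult.commute)
  qed
  note * = AE_nonpos_if_compact_integrals_zero[OF _ cell_bounded[of L]]
  have "AE x in lborel. Re (p x) \<le> 0"
    by (rule *) (use p Re0 supp in auto)
  moreover have "AE x in lborel. - Re (p x) \<le> 0"
    by (rule *) (use p Re0 supp in auto)
  moreover have "AE x in lborel. Im (p x) \<le> 0"
    by (rule *) (use p Im0 supp in auto)
  moreover have "AE x in lborel. - Im (p x) \<le> 0"
    by (rule *) (use p Im0 supp in auto)
  ultimately show ?thesis by eventually_elim (simp add: complex_eq_iff)
qed

section \<open>Plancherel's theorem\<close>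

lemma has_sum_imp_nn_integral:
  fixes f :: "'a :: countable \<Rightarrow> real"
  assumes "infinite (UNIV :: 'a set)" "(f has_sum S) UNIV" "\<And>k. 0 \<le> f k"
  shows "(\<integral>\<^sup>+k. ennreal (f k) \<partial>count_space UNIV) = ennreal S"
proof -
  let ?h = "from_nat_into (UNIV :: 'a set)"
  have h: "bij ?h"
    using assms(1) by (intro bij_betw_from_nat_into) auto
  have "((\<lambda>n. f (?h n)) has_sum S) UNIV"
    using has_sum_reindex_bij_betw[OF h, of f S] assms(2) by simp
  then have s: "(\<lambda>n. f (?h n)) sums S"
    by (rule has_sum_imp_sums)
  have "(\<integral>\<^sup>+k. ennreal (f k) \<partial>count_space UNIV) = (\<integral>\<^sup>+n. ennreal (f (?h n)) \<partial>count_space UNIV)"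
    by (rule nn_integral_bij_count_space[OF h, symmetric])
  also have "\<dots> = (\<Sum>n. ennreal (f (?h n)))"
    by (rule nn_integral_count_space_nat)
  also have "\<dots> = ennreal (\<Sum>n. f (?h n))"
    using s assms(3) by (intro suminf_ennreal2) (auto simp: sums_iff)
  finally show ?thesis using s by (simp add: sums_iff)
qed

text \<open>Counterpart of \<open>nn_integral_tiling\<close> for integrable functions without sign:
  the support lies in finitely many tiles, so the periodization is a finite sum.\<close>

lemma integral_tiling:
  fixes F :: "real^2 \<Rightarrow> 'b::{banach, second_countable_topology}"
  assumes L: "L > 0" and F: "integrable lborel F" and K: "finite K"
    and supp: "\<And>x. F x \<noteq> 0 \<Longrightarrow> \<exists>k\<in>K. x - L *\<^sub>R lattice_vec k \<in> cell L"
  shows "integrable lborel (\<lambda>x. indicator (cell L) x *\<^sub>R (\<Sum>k\<in>K. F (x + L *\<^sub>R lattice_vec k)))"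
    "(LINT x|lborel. F x) = (LINT x|lborel. indicator (cell L) x *\<^sub>R (\<Sum>k\<in>K. F (x + L *\<^sub>R lattice_vec k)))"
proof -
  have [measurable]: "F \<in> borel_measurable borel" using F by auto
  have shift: "t + L *\<^sub>R lattice_vec k = aff 1 1 (L * of_int (fst k)) (L * of_int (snd k)) t" for t k
    by (simp add: vec2_eq_iff)
  have [measurable]: "(\<lambda>t. t - L *\<^sub>R lattice_vec k) \<in> borel \<rightarrow>\<^sub>M borel" for k
    by measurable
  have Fx: "F x = (\<Sum>k\<in>K. indicator (cell L) (x - L *\<^sub>R lattice_vec k) *\<^sub>R F x)" for x
  proof (cases "F x = 0")
    case False
    then obtain k where k: "k \<in> K" "x - L *\<^sub>R lattice_vec k \<in> cell L"
      using supp by blast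
    have m: "x - L *\<^sub>R lattice_vec l = x + L *\<^sub>R lattice_vec (- l)" for l
      by (simp add: vec2_eq_iff)
    have "x - L *\<^sub>R lattice_vec l \<in> cell L \<longleftrightarrow> l = k" for l
      using k(2) cell_unique[OF L, of x "- l"] cell_unique[OF L, of x "- k"] unfolding m
      by (metis neg_equal_iff_equal)
    then have "(\<Sum>l\<in>K. indicator (cell L) (x - L *\<^sub>R lattice_vec l) *\<^sub>R F x) = (\<Sum>l\<in>K. if l = k then F x else 0)"
      by (intro sum.cong) (auto simp: indicator_def)
    then show ?thesis using K k(1) by simp
  qed simp
  have int: "integrable lborel (\<lambda>x. indicator (cell L) (x - L *\<^sub>R lattice_vec k) *\<^sub>R F x)" for k
    by (rule Bochner_Integration.integrable_bound[OF F]) (auto simp: indicator_def)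
  have int': "integrable lborel (\<lambda>x. indicator (cell L) x *\<^sub>R F (x + L *\<^sub>R lattice_vec k))"
    and eq: "(LINT x|lborel. indicator (cell L) (x - L *\<^sub>R lattice_vec k) *\<^sub>R F x)
      = (LINT x|lborel. indicator (cell L) x *\<^sub>R F (x + L *\<^sub>R lattice_vec k))" for k
  proof -
    let ?G = "\<lambda>x. indicator (cell L) (x - L *\<^sub>R lattice_vec k) *\<^sub>R F x"
    have G: "?G (x + L *\<^sub>R lattice_vec k) = indicator (cell L) x *\<^sub>R F (x + L *\<^sub>R lattice_vec k)" for x
      by simp
    show "integrable lborel (\<lambda>x. indicator (cell L) x *\<^sub>R F (x + L *\<^sub>R lattice_vec k))"
      using integrable_aff_iff[of ?G 1 1 "L * of_int (fst k)" "L * of_int (snd k)"] int[of k]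
      unfolding shift[symmetric] G by simp
    show "(LINT x|lborel. ?G x) = (LINT x|lborel. indicator (cell L) x *\<^sub>R F (x + L *\<^sub>R lattice_vec k))"
      using integral_aff[of ?G 1 1 "L * of_int (fst k)" "L * of_int (snd k)"]
      unfolding shift[symmetric] G by simp
  qed
  show "integrable lborel (\<lambda>x. indicator (cell L) x *\<^sub>R (\<Sum>k\<in>K. F (x + L *\<^sub>R lattice_vec k)))"
    unfolding scaleR_sum_right by (intro Bochner_Integration.integrable_sum int')
  have "(LINT x|lborel. F x) = (LINT x|lborel. (\<Sum>k\<in>K. indicator (cell L) (x - L *\<^sub>R lattice_vec k) *\<^sub>R F x))"
    by (rule Bochner_Integration.integral_cong[OF refl Fx])
  also have "\<dots> = (LINT x|lborel. indicator (cell L) x *\<^sub>R (\<Sum>k\<in>K. F (x + L *\<^sub>R lattice_vec k)))"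
    unfolding scaleR_sum_right by (simp add: Bochner_Integration.integral_sum int int' eq)
  finally show "(LINT x|lborel. F x) = (LINT x|lborel. indicator (cell L) x *\<^sub>R (\<Sum>k\<in>K. F (x + L *\<^sub>R lattice_vec k)))" .
qed

lemma emeasure_cell:
  assumes "L > 0"
  shows "emeasure lborel (cell L) = ennreal (L\<^sup>2)"
proof -
  have B: "(Basis :: (real^2) set) = {axis 1 1, axis 2 1}"
    by (auto simp: Basis_vec_def UNIV_2)
  have ne: "axis (2::2) (1::real) \<noteq> axis 1 1"
    by (simp add: axis_eq_axis)
  have "emeasure lborel (cell L) = (\<integral>\<^sup>+x. indicator (cell L) x \<partial>lborel)"
    by (simp only: nn_integral_indicator sets_lborel cell_sets)
  also have "\<dots> = (\<integral>\<^sup>+x. (\<Prod>b\<in>(Basis :: (real^2) set). indicator {-L/2..<L/2} (x \<bullet> b)) \<partial>lborel)"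
    by (rule nn_integral_cong) (use ne in \<open>auto simp: B inner_axis cell_def indicator_def\<close>)
  also have "\<dots> = (\<Prod>b\<in>(Basis :: (real^2) set). \<integral>\<^sup>+x. indicator {-L/2..<L/2} x \<partial>lborel)"
    by (rule nn_integral_lborel_prod) auto
  also have "\<dots> = ennreal L * ennreal L"
    using ne assms by (simp add: B)
  finally show ?thesis
    using assms by (simp add: ennreal_mult power2_eq_square)
qed

lemma integrable_cell_bounded:
  fixes g :: "real^2 \<Rightarrow> 'b::{banach, second_countable_topology}"
  assumes "L > 0" and [measurable]: "g \<in> borel_measurable borel" and "\<And>x. norm (g x) \<le> C"
  shows "integrable lborel (\<lambda>x. indicator (cell L) x *\<^sub>R g x)"
proof (rule Bochner_Integration.integrable_bound)
  show "integrable lborel (\<lambda>x. C * indicator (cell L) x)"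
    using assms(1) by (intro integrable_mult_right integrable_real_indicator) (auto simp: emeasure_cell)
  have "0 \<le> C" using assms(3)[of 0] norm_ge_zero order_trans by blast
  then show "AE x in lborel. norm (indicator (cell L) x *\<^sub>R g x) \<le> norm (C * indicator (cell L) x)"
    using assms(3) by (auto simp: indicator_def)
qed auto

text \<open>Shifting the cell by \<open>v\<close> with \<open>\<langle>\<xi>, v\<rangle> = \<pi>\<close> does not change the integral of a periodic wave, but flips its sign.\<close>

lemma integral_wave_cell:
  assumes L: "L > 0" and k: "k \<noteq> 0"
  shows "(LINT x|lborel. indicator (cell L) x *\<^sub>R wave ((2 * pi / L) *\<^sub>R lattice_vec k) x) = 0"
proof -
  let ?w = "wave ((2 * pi / L) *\<^sub>R lattice_vec k)"
  let ?K = "{-1..1} \<times> {-1..1} :: (int \<times> int) set"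
  \<comment> \<open>Half a period along a coordinate in which \<open>k\<close> does not vanish.
    Being at most L/2 long, it keeps the shifted cell within the nine neighbouring tiles.\<close>
  obtain v :: "real^2" where v: "\<bar>v$1\<bar> \<le> L/2" "\<bar>v$2\<bar> \<le> L/2" "?w v = -1"
  proof (cases "fst k = 0")
    case False
    let ?v = "vector [L / (2 * of_int (fst k)), 0] :: real^2"
    have "\<bar>real_of_int (fst k)\<bar> \<ge> 1"
      using False by linarith
    then have "\<bar>?v$1\<bar> \<le> L / 2"
      using L False by (simp add: abs_mult field_simps)
    moreover have "?w ?v = -1"
      using False L by (simp add: wave_def inner_vec2)
    ultimately show thesis using that[of ?v] L by simp
  next
    case True
    then have k2: "snd k \<noteq> 0" using k by (simp add: prod_eq_iff)
    let ?v = "vector [0, L / (2 * of_int (snd k))] :: real^2"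
    have "\<bar>real_of_int (snd k)\<bar> \<ge> 1"
      using k2 by linarith
    then have "\<bar>?v$2\<bar> \<le> L / 2"
      using L k2 by (simp add: abs_mult field_simps)
    moreover have "?w ?v = -1"
      using k2 L by (simp add: wave_def inner_vec2)
    ultimately show thesis using that[of ?v] L by simp
  qed
  have int: "integrable lborel (\<lambda>x. indicator (cell L) x *\<^sub>R ?w x)"
    by (rule integrable_cell_bounded[OF L, of _ 1]) auto
  have shift: "x - v = aff 1 1 (- v$1) (- v$2) x" for x
    by (simp add: vec2_eq_iff)
  have [measurable]: "(\<lambda>x. indicator (cell L) x *\<^sub>R ?w x) \<in> borel_measurable borel"
    using int by auto
  define G where "G x = indicator (cell L) (x - v) *\<^sub>R ?w (x - v)" for x
  have intG: "integrable lborel G" and eqG: "(LINT x|lborel. indicator (cell L) x *\<^sub>R ?w x) = (LINT x|lborel. G x)"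
    using integrable_aff_iff[of "\<lambda>x. indicator (cell L) x *\<^sub>R ?w x" 1 1 "- v$1" "- v$2"] int
      integral_aff[of "\<lambda>x. indicator (cell L) x *\<^sub>R ?w x" 1 1 "- v$1" "- v$2"]
    by (simp_all add: shift[symmetric] G_def[abs_def])
  have wv: "?w (x - v) = - ?w x" for x
    using wave_add_right[of _ "x - v" v] v(3) by simp
  have "(LINT x|lborel. G x) = (LINT x|lborel. indicator (cell L) x *\<^sub>R (\<Sum>l\<in>?K. G (x + L *\<^sub>R lattice_vec l)))"
  proof (rule integral_tiling(2)[OF L intG])
    fix x assume "G x \<noteq> 0"
    then have x: "x - v \<in> cell L" by (auto simp: G_def indicator_def split: if_splits)
    define l where "l = (\<lfloor>x$1 / L + 1/2\<rfloor>, \<lfloor>x$2 / L + 1/2\<rfloor>)"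
    have "x + L *\<^sub>R lattice_vec (- l) \<in> cell L"
      unfolding cell_unique[OF L] by (simp add: l_def)
    moreover have "x + L *\<^sub>R lattice_vec (- l) = x - L *\<^sub>R lattice_vec l"
      by (simp add: vec2_eq_iff)
    moreover have "l \<in> ?K"
    proof -
      have "-L \<le> x$1 \<and> x$1 < L" "-L \<le> x$2 \<and> x$2 < L"
        using x v(1,2) by (auto simp: cell_def abs_le_iff)
      then show ?thesis using cell_index_bounds unfolding l_def by blast
    qed
    ultimately show "\<exists>l\<in>?K. x - L *\<^sub>R lattice_vec l \<in> cell L" by metis
  qed simp
  also have "\<dots> = (LINT x|lborel. - (indicator (cell L) x *\<^sub>R ?w x))"
  proof (rule Bochner_Integration.integral_cong[OF refl])
    fix x
    show "indicator (cell L) x *\<^sub>R (\<Sum>l\<in>?K. G (x + L *\<^sub>R lattice_vec l)) = - (indicator (cell L) x *\<^sub>R ?w x)"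
    proof (cases "x \<in> cell L")
      case x: True
      \<comment> \<open>The only translate of \<open>x\<close> that falls into the cell moved by
        \<open>v\<close>.\<close>
      define l0 where "l0 = (- \<lfloor>(x - v)$1 / L + 1/2\<rfloor>, - \<lfloor>(x - v)$2 / L + 1/2\<rfloor>)"
      have G: "G (x + L *\<^sub>R lattice_vec l) = (if l = l0 then - ?w x else 0)" for l
      proof -
        have "x + L *\<^sub>R lattice_vec l - v = (x - v) + L *\<^sub>R lattice_vec l" by simp
        then have "x + L *\<^sub>R lattice_vec l - v \<in> cell L \<longleftrightarrow> l = l0"
          using cell_unique[OF L, of "x - v" l] by (simp only: l0_def)
        then show ?thesis
          unfolding G_def wv by (simp add: wave_periodic[OF L] indicator_def)
      qed
      have "-L \<le> (x-v)$1" "(x-v)$1 < L" "-L \<le> (x-v)$2" "(x-v)$2 < L"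
        using x v(1,2) by (auto simp: cell_def abs_le_iff)
      then have "l0 \<in> ?K"
        using cell_index_bounds[of L "(x-v)$1"] cell_index_bounds[of L "(x-v)$2"] by (simp add: l0_def)
      then show ?thesis using x by (simp add: G)
    qed simp
  qed
  finally have "(LINT x|lborel. indicator (cell L) x *\<^sub>R ?w x) = - (LINT x|lborel. indicator (cell L) x *\<^sub>R ?w x)"
    using eqG by simp
  then show ?thesis by (simp add: complex_eq_iff)
qed

definition cell_supported :: "real \<Rightarrow> (real^2 \<Rightarrow> complex) \<Rightarrow> bool" where
  "cell_supported L f \<longleftrightarrow> square_integrable f \<and> (\<forall>x. x \<notin> cell L \<longrightarrow> f x = 0)"

lemma cell_supported_integrable:
  assumes "L > 0" "cell_supported L f"
  shows "integrable lborel f"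
proof (rule Bochner_Integration.integrable_bound)
  have sq: "square_integrable f" and 0: "\<And>x. x \<notin> cell L \<Longrightarrow> f x = 0"
    using assms(2) by (auto simp: cell_supported_def)
  have "integrable lborel (\<lambda>x. indicator (cell L) x *\<^sub>R (1::real))"
    using integrable_cell_bounded[OF assms(1), of "\<lambda>_. 1::real" 1] by simp
  then show "integrable lborel (\<lambda>x. (cmod (f x))\<^sup>2 + indicator (cell L) x *\<^sub>R (1::real))"
    using sq by (simp add: square_integrable_def)
  show "f \<in> borel_measurable lborel"
    using sq by (simp add: square_integrable_def)
  \<comment> \<open>On a set of finite measure square integrability gives integrability.\<close>
  have "t \<le> t\<^sup>2 + 1" for t :: real
    using zero_le_power2[of "t - 1/2"] by (simp add: power2_eq_square algebra_simps)
  then show "AE x in lborel. cmod (f x) \<le> norm ((cmod (f x))\<^sup>2 + indicator (cell L) x *\<^sub>R (1::real))"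
    using 0 by (intro AE_I2) (auto simp: indicator_def)
qed

text \<open>The factor 1 / L is the inverse square root of the area of the cell.\<close>

definition cell_wave :: "real \<Rightarrow> int \<times> int \<Rightarrow> L2" where
  "cell_wave L k = abs_L2 (\<lambda>x. indicator (cell L) x *\<^sub>R (of_real (1 / L) * wave ((2 * pi / L) *\<^sub>R lattice_vec k) x))"

lemma square_integrable_cell_wave:
  assumes "L > 0"
  shows "square_integrable (\<lambda>x. indicator (cell L) x *\<^sub>R (of_real (1 / L) * wave ((2 * pi / L) *\<^sub>R lattice_vec k) x))"
proof -
  have "(\<lambda>x. (cmod (indicator (cell L) x *\<^sub>R (of_real (1 / L) * wave ((2 * pi / L) *\<^sub>R lattice_vec k) x)))\<^sup>2)
      = (\<lambda>x. indicator (cell L) x *\<^sub>R ((1 / L)\<^sup>2))"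
    using assms by (auto simp: fun_eq_iff indicator_def norm_mult norm_divide)
  moreover have "integrable lborel (\<lambda>x. indicator (cell L) x *\<^sub>R ((1 / L)\<^sup>2))"
    by (rule integrable_cell_bounded[OF assms, of _ "(1 / L)\<^sup>2"]) auto
  ultimately show ?thesis
    by (simp add: square_integrable_def)
qed

lemma cell_wave_orthonormal:
  assumes L: "L > 0"
  shows "cinner (cell_wave L k) (cell_wave L l) = (if k = l then 1 else 0)"
proof -
  have m: "(2 * pi / L) *\<^sub>R lattice_vec (k - l) = (2 * pi / L) *\<^sub>R lattice_vec k - (2 * pi / L) *\<^sub>R lattice_vec l"
    using L by (simp add: vec2_eq_iff field_simps)
  have "cinner (cell_wave L k) (cell_wave L l) =
      (LINT x|lborel. of_real (1 / L\<^sup>2) * (indicator (cell L) x *\<^sub>R wave ((2 * pi / L) *\<^sub>R lattice_vec (k - l)) x))"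
    unfolding cell_wave_def cinner_abs[OF square_integrable_cell_wave[OF L] square_integrable_cell_wave[OF L]] m
    by (intro Bochner_Integration.integral_cong)
       (auto simp: wave_diff_left indicator_def power2_eq_square)
  also have "\<dots> = of_real (1 / L\<^sup>2) * (LINT x|lborel. indicator (cell L) x *\<^sub>R wave ((2 * pi / L) *\<^sub>R lattice_vec (k - l)) x)"
    by (rule integral_mult_right_zero)
  also have "\<dots> = (if k = l then 1 else 0)"
  proof (cases "k = l")
    case True
    have "lattice_vec 0 = 0" by (simp add: vec2_eq_iff)
    then have "(LINT x|lborel. indicator (cell L) x *\<^sub>R wave ((2 * pi / L) *\<^sub>R lattice_vec (k - l)) x)
        = (LINT x|lborel. indicator (cell L) x *\<^sub>R (1::complex))"
      using True by simp
    also have "\<dots> = of_real (L\<^sup>2)"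
      using L by (simp add: emeasure_cell measure_def scaleR_conv_of_real)
    finally show ?thesis using True L by simp
  next
    case False
    then show ?thesis using integral_wave_cell[OF L, of "k - l"] by simp
  qed
  finally show ?thesis .
qed

text \<open>Completeness of the exponentials: orthogonality to all of them means that all Fourier
  coefficients vanish, and \<open>fourier_coeffs_unique\<close> applies.\<close>

lemma cell_wave_basis:
  assumes L: "L > 0"
  shows "closure (L2.span (range (cell_wave L))) = {f. AE x in lborel. x \<notin> cell L \<longrightarrow> rep_L2 f x = 0}"
    (is "_ = ?W")
proof (rule closed_span_eqI)
  show "L2.subspace ?W"
  proof (rule L2.subspaceI)
    show "0 \<in> ?W" using rep_L2_0 by (auto elim: eventually_mono)
    fix f g assume "f \<in> ?W" "g \<in> ?W"
    then have "AE x in lborel. x \<notin> cell L \<longrightarrow> rep_L2 f x = 0" "AE x in lborel. x \<notin> cell L \<longrightarrow> rep_L2 g x = 0"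
      by auto
    with rep_L2_add[of f g] have "AE x in lborel. x \<notin> cell L \<longrightarrow> rep_L2 (f + g) x = 0"
      by eventually_elim auto
    then show "f + g \<in> ?W" by simp
  next
    fix c f assume "f \<in> ?W"
    then have "AE x in lborel. x \<notin> cell L \<longrightarrow> rep_L2 f x = 0" by simp
    with rep_L2_scaleC[of c f] have "AE x in lborel. x \<notin> cell L \<longrightarrow> rep_L2 (c *\<^sub>C f) x = 0"
      by eventually_elim auto
    then show "c *\<^sub>C f \<in> ?W" by simp
  qed
  show "closed ?W"
    unfolding closed_sequential_limits
  proof (intro allI impI, elim conjE)
    fix X l assume X: "\<forall>n. X n \<in> ?W" "X \<longlonglongrightarrow> l"
    obtain r where "strict_mono r" and lim: "AE x in lborel. (\<lambda>n. rep_L2 (X (r n)) x) \<longlonglongrightarrow> rep_L2 l x"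
      using L2_AE_subseq[OF X(2)] .
    have "AE x in lborel. \<forall>n. x \<notin> cell L \<longrightarrow> rep_L2 (X (r n)) x = 0"
      unfolding AE_all_countable using X(1) by auto
    with lim have "AE x in lborel. x \<notin> cell L \<longrightarrow> rep_L2 l x = 0"
      by eventually_elim (auto simp: LIMSEQ_const_iff)
    then show "l \<in> ?W" by simp
  qed
  show "cell_wave L k \<in> ?W" for k
    using rep_L2_abs_L2[OF square_integrable_cell_wave[OF L, of k]]
    unfolding cell_wave_def[symmetric] by (auto elim!: eventually_mono)
  fix f assume f: "f \<in> ?W" "\<And>k. cinner f (cell_wave L k) = 0"
  define p where "p x = indicator (cell L) x *\<^sub>R rep_L2 f x" for x
  have pf: "AE x in lborel. p x = rep_L2 f x"
    using f(1) by (auto simp: p_def indicator_def elim!: eventually_mono)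
  have [measurable]: "p \<in> borel_measurable borel" unfolding p_def by measurable
  have "cell_supported L p"
    unfolding cell_supported_def
  proof
    show "square_integrable p"
      by (rule square_integrable_cong_AE[of "rep_L2 f"]) (use pf in \<open>auto elim!: eventually_mono\<close>)
  qed (simp add: p_def)
  then have int: "integrable lborel p" by (rule cell_supported_integrable[OF L])
  have "AE x in lborel. p x = 0"
  proof (rule fourier_coeffs_unique[OF L int])
    fix k
    \<comment> \<open>The conjugation in the inner product reverses the frequency, hence the index
      -k.\<close>
    have "cinner f (cell_wave L (- k)) = (LINT x|lborel. p x * (of_real (1 / L) * wave ((2 * pi / L) *\<^sub>R lattice_vec k) x))"
    proof -
      have m: "(2 * pi / L) *\<^sub>R lattice_vec (- k) = - ((2 * pi / L) *\<^sub>R lattice_vec k)"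
        by (simp add: vec2_eq_iff)
      have "cinner f (cell_wave L (- k)) = cinner (abs_L2 (rep_L2 f)) (cell_wave L (- k))" by simp
      also have "\<dots> = (LINT x|lborel. rep_L2 f x * cnj (indicator (cell L) x *\<^sub>R (of_real (1 / L) * wave ((2 * pi / L) *\<^sub>R lattice_vec (- k)) x)))"
        unfolding cell_wave_def by (rule cinner_abs[OF square_integrable_rep_L2 square_integrable_cell_wave[OF L]])
      also have "\<dots> = (LINT x|lborel. p x * (of_real (1 / L) * wave ((2 * pi / L) *\<^sub>R lattice_vec k) x))"
        unfolding m by (intro Bochner_Integration.integral_cong) (auto simp: p_def wave_minus indicator_def)
      finally show ?thesis .
    qed
    also have "\<dots> = (LINT x|lborel. of_real (1 / L) * (p x * wave ((2 * pi / L) *\<^sub>R lattice_vec k) x))"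
      by (simp only: mult.left_commute)
    also have "\<dots> = of_real (1 / L) * (LINT x|lborel. p x * wave ((2 * pi / L) *\<^sub>R lattice_vec k) x)"
      by simp
    finally show "(LINT x|lborel. p x * wave ((2 * pi / L) *\<^sub>R lattice_vec k) x) = 0"
      using f(2)[of "- k"] L by simp
  qed (simp add: p_def)
  with pf have "AE x in lborel. rep_L2 f x = 0" by eventually_elim simp
  then show "f = 0" by (simp add: L2_eq_0_iff)
qed

lemma fourier_integral_wave:
  "fourier_integral f \<xi> = 1 / (2 * pi) * (LINT x|lborel. wave (- \<xi>) x * f x)"
  by (simp add: fourier_integral_def wave_def)

lemma measurable_fourier_integral [measurable]:
  assumes [measurable]: "f \<in> borel_measurable borel"
  shows "fourier_integral f \<in> borel_measurable borel"
  unfolding fourier_integral_def by measurable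

text \<open>Parseval's identity for all modulations of \<open>f\<close>, integrated over a cell of modulations, is Plancherel's identity.\<close>

lemma plancherel_cell_supported:
  assumes L: "L > 0" and f: "cell_supported L f"
  shows "square_integrable (fourier_integral f)"
    "norm (abs_L2 (fourier_integral f)) = norm (abs_L2 f)"
proof -
  have sq: "square_integrable f" and 0: "\<And>x. x \<notin> cell L \<Longrightarrow> f x = 0"
    using f by (auto simp: cell_supported_def)
  have [measurable]: "f \<in> borel_measurable borel" using sq by measurable
  \<comment> \<open>Mesh of the dual lattice. The coefficients of \<open>f\<close> modulated by -t
    are M times the samples of the Fourier integral at t + M k, so the sum of the squared samples is
    the squared norm over M^2; the area M^2 of the cell of modulations cancels this.\<close>
  define M where "M = 2 * pi / L"
  have M: "M > 0" using L by (simp add: M_def)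
  have sum: "(\<integral>\<^sup>+k. ennreal ((cmod (fourier_integral f (t + M *\<^sub>R lattice_vec k)))\<^sup>2) \<partial>count_space UNIV)
      = ennreal ((norm (abs_L2 f))\<^sup>2 / M\<^sup>2)" for t
  proof -
    let ?g = "\<lambda>x. wave (- t) x * f x"
    have sqg: "square_integrable ?g"
      by (rule square_integrable_bounded_mult[OF sq, of _ 1]) auto
    have ng: "norm (abs_L2 ?g) = norm (abs_L2 f)"
    proof (rule power2_eq_imp_eq)
      show "(norm (abs_L2 ?g))\<^sup>2 = (norm (abs_L2 f))\<^sup>2"
        unfolding norm_abs_L2[OF sqg] norm_abs_L2[OF sq] by (simp add: norm_mult)
    qed auto
    have "AE x in lborel. x \<notin> cell L \<longrightarrow> rep_L2 (abs_L2 ?g) x = 0"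
      using rep_L2_abs_L2[OF sqg] by eventually_elim (simp add: 0)
    then have "abs_L2 ?g \<in> closure (L2.span (range (cell_wave L)))"
      unfolding cell_wave_basis[OF L] by simp
    then have "((\<lambda>k. (cmod (cinner (abs_L2 ?g) (cell_wave L k)))\<^sup>2) has_sum (norm (abs_L2 ?g))\<^sup>2) UNIV"
      by (intro parseval cell_wave_orthonormal[OF L])
    moreover have "cinner (abs_L2 ?g) (cell_wave L k) = of_real M * fourier_integral f (t + M *\<^sub>R lattice_vec k)" for k
    proof -
      have "cinner (abs_L2 ?g) (cell_wave L k) =
          (LINT x|lborel. ?g x * cnj (indicator (cell L) x *\<^sub>R (of_real (1 / L) * wave (M *\<^sub>R lattice_vec k) x)))"
        unfolding cell_wave_def M_def by (rule cinner_abs[OF sqg square_integrable_cell_wave[OF L]])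
      also have "\<dots> = (LINT x|lborel. of_real (1 / L) * (wave (- (t + M *\<^sub>R lattice_vec k)) x * f x))"
      proof (rule Bochner_Integration.integral_cong[OF refl])
        fix x
        have w: "wave (- (t + M *\<^sub>R lattice_vec k)) x = wave (- t) x * cnj (wave (M *\<^sub>R lattice_vec k) x)"
          using wave_diff_left[of "- t" "M *\<^sub>R lattice_vec k" x] by simp
        show "?g x * cnj (indicator (cell L) x *\<^sub>R (of_real (1 / L) * wave (M *\<^sub>R lattice_vec k) x))
            = of_real (1 / L) * (wave (- (t + M *\<^sub>R lattice_vec k)) x * f x)"
          unfolding w using 0[of x] by (cases "x \<in> cell L") (auto simp: indicator_def)
      qed
      also have "\<dots> = of_real (1 / L) * (LINT x|lborel. wave (- (t + M *\<^sub>R lattice_vec k)) x * f x)"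
        by simp
      finally show ?thesis
        using L by (simp add: fourier_integral_wave M_def)
    qed
    ultimately have "((\<lambda>k. M\<^sup>2 * (cmod (fourier_integral f (t + M *\<^sub>R lattice_vec k)))\<^sup>2) has_sum (norm (abs_L2 f))\<^sup>2) UNIV"
      using M by (simp add: ng norm_mult power_mult_distrib)
    then have "((\<lambda>k. (1 / M\<^sup>2) * (M\<^sup>2 * (cmod (fourier_integral f (t + M *\<^sub>R lattice_vec k)))\<^sup>2)) has_sum (1 / M\<^sup>2) * (norm (abs_L2 f))\<^sup>2) UNIV"
      by (rule has_sum_cmult_right)
    then have "((\<lambda>k. (cmod (fourier_integral f (t + M *\<^sub>R lattice_vec k)))\<^sup>2) has_sum (norm (abs_L2 f))\<^sup>2 / M\<^sup>2) UNIV"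
      using M by simp
    then show ?thesis
      by (intro has_sum_imp_nn_integral) (auto simp: finite_prod infinite_UNIV_int)
  qed
  have "(\<integral>\<^sup>+\<xi>. ennreal ((cmod (fourier_integral f \<xi>))\<^sup>2) \<partial>lborel) =
      (\<integral>\<^sup>+t. ennreal ((norm (abs_L2 f))\<^sup>2 / M\<^sup>2) * indicator (cell M) t \<partial>lborel)"
    by (subst nn_integral_tiling[OF M]) (auto simp: sum)
  also have "\<dots> = ennreal ((norm (abs_L2 f))\<^sup>2)"
    using M by (simp add: nn_integral_cmult_indicator emeasure_cell ennreal_mult[symmetric])
  finally have eq: "(\<integral>\<^sup>+\<xi>. ennreal ((cmod (fourier_integral f \<xi>))\<^sup>2) \<partial>lborel) = ennreal ((norm (abs_L2 f))\<^sup>2)" .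
  show sqF: "square_integrable (fourier_integral f)"
    by (rule square_integrableI) (auto simp: eq)
  show "norm (abs_L2 (fourier_integral f)) = norm (abs_L2 f)"
    using eq unfolding ennreal_norm_abs_L2[OF sqF, symmetric] by simp
qed

section \<open>Extension of the Fourier integral to all square integrable functions\<close>

definition cut :: "nat \<Rightarrow> L2 \<Rightarrow> real^2 \<Rightarrow> complex" where
  "cut n f x = indicator (cell (real n + 1)) x *\<^sub>R rep_L2 f x"

lemma measurable_cut [measurable]: "cut n f \<in> borel_measurable borel"
  unfolding cut_def by measurable

lemma cell_mono: "L \<le> M \<Longrightarrow> cell L \<subseteq> cell M"
  by (auto simp: cell_def)

lemma cell_supported_cut: "cell_supported (real n + 1) (cut n f)"
proof -
  have "cut n f = (\<lambda>x. indicator (cell (real n + 1)) x * rep_L2 f x)"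
    by (auto simp: fun_eq_iff cut_def indicator_def)
  moreover have "square_integrable (\<lambda>x. indicator (cell (real n + 1)) x * rep_L2 f x)"
    by (rule square_integrable_bounded_mult[of _ _ 1]) (auto simp: indicator_def)
  ultimately show ?thesis
    by (auto simp: cell_supported_def cut_def)
qed

lemma square_integrable_cut [simp]: "square_integrable (cut n f)"
  using cell_supported_cut by (simp add: cell_supported_def)

lemma integrable_cut: "integrable lborel (cut n f)"
  by (rule cell_supported_integrable[OF _ cell_supported_cut]) simp

lemma eventually_in_cell: "\<forall>\<^sub>F n in sequentially. x \<in> cell (real n + 1)"
proof -
  obtain N :: nat where N: "2 * (\<bar>x$1\<bar> + \<bar>x$2\<bar>) < real N"
    using reals_Archimedean2 by blast
  have "x \<in> cell (real n + 1)" if "n \<ge> N" for n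
    using N that by (auto simp: cell_def abs_if split: if_splits)
  then show ?thesis by (auto simp: eventually_sequentially)
qed

lemma tendsto_cut: "(\<lambda>n. abs_L2 (cut n f)) \<longlonglongrightarrow> f"
proof -
  have sq: "square_integrable (\<lambda>x. cut n f x - rep_L2 f x)" for n
    by (intro square_integrable_diff) auto
  have "(\<lambda>n. LINT x|lborel. (cmod (cut n f x - rep_L2 f x))\<^sup>2) \<longlonglongrightarrow> (LINT x|(lborel :: (real^2) measure). 0)"
  proof (rule integral_dominated_convergence[where w = "\<lambda>x. (cmod (rep_L2 f x))\<^sup>2"])
    show "AE x in lborel. (\<lambda>n. (cmod (cut n f x - rep_L2 f x))\<^sup>2) \<longlonglongrightarrow> 0"
    proof (rule AE_I2)
      fix x
      have "\<forall>\<^sub>F n in sequentially. (cmod (cut n f x - rep_L2 f x))\<^sup>2 = 0"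
        using eventually_in_cell[of x] by eventually_elim (simp add: cut_def)
      then show "(\<lambda>n. (cmod (cut n f x - rep_L2 f x))\<^sup>2) \<longlonglongrightarrow> 0"
        by (rule tendsto_eventually)
    qed
    show "integrable lborel (\<lambda>x. (cmod (rep_L2 f x))\<^sup>2)"
      using square_integrable_rep_L2[of f] by (simp only: square_integrable_def)
    show "AE x in lborel. norm ((cmod (cut n f x - rep_L2 f x))\<^sup>2) \<le> (cmod (rep_L2 f x))\<^sup>2" for n
      by (auto simp: cut_def indicator_def)
  qed auto
  moreover have "(LINT x|lborel. (cmod (cut n f x - rep_L2 f x))\<^sup>2) = (norm (abs_L2 (cut n f) - f))\<^sup>2" for n
    using norm_abs_L2[OF sq[of n]] abs_L2_diff[of "cut n f" "rep_L2 f"] by simp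
  ultimately have "(\<lambda>n. (norm (abs_L2 (cut n f) - f))\<^sup>2) \<longlonglongrightarrow> 0"
    by simp
  then have "(\<lambda>n. sqrt ((norm (abs_L2 (cut n f) - f))\<^sup>2)) \<longlonglongrightarrow> sqrt 0"
    by (rule tendsto_real_sqrt)
  then show ?thesis
    by (simp add: tendsto_norm_zero_iff LIM_zero_iff)
qed

lemma fourier_integral_cong_AE:
  assumes "AE x in lborel. f x = g x" and [measurable]: "f \<in> borel_measurable borel" "g \<in> borel_measurable borel"
  shows "fourier_integral f = fourier_integral g"
  unfolding fourier_integral_wave
  by (intro ext arg_cong2[where f="(*)"] refl integral_cong_AE)
     (use assms(1) in \<open>auto elim: eventually_mono\<close>)

lemma integrable_wave_mult': "integrable lborel f \<Longrightarrow> integrable lborel (\<lambda>x. wave \<xi> x * f x)"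
  using integrable_wave_mult[of f \<xi>] by (simp add: mult.commute)

lemma fourier_integral_add:
  "integrable lborel f \<Longrightarrow> integrable lborel g \<Longrightarrow>
    fourier_integral (\<lambda>x. f x + g x) = (\<lambda>\<xi>. fourier_integral f \<xi> + fourier_integral g \<xi>)"
  by (simp add: fourier_integral_wave fun_eq_iff distrib_left integrable_wave_mult' add_divide_distrib)

lemma fourier_integral_scale:
  "fourier_integral (\<lambda>x. c * f x) = (\<lambda>\<xi>. c * fourier_integral f \<xi>)"
  by (simp add: fourier_integral_wave fun_eq_iff mult.left_commute)

lemma fourier_integral_diff:
  "integrable lborel f \<Longrightarrow> integrable lborel g \<Longrightarrow>
    fourier_integral (\<lambda>x. f x - g x) = (\<lambda>\<xi>. fourier_integral f \<xi> - fourier_integral g \<xi>)"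
  by (simp add: fourier_integral_wave fun_eq_iff right_diff_distrib integrable_wave_mult' diff_divide_distrib)

definition cut_fourier :: "nat \<Rightarrow> L2 \<Rightarrow> L2" where
  "cut_fourier n f = abs_L2 (fourier_integral (cut n f))"

lemma square_integrable_cut_fourier: "square_integrable (fourier_integral (cut n f))"
  by (rule plancherel_cell_supported[OF _ cell_supported_cut]) simp

text \<open>\<open>fourier\<close> is known only through a unique description; this limit of Fourier
  integrals of truncations is the candidate that will satisfy it.\<close>

definition plancherel :: "L2 \<Rightarrow> L2" where
  "plancherel f = lim (\<lambda>n. cut_fourier n f)"

text \<open>The difference of two truncations is supported in the larger cell, so Plancherel's
  identity on cells applies to it. Hence the transformed truncations are Cauchy.\<close>

lemma norm_cut_fourier_diff:
  "norm (cut_fourier m f - cut_fourier n f) = norm (abs_L2 (cut m f) - abs_L2 (cut n f))"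
proof -
  let ?L = "max (real m + 1) (real n + 1)"
  have "cell_supported ?L (\<lambda>x. cut m f x - cut n f x)"
    unfolding cell_supported_def
  proof (intro conjI allI impI)
    fix x assume "x \<notin> cell ?L"
    then have "x \<notin> cell (real m + 1)" "x \<notin> cell (real n + 1)"
      using cell_mono[of "real m + 1" ?L] cell_mono[of "real n + 1" ?L] by auto
    then show "cut m f x - cut n f x = 0" by (simp add: cut_def)
  qed (auto intro: square_integrable_diff)
  then have "norm (abs_L2 (fourier_integral (\<lambda>x. cut m f x - cut n f x))) = norm (abs_L2 (\<lambda>x. cut m f x - cut n f x))"
    by (intro plancherel_cell_supported(2)[of ?L]) auto
  then show ?thesis
    by (simp add: fourier_integral_diff integrable_cut cut_fourier_def abs_L2_diff square_integrable_cut_fourier)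
qed

lemma tendsto_plancherel: "(\<lambda>n. cut_fourier n f) \<longlonglongrightarrow> plancherel f"
proof -
  have "Cauchy (\<lambda>n. abs_L2 (cut n f))"
    using tendsto_cut by (rule LIMSEQ_imp_Cauchy)
  then have "Cauchy (\<lambda>n. cut_fourier n f)"
    by (simp add: Cauchy_def dist_norm norm_cut_fourier_diff)
  then show ?thesis
    unfolding plancherel_def by (simp add: Cauchy_convergent_iff convergent_LIMSEQ_iff)
qed

lemma norm_plancherel: "norm (plancherel f) = norm f"
proof -
  have "norm (cut_fourier n f) = norm (abs_L2 (cut n f))" for n
    unfolding cut_fourier_def by (rule plancherel_cell_supported(2)[OF _ cell_supported_cut]) simp
  then have "(\<lambda>n. norm (cut_fourier n f)) \<longlonglongrightarrow> norm f"
    using tendsto_norm[OF tendsto_cut] by simp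
  then show ?thesis
    using tendsto_norm[OF tendsto_plancherel] LIMSEQ_unique by blast
qed

lemma plancherel_add: "plancherel (f + g) = plancherel f + plancherel g"
proof -
  have "AE x in lborel. cut n (f + g) x = cut n f x + cut n g x" for n
    using rep_L2_add[of f g] by eventually_elim (simp add: cut_def scaleR_add_right)
  then have "fourier_integral (cut n (f + g)) = fourier_integral (\<lambda>x. cut n f x + cut n g x)" for n
    by (rule fourier_integral_cong_AE) measurable
  then have "cut_fourier n (f + g) = cut_fourier n f + cut_fourier n g" for n
    by (simp add: cut_fourier_def fourier_integral_add integrable_cut abs_L2_add square_integrable_cut_fourier)
  then show ?thesis
    using tendsto_add[OF tendsto_plancherel[of f] tendsto_plancherel[of g]] tendsto_plancherel[of "f + g"]
    by (auto intro: LIMSEQ_unique)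
qed

lemma plancherel_scaleC: "plancherel (c *\<^sub>C f) = c *\<^sub>C plancherel f"
proof -
  have "AE x in lborel. cut n (c *\<^sub>C f) x = c * cut n f x" for n
    using rep_L2_scaleC[of c f] by eventually_elim (simp add: cut_def)
  then have "fourier_integral (cut n (c *\<^sub>C f)) = fourier_integral (\<lambda>x. c * cut n f x)" for n
    by (rule fourier_integral_cong_AE) measurable
  then have "cut_fourier n (c *\<^sub>C f) = c *\<^sub>C cut_fourier n f" for n
    by (simp add: cut_fourier_def fourier_integral_scale abs_L2_scaleC square_integrable_cut_fourier)
  then show ?thesis
    using tendsto_scaleC[OF tendsto_plancherel[of f], of c] tendsto_plancherel[of "c *\<^sub>C f"]
    by (auto intro: LIMSEQ_unique)
qed

lemma plancherel_linear: "Vector_Spaces.linear scaleC scaleC plancherel"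
  by unfold_locales (auto simp: plancherel_add plancherel_scaleC)

text \<open>The transformed truncations converge to \<open>plancherel\<close> almost everywhere
  along a subsequence, and to the Fourier integral at every point by dominated convergence.\<close>

lemma plancherel_integrable:
  assumes int: "integrable lborel f" and sq: "square_integrable f"
  shows "AE \<xi> in lborel. rep_L2 (plancherel (abs_L2 f)) \<xi> = fourier_integral f \<xi>"
proof -
  have [measurable]: "f \<in> borel_measurable borel" using int by auto
  obtain r where r: "strict_mono r"
    and lim: "AE \<xi> in lborel. (\<lambda>n. rep_L2 (cut_fourier (r n) (abs_L2 f)) \<xi>) \<longlonglongrightarrow> rep_L2 (plancherel (abs_L2 f)) \<xi>"
    using L2_AE_subseq[OF tendsto_plancherel] .
  have eq: "AE \<xi> in lborel. \<forall>n. rep_L2 (cut_fourier (r n) (abs_L2 f)) \<xi> = fourier_integral (cut (r n) (abs_L2 f)) \<xi>"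
    unfolding AE_all_countable cut_fourier_def
    by (intro allI rep_L2_abs_L2 square_integrable_cut_fourier)
  have "(\<lambda>n. fourier_integral (cut n (abs_L2 f)) \<xi>) \<longlonglongrightarrow> fourier_integral f \<xi>" for \<xi>
  proof -
    have "(\<lambda>n. LINT x|lborel. wave (- \<xi>) x * cut n (abs_L2 f) x) \<longlonglongrightarrow> (LINT x|lborel. wave (- \<xi>) x * f x)"
    proof (rule integral_dominated_convergence[where w = "\<lambda>x. norm (f x)"])
      show "AE x in lborel. (\<lambda>n. wave (- \<xi>) x * cut n (abs_L2 f) x) \<longlonglongrightarrow> wave (- \<xi>) x * f x"
        using rep_L2_abs_L2[OF sq]
      proof eventually_elim
        case (elim x)
        have "\<forall>\<^sub>F n in sequentially. wave (- \<xi>) x * cut n (abs_L2 f) x = wave (- \<xi>) x * f x"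
          using eventually_in_cell[of x] by eventually_elim (simp add: cut_def elim)
        then show ?case by (rule tendsto_eventually)
      qed
      show "AE x in lborel. norm (wave (- \<xi>) x * cut n (abs_L2 f) x) \<le> norm (f x)" for n
        using rep_L2_abs_L2[OF sq] by eventually_elim (auto simp: norm_mult cut_def indicator_def)
    qed (use int in auto)
    then show ?thesis
      unfolding fourier_integral_wave by (intro tendsto_mult_left)
  qed
  then have "(\<lambda>n. fourier_integral (cut (r n) (abs_L2 f)) \<xi>) \<longlonglongrightarrow> fourier_integral f \<xi>" for \<xi>
    using LIMSEQ_subseq_LIMSEQ[OF _ r] by (auto simp: comp_def)
  note lim' = this
  from eq lim show ?thesis
    by eventually_elim (use lim' in \<open>auto intro: LIMSEQ_unique\<close>)
qed

text \<open>Turns the sesquilinear inner product into the bilinear pairing, for which the Fourier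
  transform is symmetric.\<close>

definition cnj_L2 :: "L2 \<Rightarrow> L2" where
  "cnj_L2 f = abs_L2 (\<lambda>x. cnj (rep_L2 f x))"

lemma measurable_cnj [measurable]: "cnj \<in> borel_measurable borel"
  by (intro borel_measurable_continuous_onI continuous_intros)

lemma square_integrable_cnj: "square_integrable f \<Longrightarrow> square_integrable (\<lambda>x. cnj (f x))"
  by (auto simp: square_integrable_def intro!: measurable_compose[OF _ measurable_cnj])

lemma rep_cnj_L2: "AE x in lborel. rep_L2 (cnj_L2 f) x = cnj (rep_L2 f x)"
  unfolding cnj_L2_def by (rule rep_L2_abs_L2) (simp add: square_integrable_cnj)

lemma cnj_L2_cnj_L2 [simp]: "cnj_L2 (cnj_L2 f) = f"
  unfolding L2_eq_iff using rep_cnj_L2[of "cnj_L2 f"] rep_cnj_L2[of f] by eventually_elim simp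

lemma cnj_L2_eq_0_iff: "cnj_L2 f = 0 \<longleftrightarrow> f = 0"
proof -
  have "AE x in lborel. (rep_L2 (cnj_L2 f) x = 0) = (rep_L2 f x = 0)"
    using rep_cnj_L2[of f] by eventually_elim simp
  then show ?thesis
    unfolding L2_eq_0_iff by (rule eventually_subst)
qed

lemma tendsto_cnj_L2:
  assumes "X \<longlonglongrightarrow> f"
  shows "(\<lambda>n. cnj_L2 (X n)) \<longlonglongrightarrow> cnj_L2 f"
proof -
  have "norm (cnj_L2 g - cnj_L2 h) = norm (g - h)" for g h
  proof -
    have "cnj_L2 g - cnj_L2 h = cnj_L2 (g - h)"
      unfolding L2_eq_iff
      using rep_L2_diff[of "cnj_L2 g" "cnj_L2 h"] rep_cnj_L2[of g] rep_cnj_L2[of h]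
        rep_cnj_L2[of "g - h"] rep_L2_diff[of g h]
      by eventually_elim simp
    moreover have "(norm (cnj_L2 k))\<^sup>2 = (norm k)\<^sup>2" for k
      unfolding cnj_L2_def
      by (subst norm_abs_L2) (simp_all add: square_integrable_cnj norm_rep)
    then have "norm (cnj_L2 k) = norm k" for k
      by simp
    ultimately show ?thesis by metis
  qed
  then show ?thesis
    using assms by (simp add: tendsto_iff dist_norm)
qed

text \<open>Fubini's theorem for the kernel \<open>wave\<close>, which is symmetric in its two
  arguments.\<close>

lemma multiplication_formula:
  assumes f: "integrable lborel f" and g: "integrable lborel g"
  shows "(LINT \<xi>|lborel. fourier_integral f \<xi> * g \<xi>) = (LINT x|lborel. f x * fourier_integral g x)"
proof -
  have [measurable]: "f \<in> borel_measurable borel" "g \<in> borel_measurable borel"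
    using f g by auto
  let ?h = "\<lambda>x \<xi>. wave (- \<xi>) x * (f x * g \<xi>)"
  have "integrable (lborel \<Otimes>\<^sub>M lborel) (case_prod ?h)"
  proof (rule lborel_pair.Fubini_integrable)
    show "case_prod ?h \<in> borel_measurable (lborel \<Otimes>\<^sub>M lborel)"
      unfolding wave_def by measurable
    show "integrable lborel (\<lambda>x. LINT \<xi>|lborel. norm (case_prod ?h (x, \<xi>)))"
      using f by (simp add: norm_mult)
    show "AE x in lborel. integrable lborel (\<lambda>\<xi>. case_prod ?h (x, \<xi>))"
    proof (rule AE_I2)
      fix x
      have "integrable lborel (\<lambda>\<xi>. f x * (wave (- x) \<xi> * g \<xi>))"
        by (intro integrable_mult_right integrable_wave_mult' g)
      then show "integrable lborel (\<lambda>\<xi>. case_prod ?h (x, \<xi>))"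
        by (simp add: wave_def inner_commute mult_ac)
    qed
  qed
  then have "(LINT \<xi>|lborel. LINT x|lborel. ?h x \<xi>) = (LINT x|lborel. LINT \<xi>|lborel. ?h x \<xi>)"
    by (rule lborel_pair.Fubini_integral)
  moreover have "(LINT x|lborel. ?h x \<xi>) = 2 * pi * (fourier_integral f \<xi> * g \<xi>)" for \<xi>
    unfolding mult.assoc[symmetric] by (simp add: fourier_integral_wave)
  moreover have "(LINT \<xi>|lborel. ?h x \<xi>) = 2 * pi * (f x * fourier_integral g x)" for x
  proof -
    have "?h x = (\<lambda>\<xi>. f x * (wave (- x) \<xi> * g \<xi>))"
      by (simp add: wave_def inner_commute mult_ac fun_eq_iff)
    then show ?thesis by (simp add: fourier_integral_wave)
  qed
  ultimately show ?thesis by simp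
qed

lemma cinner_cnj_L2:
  assumes "square_integrable f" "square_integrable g"
  shows "cinner (abs_L2 f) (cnj_L2 (abs_L2 g)) = (LINT x|lborel. f x * g x)"
proof -
  have "cnj_L2 (abs_L2 g) = abs_L2 (\<lambda>x. cnj (g x))"
    unfolding cnj_L2_def
    using assms(2) rep_L2_abs_L2[OF assms(2)]
    by (subst abs_L2_eq_iff) (auto simp: square_integrable_cnj elim: eventually_mono)
  then show ?thesis
    using assms by (simp add: cinner_abs square_integrable_cnj)
qed

lemma plancherel_transpose: "cinner (plancherel f) (cnj_L2 g) = cinner f (cnj_L2 (plancherel g))"
proof -
  have "cinner (cut_fourier n f) (cnj_L2 (abs_L2 (cut n g))) = cinner (abs_L2 (cut n f)) (cnj_L2 (cut_fourier n g))" for n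
    unfolding cut_fourier_def
    by (simp add: cinner_cnj_L2 square_integrable_cut_fourier multiplication_formula integrable_cut)
  moreover have "(\<lambda>n. cinner (cut_fourier n f) (cnj_L2 (abs_L2 (cut n g)))) \<longlonglongrightarrow> cinner (plancherel f) (cnj_L2 g)"
    by (intro tendsto_cinner tendsto_cnj_L2 tendsto_plancherel tendsto_cut)
  moreover have "(\<lambda>n. cinner (abs_L2 (cut n f)) (cnj_L2 (cut_fourier n g))) \<longlonglongrightarrow> cinner f (cnj_L2 (plancherel g))"
    by (intro tendsto_cinner tendsto_cnj_L2 tendsto_plancherel tendsto_cut)
  ultimately show ?thesis by (simp add: LIMSEQ_unique)
qed

lemma plancherel_diff: "plancherel (f - g) = plancherel f - plancherel g"
  using plancherel_add[of "f - g" g] by simp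

lemma closed_isometric_image:
  fixes T :: "L2 \<Rightarrow> L2"
  assumes iso: "\<And>f g. norm (T f - T g) = norm (f - g)" and "closed S"
  shows "closed (T ` S)"
  unfolding closed_sequential_limits
proof (intro allI impI, elim conjE)
  fix X l assume X: "\<forall>n. X n \<in> T ` S" "X \<longlonglongrightarrow> l"
  then have "\<forall>n. \<exists>y. y \<in> S \<and> X n = T y" by blast
  then obtain Y where Y: "\<And>n. Y n \<in> S" "\<And>n. X n = T (Y n)"
    by metis
  have "Cauchy X" using X(2) by (rule LIMSEQ_imp_Cauchy)
  then have "Cauchy Y" by (simp add: Cauchy_def dist_norm Y(2) iso)
  then obtain y where y: "Y \<longlonglongrightarrow> y"
    using Cauchy_convergent convergent_def by blast
  then have "y \<in> S" using assms(2) Y(1) closed_sequentially by blast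
  have "(\<lambda>n. T (Y n)) \<longlonglongrightarrow> T y"
    using y by (simp add: tendsto_iff dist_norm iso)
  moreover have "X = (\<lambda>n. T (Y n))" using Y(2) by (rule ext)
  ultimately have "l = T y"
    using X(2) LIMSEQ_unique by blast
  then show "l \<in> T ` S" using \<open>y \<in> S\<close> by blast
qed

text \<open>The range of an isometry is closed. If \<open>h\<close> is orthogonal to it, the
  symmetry \<open>plancherel_transpose\<close> makes the transform of the conjugate of
  \<open>h\<close> zero, and the isometry forces h = 0.\<close>

lemma plancherel_surj: "surj plancherel"
proof -
  let ?R = "range plancherel"
  have R: "L2.subspace ?R" "closed ?R"
  proof -
    have "0 \<in> ?R" using plancherel_diff[of 0 0] by (metis diff_self rangeI)
    then show "L2.subspace ?R"
      by (auto intro!: L2.subspaceI simp flip: plancherel_add plancherel_scaleC)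
    show "closed ?R"
      by (rule closed_isometric_image) (auto simp: norm_plancherel simp flip: plancherel_diff)
  qed
  have "g \<in> ?R" for g
  proof -
    define h where "h = g - orth_proj ?R g"
    have "cinner f (cnj_L2 (plancherel (cnj_L2 h))) = 0" for f
    proof -
      have "cinner h (plancherel f) = 0"
        unfolding h_def by (rule orth_proj_orthogonal[OF R]) simp
      then have "cinner (plancherel f) h = 0"
        using cinner_commute[of "plancherel f" h] by simp
      then show ?thesis
        using plancherel_transpose[of f "cnj_L2 h"] by simp
    qed
    then have "cnj_L2 (plancherel (cnj_L2 h)) = 0"
      by (metis cinner_self_norm of_real_eq_0_iff norm_eq_zero zero_eq_power2)
    then have "norm (cnj_L2 h) = 0"
      using norm_plancherel[of "cnj_L2 h"] by (simp add: cnj_L2_eq_0_iff)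
    then have "h = 0" by (simp add: cnj_L2_eq_0_iff)
    then show ?thesis
      unfolding h_def using orth_proj_in[OF R, of g] by simp
  qed
  then show ?thesis by blast
qed

text \<open>Truncations are integrable and dense. The same principle yields uniqueness of the
  Fourier transform and its exchange rules with translations and dilations.\<close>

lemma isometries_eqI:
  fixes S T :: "L2 \<Rightarrow> L2"
  assumes S: "\<And>f g. norm (S f - S g) = norm (f - g)" and T: "\<And>f g. norm (T f - T g) = norm (f - g)"
    and eq: "\<And>f. integrable lborel f \<Longrightarrow> square_integrable f \<Longrightarrow> S (abs_L2 f) = T (abs_L2 f)"
  shows "S f = T f"
proof -
  have "(\<lambda>n. S (abs_L2 (cut n f))) \<longlonglongrightarrow> S f" "(\<lambda>n. T (abs_L2 (cut n f))) \<longlonglongrightarrow> T f"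
    using tendsto_cut[of f] by (simp_all add: tendsto_iff dist_norm S T)
  moreover have "S (abs_L2 (cut n f)) = T (abs_L2 (cut n f))" for n
    by (rule eq[OF integrable_cut square_integrable_cut])
  ultimately show ?thesis by (simp add: LIMSEQ_unique)
qed

lemma unitary_diff:
  assumes "unitary U"
  shows "U (f - g) = U f - U g"
proof -
  interpret Vector_Spaces.linear scaleC scaleC U
    using assms by (simp add: unitary_def)
  show ?thesis by (rule diff)
qed

lemma fourier_eq_plancherel: "fourier = plancherel"
  unfolding fourier_def
proof (rule the_equality)
  have u: "unitary plancherel"
    by (simp add: unitary_def plancherel_linear norm_plancherel plancherel_surj)
  then show "unitary plancherel \<and> (\<forall>f. integrable lborel f \<and> square_integrable f \<longrightarrow>
      (AE \<xi> in lborel. rep_L2 (plancherel (abs_L2 f)) \<xi> = fourier_integral f \<xi>))"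
    using plancherel_integrable by blast
  fix U assume U: "unitary U \<and> (\<forall>f. integrable lborel f \<and> square_integrable f \<longrightarrow>
      (AE \<xi> in lborel. rep_L2 (U (abs_L2 f)) \<xi> = fourier_integral f \<xi>))"
  show "U = plancherel"
  proof
    fix f show "U f = plancherel f"
    proof (rule isometries_eqI[where S = U and T = plancherel])
      show "norm (U f - U g) = norm (f - g)" "norm (plancherel f - plancherel g) = norm (f - g)" for f g :: L2
        using U u unitary_diff by (metis unitary_def)+
      fix f :: "real^2 \<Rightarrow> complex" assume "integrable lborel f" "square_integrable f"
      then have "AE \<xi> in lborel. rep_L2 (U (abs_L2 f)) \<xi> = fourier_integral f \<xi>"
        and "AE \<xi> in lborel. rep_L2 (plancherel (abs_L2 f)) \<xi> = fourier_integral f \<xi>"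
        using U plancherel_integrable by blast+
      then show "U (abs_L2 f) = plancherel (abs_L2 f)"
        unfolding L2_eq_iff by eventually_elim simp
    qed
  qed
qed

section \<open>Translations, dilations and the Fourier transform\<close>

lemma unitary_props:
  assumes "unitary U"
  shows unitary_add: "U (f + g) = U f + U g" and unitary_scaleC: "U (c *\<^sub>C f) = c *\<^sub>C U f"
    and unitary_norm: "norm (U f) = norm f" and unitary_surj: "surj U"
    and unitary_zero: "U 0 = 0" and unitary_isometry: "norm (U f - U g) = norm (f - g)"
    and unitary_inj: "inj U" and unitary_cinner: "cinner (U f) (U g) = cinner f g"
proof -
  interpret Vector_Spaces.linear scaleC scaleC U
    using assms by (simp add: unitary_def)
  show add: "U (f + g) = U f + U g" for f g by (rule add)
  show scaleC: "U (c *\<^sub>C f) = c *\<^sub>C U f" for c f by (rule scale)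
  show norm: "norm (U f) = norm f" for f using assms by (simp add: unitary_def)
  show "surj U" using assms by (simp add: unitary_def)
  show "U 0 = 0" by (rule zero)
  show iso: "norm (U f - U g) = norm (f - g)" for f g
    using norm[of "f - g"] by (simp add: unitary_diff[OF assms])
  show "inj U"
  proof (rule injI)
    fix f g assume "U f = U g"
    then show "f = g" using iso[of f g] by simp
  qed
  \<comment> \<open>Polarisation gives the real part; replacing \<open>g\<close> by its multiple by
    the imaginary unit gives the imaginary part.\<close>
  have Re: "Re (cinner (U f) (U g)) = Re (cinner f g)" for f g
  proof -
    have "(norm (f + g))\<^sup>2 = (norm f)\<^sup>2 + (norm g)\<^sup>2 + 2 * inner f g" for f g :: L2
      by (simp add: power2_norm_eq_inner inner_add inner_commute)
    from this[of f g] this[of "U f" "U g"] show ?thesis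
      by (simp add: add[symmetric] norm inner_L2_def)
  qed
  have "Im (cinner (U f) (U g)) = Im (cinner f g)"
    using Re[of f "\<i> *\<^sub>C g"] by (simp add: scaleC cinner_scaleC_right)
  with Re show "cinner (U f) (U g) = cinner f g"
    by (simp add: complex_eq_iff)
qed

lemma unitaryI:
  assumes "\<And>f g. U (f + g) = U f + U g" "\<And>c f. U (c *\<^sub>C f) = c *\<^sub>C U f"
    and "\<And>f. norm (U f) = norm f" "surj U"
  shows "unitary U"
proof -
  have "Vector_Spaces.linear scaleC scaleC U"
    by unfold_locales (simp_all add: assms)
  then show ?thesis using assms by (simp add: unitary_def)
qed

lemma unitary_image_subspace: "unitary U \<Longrightarrow> L2.subspace V \<Longrightarrow> L2.subspace (U ` V)"
  unfolding unitary_def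
  by (metis Vector_Spaces.linear.axioms(3) module_hom.subspace_image)

lemma unitary_image_closed: "unitary U \<Longrightarrow> closed V \<Longrightarrow> closed (U ` V)"
  by (rule closed_isometric_image) (simp_all add: unitary_isometry)

lemma unitary_orth_proj:
  assumes U: "unitary U" and V: "L2.subspace V" "closed V"
  shows "orth_proj (U ` V) (U f) = U (orth_proj V f)"
proof (rule orth_proj_eqI)
  show "L2.subspace (U ` V)" using U V by (simp add: unitary_image_subspace)
  show "U (orth_proj V f) \<in> U ` V" using orth_proj_in[OF V] by blast
  fix h assume "h \<in> U ` V"
  then obtain k where "k \<in> V" "h = U k" by blast
  then show "cinner (U f - U (orth_proj V f)) h = 0"
    using orth_proj_orthogonal[OF V, of k f]
    by (simp add: unitary_diff[OF U, symmetric] unitary_cinner[OF U])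
qed

lemma unitary_fourier: "unitary fourier"
  by (simp add: fourier_eq_plancherel unitary_def plancherel_linear norm_plancherel plancherel_surj)

lemma fourier_abs_L2:
  assumes "integrable lborel f" "square_integrable f"
  shows "fourier (abs_L2 f) = abs_L2 (fourier_integral f)"
proof -
  have ae: "AE \<xi> in lborel. rep_L2 (fourier (abs_L2 f)) \<xi> = fourier_integral f \<xi>"
    using plancherel_integrable[OF assms] by (simp add: fourier_eq_plancherel)
  have "f \<in> borel_measurable borel" using assms by auto
  then have "square_integrable (fourier_integral f)"
    by (intro square_integrable_cong_AE[OF square_integrable_rep_L2 _ ae]) measurable
  then have "abs_L2 (rep_L2 (fourier (abs_L2 f))) = abs_L2 (fourier_integral f)"
    using ae by (subst abs_L2_eq_iff) auto
  then show ?thesis by simp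
qed

lemma square_integrable_aff:
  assumes sq: "square_integrable f" and "a \<noteq> 0" "b \<noteq> 0"
  shows "square_integrable (\<lambda>x. f (aff a b p q x))"
proof -
  have [measurable]: "f \<in> borel_measurable borel" using sq by measurable
  have "integrable lborel (\<lambda>x. (cmod (f (aff a b p q x)))\<^sup>2) \<longleftrightarrow> integrable lborel (\<lambda>x. (cmod (f x))\<^sup>2)"
    by (rule integrable_aff_iff[of "\<lambda>x. (cmod (f x))\<^sup>2"]) (use assms in auto)
  then show ?thesis
    using sq by (simp add: square_integrable_def)
qed

text \<open>Common form of translations, dilations, modulations and the single terms of the
  projection in the frequency domain, so that linearity, norms and compositions are computed
  once.\<close>

definition wcomp :: "(real^2 \<Rightarrow> complex) \<Rightarrow> real \<Rightarrow> real \<Rightarrow> real \<Rightarrow> real \<Rightarrow> L2 \<Rightarrow> L2" where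
  "wcomp u a b p q f = abs_L2 (\<lambda>x. u x * rep_L2 f (aff a b p q x))"

locale weighted_composition =
  fixes u :: "real^2 \<Rightarrow> complex" and a b C :: real
  assumes u_meas [measurable]: "u \<in> borel_measurable borel" and u_bound: "\<And>x. cmod (u x) \<le> C"
    and ab: "a \<noteq> 0" "b \<noteq> 0"
begin

lemma wcomp_square_integrable: "square_integrable f \<Longrightarrow> square_integrable (\<lambda>x. u x * f (aff a b p q x))"
  by (rule square_integrable_bounded_mult[of _ _ C]) (auto intro!: square_integrable_aff simp: ab u_bound)

lemma rep_wcomp: "AE x in lborel. rep_L2 (wcomp u a b p q f) x = u x * rep_L2 f (aff a b p q x)"
  unfolding wcomp_def by (rule rep_L2_abs_L2) (simp add: wcomp_square_integrable)

lemma wcomp_abs: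
  assumes "square_integrable f"
  shows "wcomp u a b p q (abs_L2 f) = abs_L2 (\<lambda>x. u x * f (aff a b p q x))"
  unfolding wcomp_def
  using AE_aff[OF rep_L2_abs_L2[OF assms] ab, of p q] assms
  by (subst abs_L2_eq_iff) (auto simp: wcomp_square_integrable elim!: eventually_mono)

lemma wcomp_add: "wcomp u a b p q (f + g) = wcomp u a b p q f + wcomp u a b p q g"
  unfolding L2_eq_iff
  using rep_wcomp[of p q "f + g"] rep_wcomp[of p q f] rep_wcomp[of p q g] AE_aff[OF rep_L2_add[of f g] ab, of p q]
    rep_L2_add[of "wcomp u a b p q f" "wcomp u a b p q g"]
  by eventually_elim (simp add: distrib_left)

lemma wcomp_scaleC: "wcomp u a b p q (c *\<^sub>C f) = c *\<^sub>C wcomp u a b p q f"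
  unfolding L2_eq_iff
  using rep_wcomp[of p q "c *\<^sub>C f"] rep_wcomp[of p q f] AE_aff[OF rep_L2_scaleC[of c f] ab, of p q]
    rep_L2_scaleC[of c "wcomp u a b p q f"]
  by eventually_elim simp

lemma norm_wcomp:
  assumes "\<And>x. cmod (u x) = sqrt \<bar>a * b\<bar>"
  shows "norm (wcomp u a b p q f) = norm f"
proof (rule power2_eq_imp_eq)
  have "(norm (wcomp u a b p q f))\<^sup>2 = (LINT x|lborel. (cmod (u x * rep_L2 f (aff a b p q x)))\<^sup>2)"
    unfolding wcomp_def by (rule norm_abs_L2) (simp add: wcomp_square_integrable)
  also have "\<dots> = \<bar>a * b\<bar> * (LINT x|lborel. (cmod (rep_L2 f (aff a b p q x)))\<^sup>2)"
    by (simp add: norm_mult power_mult_distrib assms)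
  also have "\<dots> = (norm f)\<^sup>2"
    unfolding norm_rep using integral_aff[of "\<lambda>x. (cmod (rep_L2 f x))\<^sup>2" a b p q] ab by simp
  finally show "(norm (wcomp u a b p q f))\<^sup>2 = (norm f)\<^sup>2" .
qed auto

end

lemma wcomp_wcomp:
  assumes "weighted_composition u a b C" "weighted_composition v a' b' C'"
  shows "wcomp u a b p q (wcomp v a' b' p' q' f) =
    wcomp (\<lambda>x. u x * v (aff a b p q x)) (a' * a) (b' * b) (a' * p + p') (b' * q + q') f"
proof -
  interpret u: weighted_composition u a b C by fact
  interpret v: weighted_composition v a' b' C' by fact
  have "0 \<le> C'" using v.u_bound[of 0] norm_ge_zero order_trans by blast
  then interpret uv: weighted_composition "\<lambda>x. u x * v (aff a b p q x)" "a' * a" "b' * b" "C * C'"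
    using u.ab v.ab by unfold_locales
      (auto simp: norm_mult intro!: mult_mono' u.u_bound v.u_bound)
  show ?thesis
    unfolding L2_eq_iff
    using u.rep_wcomp[of p q "wcomp v a' b' p' q' f"] AE_aff[OF v.rep_wcomp[of p' q' f] u.ab, of p q]
      uv.rep_wcomp[of "a' * p + p'" "b' * q + q'" f]
    by eventually_elim (simp add: aff_aff)
qed

lemma wcomp_id [simp]: "wcomp (\<lambda>_. 1) 1 1 0 0 f = f"
  by (simp add: wcomp_def)

text \<open>Diagonal dilations compose by multiplying parameters, so all integer powers of the two
  given dilations and their products become members of this one family.\<close>

definition dil :: "real \<Rightarrow> real \<Rightarrow> L2 \<Rightarrow> L2" where
  "dil a b = wcomp (\<lambda>_. of_real (sqrt (a * b))) a b 0 0"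

definition modulate :: "real^2 \<Rightarrow> L2 \<Rightarrow> L2" where
  "modulate v = wcomp (wave v) 1 1 0 0"

lemma wc_dil: "a > 0 \<Longrightarrow> b > 0 \<Longrightarrow> weighted_composition (\<lambda>_. of_real (sqrt (a * b))) a b (sqrt (a * b))"
  by unfold_locales auto

lemma wc_modulate: "weighted_composition (wave v) 1 1 1"
  by unfold_locales auto

lemma wc_translation: "weighted_composition (\<lambda>_. 1) 1 1 1"
  by unfold_locales auto

lemma translation_wcomp: "translation v = wcomp (\<lambda>_. 1) 1 1 (- v$1) (- v$2)"
proof -
  have "x - v = aff 1 1 (- v$1) (- v$2) x" for x by (simp add: vec2_eq_iff)
  then show ?thesis by (simp add: fun_eq_iff translation_def wcomp_def)
qed

lemma rep_dil: "a > 0 \<Longrightarrow> b > 0 \<Longrightarrow>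
    AE x in lborel. rep_L2 (dil a b f) x = of_real (sqrt (a * b)) * rep_L2 f (aff a b 0 0 x)"
  unfolding dil_def by (rule weighted_composition.rep_wcomp[OF wc_dil])

lemma rep_modulate: "AE x in lborel. rep_L2 (modulate v f) x = wave v x * rep_L2 f x"
  unfolding modulate_def using weighted_composition.rep_wcomp[OF wc_modulate, of v 0 0 f] by simp

lemma dil_dil: "a > 0 \<Longrightarrow> b > 0 \<Longrightarrow> c > 0 \<Longrightarrow> d > 0 \<Longrightarrow> dil a b (dil c d f) = dil (a * c) (b * d) f"
  unfolding dil_def by (subst wcomp_wcomp[OF wc_dil wc_dil])
    (auto simp: real_sqrt_mult[symmetric] mult_ac simp flip: of_real_mult)

lemma dil_1 [simp]: "dil 1 1 f = f"
  by (simp add: dil_def)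

lemma unitary_dil:
  assumes "a > 0" "b > 0"
  shows "unitary (dil a b)"
proof (rule unitaryI)
  interpret weighted_composition "\<lambda>_. of_real (sqrt (a * b))" a b "sqrt (a * b)"
    using assms by (rule wc_dil)
  show "dil a b (f + g) = dil a b f + dil a b g" "dil a b (c *\<^sub>C f) = c *\<^sub>C dil a b f" for f g c
    by (simp_all add: dil_def wcomp_add wcomp_scaleC)
  show "norm (dil a b f) = norm f" for f
    unfolding dil_def using assms by (intro norm_wcomp) auto
  show "surj (dil a b)"
    by (rule surjI[of _ "dil (1 / a) (1 / b)"]) (use assms in \<open>simp add: dil_dil\<close>)
qed

lemma isometry_translation: "norm (translation v f - translation v g) = norm (f - g)"
proof -
  interpret weighted_composition "\<lambda>_. 1" 1 1 1 by (rule wc_translation)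
  have "translation v (f - g) + translation v g = translation v f"
    unfolding translation_wcomp wcomp_add[symmetric] by simp
  then have "translation v f - translation v g = translation v (f - g)" by (simp add: algebra_simps)
  then show ?thesis by (simp add: translation_wcomp norm_wcomp)
qed

lemma isometry_modulate: "norm (modulate v f - modulate v g) = norm (f - g)"
proof -
  interpret weighted_composition "wave v" 1 1 1 by (rule wc_modulate)
  have "modulate v (f - g) + modulate v g = modulate v f"
    unfolding modulate_def wcomp_add[symmetric] by simp
  then have "modulate v f - modulate v g = modulate v (f - g)" by (simp add: algebra_simps)
  then show ?thesis by (simp add: modulate_def norm_wcomp)
qed

lemma square_integrable_fourier_integral:
  assumes "integrable lborel f" "square_integrable f"
  shows "square_integrable (fourier_integral f)"
proof -
  have "AE \<xi> in lborel. rep_L2 (plancherel (abs_L2 f)) \<xi> = fourier_integral f \<xi>"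
    using plancherel_integrable[OF assms] .
  moreover have "f \<in> borel_measurable borel" using assms by auto
  ultimately show ?thesis
    by (intro square_integrable_cong_AE[OF square_integrable_rep_L2]) auto
qed

text \<open>Both sides are isometric, so a change of variables in the Fourier integral of an
  integrable function suffices.\<close>

lemma fourier_translation: "fourier (translation v f) = modulate (- v) (fourier f)"
proof (rule isometries_eqI[where S = "\<lambda>f. fourier (translation v f)" and T = "\<lambda>f. modulate (- v) (fourier f)"])
  show "norm (fourier (translation v f) - fourier (translation v g)) = norm (f - g)" for f g
    by (simp add: unitary_isometry[OF unitary_fourier] isometry_translation)
  show "norm (modulate (- v) (fourier f) - modulate (- v) (fourier g)) = norm (f - g)" for f g
    by (simp add: unitary_isometry[OF unitary_fourier] isometry_modulate)
  fix f assume f: "integrable lborel f" "square_integrable f"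
  then have [measurable]: "f \<in> borel_measurable borel" by auto
  let ?t = "aff 1 1 (- v$1) (- v$2)"
  have t: "?t (x + v) = x" for x by (simp add: vec2_eq_iff)
  have tr: "translation v (abs_L2 f) = abs_L2 (\<lambda>x. f (?t x))"
    unfolding translation_wcomp by (subst weighted_composition.wcomp_abs[OF wc_translation f(2)]) simp
  have "integrable lborel (\<lambda>x. f (?t x))" "square_integrable (\<lambda>x. f (?t x))"
    using f by (auto simp: integrable_aff_iff intro: square_integrable_aff)
  then have "fourier (translation v (abs_L2 f)) = abs_L2 (fourier_integral (\<lambda>x. f (?t x)))"
    unfolding tr by (rule fourier_abs_L2)
  also have "fourier_integral (\<lambda>x. f (?t x)) = (\<lambda>\<xi>. wave (- v) \<xi> * fourier_integral f \<xi>)"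
  proof
    fix \<xi>
    have s: "aff 1 1 (v$1) (v$2) x = x + v" for x by (simp add: vec2_eq_iff)
    have "(LINT x|lborel. wave (- \<xi>) x * f (?t x)) = (LINT x|lborel. wave (- \<xi>) (x + v) * f (?t (x + v)))"
      using integral_aff[of "\<lambda>x. wave (- \<xi>) x * f (?t x)" 1 1 "v$1" "v$2"] unfolding s by simp
    also have "\<dots> = wave (- \<xi>) v * (LINT x|lborel. wave (- \<xi>) x * f x)"
      unfolding t wave_add_right by (simp add: mult_ac flip: integral_mult_right_zero)
    finally show "fourier_integral (\<lambda>x. f (?t x)) \<xi> = wave (- v) \<xi> * fourier_integral f \<xi>"
      by (simp add: fourier_integral_wave wave_def inner_commute)
  qed
  also have "abs_L2 (\<lambda>\<xi>. wave (- v) \<xi> * fourier_integral f \<xi>) = modulate (- v) (abs_L2 (fourier_integral f))"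
    unfolding modulate_def
    by (subst weighted_composition.wcomp_abs[OF wc_modulate square_integrable_fourier_integral[OF f]]) simp
  also have "\<dots> = modulate (- v) (fourier (abs_L2 f))"
    by (simp add: fourier_abs_L2 f)
  finally show "fourier (translation v (abs_L2 f)) = modulate (- v) (fourier (abs_L2 f))" .
qed

lemma fourier_dil:
  assumes ab: "a > 0" "b > 0"
  shows "fourier (dil a b f) = dil (1 / a) (1 / b) (fourier f)"
proof (rule isometries_eqI[where S = "\<lambda>f. fourier (dil a b f)" and T = "\<lambda>f. dil (1 / a) (1 / b) (fourier f)"])
  show "norm (fourier (dil a b f) - fourier (dil a b g)) = norm (f - g)" for f g
    by (simp add: unitary_isometry[OF unitary_fourier] unitary_isometry[OF unitary_dil] ab)
  show "norm (dil (1 / a) (1 / b) (fourier f) - dil (1 / a) (1 / b) (fourier g)) = norm (f - g)" for f g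
    by (simp add: unitary_isometry[OF unitary_fourier] unitary_isometry[OF unitary_dil] ab)
  fix f assume f: "integrable lborel f" "square_integrable f"
  then have [measurable]: "f \<in> borel_measurable borel" by auto
  let ?c = "complex_of_real (sqrt (a * b))"
  let ?g = "\<lambda>x. ?c * f (aff a b 0 0 x)"
  have "dil a b (abs_L2 f) = abs_L2 ?g"
    unfolding dil_def by (rule weighted_composition.wcomp_abs[OF wc_dil[OF ab] f(2)])
  moreover have "integrable lborel ?g" "square_integrable ?g"
    using f ab by (auto simp: integrable_aff_iff intro: square_integrable_aff square_integrable_scale)
  ultimately have "fourier (dil a b (abs_L2 f)) = abs_L2 (fourier_integral ?g)"
    by (simp add: fourier_abs_L2)
  also have "fourier_integral ?g = (\<lambda>\<xi>. of_real (sqrt (1 / a * (1 / b))) * fourier_integral f (aff (1 / a) (1 / b) 0 0 \<xi>))"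
  proof
    fix \<xi>
    have w: "wave (- \<xi>) x = wave (- aff (1 / a) (1 / b) 0 0 \<xi>) (aff a b 0 0 x)" for x
      using ab by (simp add: wave_def inner_vec2)
    have "(LINT x|lborel. wave (- aff (1 / a) (1 / b) 0 0 \<xi>) x * f x) = (a * b) *\<^sub>R (LINT x|lborel. wave (- \<xi>) x * f (aff a b 0 0 x))"
      using integral_aff[of "\<lambda>x. wave (- aff (1 / a) (1 / b) 0 0 \<xi>) x * f x" a b 0 0] ab by (simp add: w)
    \<comment> \<open>The Jacobian a b times the normalisation of the inverse dilation is the
      normalisation of the original one.\<close>
    moreover have "sqrt (1 / a * (1 / b)) * (a * b) = sqrt (a * b)"
      using ab by (simp add: real_sqrt_mult real_sqrt_divide field_simps)
    then have "complex_of_real (sqrt (1 / a * (1 / b))) * of_real (a * b) = ?c"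
      by (metis of_real_mult)
    ultimately show "fourier_integral ?g \<xi> = of_real (sqrt (1 / a * (1 / b))) * fourier_integral f (aff (1 / a) (1 / b) 0 0 \<xi>)"
      by (simp add: fourier_integral_wave scaleR_conv_of_real mult.left_commute[of _ ?c] del: of_real_mult)
  qed
  also have "abs_L2 \<dots> = dil (1 / a) (1 / b) (abs_L2 (fourier_integral f))"
    unfolding dil_def using ab
    by (intro weighted_composition.wcomp_abs[OF wc_dil square_integrable_fourier_integral[OF f], symmetric]) auto
  also have "\<dots> = dil (1 / a) (1 / b) (fourier (abs_L2 f))"
    by (simp add: fourier_abs_L2 f)
  finally show "fourier (dil a b (abs_L2 f)) = dil (1 / a) (1 / b) (fourier (abs_L2 f))" .
qed

lemma funpow_dil: "a > 0 \<Longrightarrow> b > 0 \<Longrightarrow> (dil a b ^^ n) f = dil (a ^ n) (b ^ n) f"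
  by (induction n) (simp_all add: dil_dil)

lemma inv_dil: "a > 0 \<Longrightarrow> b > 0 \<Longrightarrow> inv (dil a b) = dil (1 / a) (1 / b)"
  by (rule inv_equality) (simp_all add: dil_dil)

lemma op_power_int_dil:
  assumes "a > 0" "b > 0"
  shows "op_power_int (dil a b) n = dil (a powi n) (b powi n)"
  using assms by (auto simp: fun_eq_iff op_power_int_def inv_dil funpow_dil power_int_def power_one_over inverse_eq_divide)

lemma dilation_diag:
  assumes "a > 0" "b > 0"
  shows "dilation (vector [vector [a, 0], vector [0, b]]) = dil a b"
proof
  fix f
  have v: "vector [vector [a, 0], vector [0, b]] *v x = aff a b 0 0 x" for x :: "real^2"
    by (simp add: vec2_eq_iff matrix_vector_mult_def sum_2)
  have d: "det (vector [vector [a, 0], vector [0, b]] :: real^2^2) = a * b"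
    by (simp add: det_2)
  show "dilation (vector [vector [a, 0], vector [0, b]]) f = dil a b f"
    using assms unfolding dilation_def dil_def wcomp_def v d by simp
qed


section \<open>Commuting projections\<close>

lemma orth_proj_mem:
  "L2.subspace V \<Longrightarrow> f \<in> V \<Longrightarrow> orth_proj V f = f"
  by (rule orth_proj_eqI) auto

lemma orth_proj_symmetric:
  assumes "L2.subspace V" "closed V"
  shows "cinner (orth_proj V f) g = cinner f (orth_proj V g)"
proof -
  have "cinner (f - orth_proj V f) (orth_proj V g) = 0"
    by (rule orth_proj_orthogonal[OF assms orth_proj_in[OF assms]])
  moreover have "cinner (g - orth_proj V g) (orth_proj V f) = 0"
    by (rule orth_proj_orthogonal[OF assms orth_proj_in[OF assms]])
  then have "cinner (orth_proj V f) (g - orth_proj V g) = 0"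
    by (metis cinner_commute complex_cnj_zero)
  ultimately show ?thesis by (simp add: cinner_diff_left cinner_diff_right)
qed

lemma cinner_eqI: "(\<And>h. cinner f h = cinner g h) \<Longrightarrow> f = g"
proof -
  assume "\<And>h. cinner f h = cinner g h"
  then have "cinner (f - g) (f - g) = 0"
    by (simp add: cinner_diff_left)
  then show "f = g" by (simp add: cinner_self_norm)
qed

lemma orth_proj_subset:
  assumes V: "L2.subspace V" "closed V" and W: "L2.subspace W" "closed W" and "V \<subseteq> W"
  shows "orth_proj W (orth_proj V f) = orth_proj V f" "orth_proj V (orth_proj W f) = orth_proj V f"
proof -
  show 1: "orth_proj W (orth_proj V f) = orth_proj V f" for f
    using orth_proj_in[OF V, of f] \<open>V \<subseteq> W\<close> W(1) by (intro orth_proj_mem) auto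
  show "orth_proj V (orth_proj W f) = orth_proj V f"
    by (rule cinner_eqI) (simp add: orth_proj_symmetric V W 1)
qed

text \<open>Every product of two projections equals the projection with the minima of the indices.
  \<open>key\<close> is the case of neighbouring indices, and two inductions enlarge the
  gaps.\<close>

lemma orth_proj_commuting:
  fixes V :: "int \<Rightarrow> int \<Rightarrow> L2 set"
  assumes sub: "\<And>i j. L2.subspace (V i j)" and cl: "\<And>i j. closed (V i j)"
    and mono: "\<And>i j l m. i \<le> l \<Longrightarrow> j \<le> m \<Longrightarrow> V i j \<subseteq> V l m"
    and key: "\<And>i j f. f \<in> V i (j + 1) \<Longrightarrow> orth_proj (V (i + 1) j) f \<in> V i j"
  shows "orth_proj (V i j) \<circ> orth_proj (V l m) = orth_proj (V l m) \<circ> orth_proj (V i j)"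
proof -
  define P where "P i j = orth_proj (V i j)" for i j
  have PP: "P l m (P i j f) = P i j f" "P i j (P l m f) = P i j f" if "i \<le> l" "j \<le> m" for i j l m f
    unfolding P_def using mono[OF that] by (auto intro!: orth_proj_subset sub cl)
  have 1: "P (i + 1) j (P i (j + 1) f) = P i j f" for i j f
  proof -
    have "P i (j + 1) f \<in> V i (j + 1)"
      unfolding P_def by (rule orth_proj_in[OF sub cl])
    then have "P i j (P (i + 1) j (P i (j + 1) f)) = P (i + 1) j (P i (j + 1) f)"
      unfolding P_def by (intro orth_proj_mem sub key)
    then show ?thesis by (simp add: PP)
  qed
  \<comment> \<open>Insert the projection with indices i + 1 and j + n, which contains the range in
    question, and apply the neighbouring case at height j + n.\<close>
  have 2: "P (i + 1) j (P i (j + int n) f) = P i j f" for i j n f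
  proof (induction n arbitrary: f)
    case 0
    show ?case by (simp add: PP)
  next
    case (Suc n)
    have "P (i + 1) j (P i (j + int (Suc n)) f) = P (i + 1) j (P (i + 1) (j + int n) (P i (j + int n + 1) f))"
      by (simp add: PP add_ac)
    also have "\<dots> = P i j f" by (simp only: 1 Suc)
    finally show ?case .
  qed
  have 3: "P (i + int m) j (P i (j + int n) f) = P i j f" for i j m n f
  proof (induction m arbitrary: f)
    case 0
    show ?case by (simp add: PP)
  next
    case (Suc m)
    have "P (i + int (Suc m)) j (P i (j + int n) f) = P (i + int m + 1) j (P (i + int m) (j + int n) (P i (j + int n) f))"
      by (simp add: PP add_ac)
    also have "\<dots> = P i j f" by (simp only: 2 Suc)
    finally show ?case .
  qed
  have 4: "P l m (P i j f) = P i m f" if "i \<le> l" "m \<le> j" for i j l m f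
    using 3[of i "nat (l - i)" m "nat (j - m)" f] that by simp
  \<comment> \<open>The adjoint of 4.\<close>
  have 5: "P i j (P l m f) = P i m f" if "i \<le> l" "m \<le> j" for i j l m f
    by (rule cinner_eqI) (use 4[OF that] in \<open>simp add: P_def orth_proj_symmetric sub cl\<close>)
  have "P i j (P l m f) = P l m (P i j f)" for f
    using PP[of i l j m f] PP[of l i m j f] 4[of i l m j f] 5[of i l m j f] 4[of l i j m f] 5[of l i j m f]
    by (cases "i \<le> l"; cases "j \<le> m") auto
  then show ?thesis by (simp add: fun_eq_iff P_def)
qed

section \<open>Quotients of functions with a common periodic factor\<close>

text \<open>If \<open>N = m D\<close> with \<open>m\<close> periodic, then \<open>m\<close> is the quotient \<open>N / D\<close> at any translate where \<open>D\<close> does not vanish.\<close>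

definition periodic_quotient ::
    "(real \<Rightarrow> real \<Rightarrow> 'a) \<Rightarrow> (real \<Rightarrow> real \<Rightarrow> 'a) \<Rightarrow> real \<Rightarrow> real \<Rightarrow> 'a :: field" where
  "periodic_quotient N D x y = (SOME z. \<exists>(m::int) (n::int).
     D (x + 2*pi*m) (y + 2*pi*n) \<noteq> 0 \<and> z = N (x + 2*pi*m) (y + 2*pi*n) / D (x + 2*pi*m) (y + 2*pi*n))"

text \<open>Reindexing the translates shows that both choices are made from literally the same
  predicate; hence periodicity holds at every point, even where no translate of \<open>D\<close> is
  nonzero.\<close>

lemma periodic_quotient_periodic:
  fixes m n :: int
  shows "periodic_quotient N D (x + 2*pi*m) (y + 2*pi*n) = periodic_quotient N D x y"
proof -
  have shift: "t + 2*pi*k + 2*pi*l = t + 2*pi*(k + l :: int)" for t k l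
    by (simp add: algebra_simps)
  have "(\<exists>(k::int) (l::int). Q (x + 2*pi*m + 2*pi*k) (y + 2*pi*n + 2*pi*l)) \<longleftrightarrow> (\<exists>(k::int) (l::int). Q (x + 2*pi*k) (y + 2*pi*l))"
    for Q :: "real \<Rightarrow> real \<Rightarrow> bool"
    unfolding shift by (metis add_diff_cancel_left' add_diff_eq)
  then show ?thesis
    unfolding periodic_quotient_def by (intro arg_cong[where f = Eps] ext)
qed

text \<open>The cross relation makes the quotient independent of the chosen translate; where
  \<open>D\<close> vanishes, comparison with a translate where it does not forces \<open>N\<close>
  to vanish too.\<close>

lemma periodic_quotient_mult:
  assumes ex: "\<exists>(m::int) (n::int). D (x + 2*pi*m) (y + 2*pi*n) \<noteq> 0"
    and cross: "\<And>(m::int) (n::int). N x y * D (x + 2*pi*m) (y + 2*pi*n) = N (x + 2*pi*m) (y + 2*pi*n) * D x y"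
  shows "periodic_quotient N D x y * D x y = N x y"
proof (cases "D x y = 0")
  case True
  then show ?thesis using ex cross by (metis mult_zero_right mult_eq_0_iff)
next
  case False
  let ?P = "\<lambda>z. \<exists>(m::int) (n::int). D (x + 2*pi*m) (y + 2*pi*n) \<noteq> 0 \<and> z = N (x + 2*pi*m) (y + 2*pi*n) / D (x + 2*pi*m) (y + 2*pi*n)"
  have "?P (periodic_quotient N D x y)"
    unfolding periodic_quotient_def using ex by (intro someI_ex[of ?P]) blast
  then obtain m n :: int where nz: "D (x + 2*pi*m) (y + 2*pi*n) \<noteq> 0"
    and eq: "periodic_quotient N D x y = N (x + 2*pi*m) (y + 2*pi*n) / D (x + 2*pi*m) (y + 2*pi*n)"
    by blast
  show ?thesis
    unfolding eq times_divide_eq_left nonzero_divide_eq_eq[OF nz] by (rule cross[symmetric])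
qed


section \<open>The scaling function in the frequency domain\<close>

text \<open>For \<open>2\<pi>/3 < \<bar>t\<bar> < 4\<pi>/3\<close> this is the only other translate of \<open>t\<close> by \<open>2\<pi>\<int>\<close> with absolute value below \<open>4\<pi>/3\<close>.\<close>

definition partner :: "real \<Rightarrow> real" where
  "partner t = (if t > 0 then t - 2*pi else t + 2*pi)"

lemma partner_range:
  "2*pi/3 < \<bar>t\<bar> \<Longrightarrow> \<bar>t\<bar> < 4*pi/3 \<Longrightarrow> 2*pi/3 < \<bar>partner t\<bar> \<and> \<bar>partner t\<bar> < 4*pi/3"
  using pi_gt_zero by (auto simp: partner_def abs_if split: if_splits)

lemma partner_partner: "2*pi/3 < \<bar>t\<bar> \<Longrightarrow> \<bar>t\<bar> < 4*pi/3 \<Longrightarrow> partner (partner t) = t"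
  using pi_gt_zero by (auto simp: partner_def abs_if split: if_splits)

lemma shift_eq_partner:
  fixes k :: int
  assumes "\<bar>t\<bar> < 4*pi/3" "\<bar>t + 2*pi*k\<bar> < 4*pi/3" "k \<noteq> 0"
  shows "t + 2*pi*k = partner t" "2*pi/3 < \<bar>t\<bar>"
proof -
  have "\<bar>2*pi*k\<bar> < 2*pi*2"
    using assms(1,2) pi_gt_zero by linarith
  then have "2*pi*\<bar>real_of_int k\<bar> < 2*pi*2"
    by (simp add: abs_mult)
  then have "\<bar>real_of_int k\<bar> < 2" by simp
  then have "k = 1 \<or> k = -1" using assms(3) by linarith
  then show "t + 2*pi*k = partner t" "2*pi/3 < \<bar>t\<bar>"
    using assms(1,2) pi_gt_zero by (auto simp: partner_def abs_if split: if_splits)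
qed

text \<open>A support of radius 4 pi / 3 contains at most \<open>t\<close> and its partner; below 2
  pi / 3 the partner is outside as well.\<close>

lemma sum_shifts:
  fixes h :: "real \<Rightarrow> real"
  assumes "\<And>t. 4*pi/3 \<le> \<bar>t\<bar> \<Longrightarrow> h t = 0" "\<bar>t\<bar> < 4*pi/3" "\<bar>t\<bar> \<noteq> 2*pi/3"
  shows "(\<Sum>k\<in>{-1..1::int}. h (t + 2*pi*k)) = (if \<bar>t\<bar> < 2*pi/3 then h t else h t + h (partner t))"
proof -
  have K: "{-1..1::int} = {-1, 0, 1}" by auto
  show ?thesis
    using assms pi_gt_zero unfolding K
    by (auto simp: partner_def abs_if split: if_splits)
qed

text \<open>
  \<open>F\<close> is a representative of \<open>2\<pi>\<close> times the Fourier transform of the scaling function. The identities hold on a set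
  \<open>G\<close> of full measure; its invariance under rational affine maps allows them to be iterated.
\<close>

locale scaling_profile =
  fixes F :: "real \<Rightarrow> real \<Rightarrow> real" and G :: "real \<Rightarrow> real \<Rightarrow> bool"
  assumes G_affine: "\<And>x y a b p q. G x y \<Longrightarrow> a \<in> \<rat> \<Longrightarrow> b \<in> \<rat> \<Longrightarrow> p \<in> \<rat> \<Longrightarrow> q \<in> \<rat> \<Longrightarrow> a \<noteq> 0 \<Longrightarrow> b \<noteq> 0 \<Longrightarrow>
      G (a * x + p * pi) (b * y + q * pi)"
    and G_irrational: "\<And>x y q. G x y \<Longrightarrow> q \<in> \<rat> \<Longrightarrow> x \<noteq> q * pi \<and> y \<noteq> q * pi"
    and F_nonneg: "\<And>x y. 0 \<le> F x y" and F_le_1: "\<And>x y. F x y \<le> 1"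
    and F_support: "\<And>x y. F x y \<noteq> 0 \<Longrightarrow> \<bar>x\<bar> < 4*pi/3 \<and> \<bar>y\<bar> < 4*pi/3"
    and F_center: "\<And>x y. G x y \<Longrightarrow> \<bar>x\<bar> < 2*pi/3 \<Longrightarrow> \<bar>y\<bar> < 2*pi/3 \<Longrightarrow> F x y = 1"
    and F_corner: "\<And>x y. G x y \<Longrightarrow> 2*pi/3 < x \<Longrightarrow> x < 4*pi/3 \<Longrightarrow> 2*pi/3 < y \<Longrightarrow> y < 4*pi/3 \<Longrightarrow>
      (F x y)\<^sup>2 + (F x (y - 2*pi))\<^sup>2 + (F (x - 2*pi) y)\<^sup>2 + (F (x - 2*pi) (y - 2*pi))\<^sup>2 = 1 \<and>
      F x y * F (x - 2*pi) (y - 2*pi) = F (x - 2*pi) y * F x (y - 2*pi)"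
    and F_edge1: "\<And>x y. G x y \<Longrightarrow> pi/3 < \<bar>x\<bar> \<Longrightarrow> \<bar>x\<bar> < 2*pi/3 \<Longrightarrow> 2*pi/3 < \<bar>y\<bar> \<Longrightarrow> \<bar>y\<bar> < 4*pi/3 \<Longrightarrow>
      (F (2*x) y)\<^sup>2 + (F (2*x) (partner y))\<^sup>2 \<noteq> 0 \<and>
      (F x y)\<^sup>2 * ((F (2*x) y)\<^sup>2 + (F (2*x) (partner y))\<^sup>2) = (F (2*x) y)\<^sup>2"
    and F_edge2: "\<And>x y. G x y \<Longrightarrow> 2*pi/3 < \<bar>x\<bar> \<Longrightarrow> \<bar>x\<bar> < 4*pi/3 \<Longrightarrow> pi/3 < \<bar>y\<bar> \<Longrightarrow> \<bar>y\<bar> < 2*pi/3 \<Longrightarrow>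
      (F x (2*y))\<^sup>2 + (F (partner x) (2*y))\<^sup>2 \<noteq> 0 \<and>
      (F x y)\<^sup>2 * ((F x (2*y))\<^sup>2 + (F (partner x) (2*y))\<^sup>2) = (F x (2*y))\<^sup>2"
    and F_double1: "\<And>x y. G x y \<Longrightarrow> \<bar>x\<bar> < pi/3 \<Longrightarrow> 2*pi/3 < \<bar>y\<bar> \<Longrightarrow> \<bar>y\<bar> < 4*pi/3 \<Longrightarrow> F x y = F (2*x) y"
    and F_double2: "\<And>x y. G x y \<Longrightarrow> 2*pi/3 < \<bar>x\<bar> \<Longrightarrow> \<bar>x\<bar> < 4*pi/3 \<Longrightarrow> \<bar>y\<bar> < pi/3 \<Longrightarrow> F x y = F x (2*y)"
begin

text \<open>Exchanging the coordinates interchanges the two edge and the two doubling conditions, so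
  each one-sided result also yields its mirror image.\<close>

lemma swap: "scaling_profile (\<lambda>x y. F y x) (\<lambda>x y. G y x)"
proof (rule scaling_profile.intro, goal_cases)
  case (1 x y a b p q)
  then show ?case using G_affine[of y x b a q p] by simp
next
  case (2 x y q)
  then show ?case using G_irrational[of y x q] by simp
next
  case (3 x y)
  show ?case by (rule F_nonneg)
next
  case (4 x y)
  show ?case by (rule F_le_1)
next
  case (5 x y)
  then show ?case using F_support[of y x] by simp
next
  case (6 x y)
  then show ?case by (intro F_center)
next
  case (7 x y)
  then show ?case using F_corner[of y x] by (simp add: mult.commute add_ac)
next
  case (8 x y)
  then show ?case by (intro F_edge2)
next
  case (9 x y)
  then show ?case by (intro F_edge1)
next
  case (10 x y)
  then show ?case by (intro F_double2)
next
  case (11 x y)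
  then show ?case by (intro F_double1)
qed

lemma G_shift:
  fixes m n :: int
  assumes "G x y"
  shows "G (x + 2*pi*m) (y + 2*pi*n)"
  using G_affine[OF assms, of 1 1 "2 * of_int m" "2 * of_int n"] by (simp add: mult_ac)

lemma G_scale: "G x y \<Longrightarrow> a \<in> \<rat> \<Longrightarrow> b \<in> \<rat> \<Longrightarrow> a \<noteq> 0 \<Longrightarrow> b \<noteq> 0 \<Longrightarrow> G (a * x) (b * y)"
  using G_affine[of x y a b 0 0] by simp

lemma G_partner:
  assumes "G x y"
  shows "G x (partner y)" "G (partner x) y"
  using G_shift[OF assms, of 0 1] G_shift[OF assms, of 0 "-1"]
    G_shift[OF assms, of 1 0] G_shift[OF assms, of "-1" 0]
  by (auto simp: partner_def)

lemma G_neq: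
  assumes "G x y" "q \<in> \<rat>"
  shows "\<bar>x\<bar> \<noteq> q * pi" "\<bar>y\<bar> \<noteq> q * pi"
  using G_irrational[OF assms(1), of q] G_irrational[OF assms(1), of "- q"] assms(2)
  by (auto simp: abs_if)

lemma G_bounds:
  assumes "G x y"
  shows "\<bar>x\<bar> \<noteq> pi/3" "\<bar>y\<bar> \<noteq> pi/3" "\<bar>x\<bar> \<noteq> 2*pi/3" "\<bar>y\<bar> \<noteq> 2*pi/3" "\<bar>x\<bar> \<noteq> 4*pi/3" "\<bar>y\<bar> \<noteq> 4*pi/3"
    "x \<noteq> 0" "\<bar>x\<bar> \<noteq> pi" "\<bar>y\<bar> \<noteq> pi"
  using G_neq[OF assms, of "1/3"] G_neq[OF assms, of "2/3"] G_neq[OF assms, of "4/3"] G_neq[OF assms, of 0]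
    G_neq[OF assms, of 1]
  by auto

lemma F_outside: "4*pi/3 \<le> \<bar>x\<bar> \<or> 4*pi/3 \<le> \<bar>y\<bar> \<Longrightarrow> F x y = 0"
  using F_support[of x y] by linarith

text \<open>For |x| > pi/3 the edge condition at \<open>y\<close> and at its partner gives two
  fractions with a common denominator that add up to 1. For smaller |x| the doubling condition moves
  the question to 2x; as x is nonzero, finitely many doublings suffice.\<close>

lemma edge_sum:
  assumes "G x y" "\<bar>x\<bar> < 2*pi/3" "2*pi/3 < \<bar>y\<bar>" "\<bar>y\<bar> < 4*pi/3"
  shows "(F x y)\<^sup>2 + (F x (partner y))\<^sup>2 = 1"
proof -
  note y = assms(3,4)
  have y': "2*pi/3 < \<bar>partner y\<bar>" "\<bar>partner y\<bar> < 4*pi/3" "partner (partner y) = y"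
    using partner_range[OF y] partner_partner[OF y] by auto
  \<comment> \<open>The exponent bounds the number of doublings that are still needed.\<close>
  have "G x y \<Longrightarrow> \<bar>x\<bar> < 2*pi/3 \<Longrightarrow> pi/3 < 2^n * \<bar>x\<bar> \<Longrightarrow> (F x y)\<^sup>2 + (F x (partner y))\<^sup>2 = 1" for n x
  proof (induction n arbitrary: x)
    case (Suc n)
    show ?case
    proof (cases "\<bar>x\<bar> < pi/3")
      case True
      have "G (2*x) y" using G_scale[OF Suc.prems(1), of 2 1] by simp
      then have "(F (2*x) y)\<^sup>2 + (F (2*x) (partner y))\<^sup>2 = 1"
        using Suc.prems True by (intro Suc.IH) (auto simp: abs_mult)
      then show ?thesis
        using F_double1[OF Suc.prems(1) True y] F_double1[OF G_partner(1)[OF Suc.prems(1)] True y'(1,2)] by simp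
    next
      case False
      then have x: "pi/3 < \<bar>x\<bar>" using G_bounds(1)[OF Suc.prems(1)] by simp
      show ?thesis
        using F_edge1[OF Suc.prems(1) x Suc.prems(2) y]
          F_edge1[OF G_partner(1)[OF Suc.prems(1)] x Suc.prems(2) y'(1,2)]
        unfolding y'(3) by (smt (verit) distrib_right mult_cancel_right1)
    qed
  next
    case (0 x)
    then have x: "pi/3 < \<bar>x\<bar>" by simp
    show ?case
      using F_edge1[OF 0(1) x 0(2) y] F_edge1[OF G_partner(1)[OF 0(1)] x 0(2) y'(1,2)]
      unfolding y'(3) by (smt (verit) distrib_right mult_cancel_right1)
  qed
  moreover have "\<exists>n. pi/3 < 2^n * \<bar>x\<bar>"
  proof -
    have "\<bar>x\<bar> > 0" using G_bounds(7)[OF assms(1)] by simp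
    obtain n where "pi/3 / \<bar>x\<bar> < 2^n" using real_arch_pow[of 2 "pi/3 / \<bar>x\<bar>"] by auto
    then show ?thesis using \<open>\<bar>x\<bar> > 0\<close> by (auto simp: field_simps)
  qed
  ultimately show ?thesis using assms by blast
qed

lemma corner:
  assumes "G x y" "2*pi/3 < \<bar>x\<bar>" "\<bar>x\<bar> < 4*pi/3" "2*pi/3 < \<bar>y\<bar>" "\<bar>y\<bar> < 4*pi/3"
  shows corner_sum: "(F x y)\<^sup>2 + (F x (partner y))\<^sup>2 + ((F (partner x) y)\<^sup>2 + (F (partner x) (partner y))\<^sup>2) = 1"
    and corner_product: "F x y * F (partner x) (partner y) = F (partner x) y * F x (partner y)"
proof -
  \<comment> \<open>The translate of the point in the positive corner square, where
    \<open>F_corner\<close> is stated.\<close>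
  define x0 where "x0 = (if x > 0 then x else x + 2*pi)"
  define y0 where "y0 = (if y > 0 then y else y + 2*pi)"
  have r: "2*pi/3 < x0" "x0 < 4*pi/3" "2*pi/3 < y0" "y0 < 4*pi/3"
    using assms pi_gt_zero by (auto simp: x0_def y0_def abs_if split: if_splits)
  have G0: "G x0 y0"
    using G_shift[OF assms(1), of 0 1] G_shift[OF assms(1), of 1 0] G_shift[OF assms(1), of 1 1] assms(1)
    by (auto simp: x0_def y0_def)
  have cx: "x = x0 \<and> partner x = x0 - 2*pi \<or> x = x0 - 2*pi \<and> partner x = x0"
    by (auto simp: x0_def partner_def)
  have cy: "y = y0 \<and> partner y = y0 - 2*pi \<or> y = y0 - 2*pi \<and> partner y = y0"
    by (auto simp: y0_def partner_def)
  show "(F x y)\<^sup>2 + (F x (partner y))\<^sup>2 + ((F (partner x) y)\<^sup>2 + (F (partner x) (partner y))\<^sup>2) = 1"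
    using cx cy by (elim disjE conjE; simp only:) (use F_corner[OF G0 r] in linarith)+
  show "F x y * F (partner x) (partner y) = F (partner x) y * F x (partner y)"
    using cx cy by (elim disjE conjE; simp only:) (use F_corner[OF G0 r] in \<open>simp_all add: mult.commute\<close>)
qed

text \<open>Independence of the two coordinates: a \<open>2 \<times> 2\<close> probability matrix of rank one is the product of its marginals.\<close>

lemma corner_marginals:
  assumes "G x y" "2*pi/3 < \<bar>x\<bar>" "\<bar>x\<bar> < 4*pi/3" "2*pi/3 < \<bar>y\<bar>" "\<bar>y\<bar> < 4*pi/3"
  shows "(F x y)\<^sup>2 = ((F x y)\<^sup>2 + (F x (partner y))\<^sup>2) * ((F x y)\<^sup>2 + (F (partner x) y)\<^sup>2)"
    and "F x y \<noteq> 0"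
proof -
  define a b c d where "a = (F x y)\<^sup>2" "b = (F x (partner y))\<^sup>2" "c = (F (partner x) y)\<^sup>2" "d = (F (partner x) (partner y))\<^sup>2"
  have sum: "a + b + (c + d) = 1"
    using corner_sum[OF assms] by (simp add: a_b_c_d_def)
  have prod: "a * d = b * c"
    using arg_cong[OF corner_product[OF assms], of "\<lambda>t. t\<^sup>2"] by (simp add: a_b_c_d_def power_mult_distrib)
  \<comment> \<open>Rank one, a d = b c, is exactly what turns the expanded product of the marginals
    into \<open>a\<close> times the total mass 1.\<close>
  have "(a + b) * (a + c) = a * (a + b + (c + d))"
    using prod by (simp add: algebra_simps)
  then show *: "(F x y)\<^sup>2 = ((F x y)\<^sup>2 + (F x (partner y))\<^sup>2) * ((F x y)\<^sup>2 + (F (partner x) y)\<^sup>2)"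
    unfolding sum by (simp add: a_b_c_d_def)
  \<comment> \<open>The denominators of the edge conditions at (x/2, y) and (x, y/2) are the two
    marginals at (x, y); their nonvanishing passes to \<open>F\<close> on all four corner
    squares.\<close>
  have "G (x/2) y" "G x (y/2)"
    using G_scale[OF assms(1), of "1/2" 1] G_scale[OF assms(1), of 1 "1/2"] by auto
  then have "(F x y)\<^sup>2 + (F x (partner y))\<^sup>2 \<noteq> 0" "(F x y)\<^sup>2 + (F (partner x) y)\<^sup>2 \<noteq> 0"
    using F_edge1[of "x/2" y] F_edge2[of x "y/2"] assms by auto
  then show "F x y \<noteq> 0" using * by auto
qed

text \<open>The translates inside the support form a single point, a pair or a quadruple, and
  \<open>F_center\<close>, \<open>edge_sum\<close> and \<open>corner_sum\<close> treat these
  cases.\<close>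

lemma sum_squares:
  assumes "G x y" "\<bar>x\<bar> < 4*pi/3" "\<bar>y\<bar> < 4*pi/3"
  shows "(\<Sum>k\<in>{-1..1::int}. \<Sum>l\<in>{-1..1::int}. (F (x + 2*pi*k) (y + 2*pi*l))\<^sup>2) = 1"
proof -
  interpret swap: scaling_profile "\<lambda>x y. F y x" "\<lambda>x y. G y x" by (rule swap)
  note n = G_bounds[OF assms(1)]
  have "(\<Sum>k\<in>{-1..1::int}. \<Sum>l\<in>{-1..1::int}. (F (x + 2*pi*k) (y + 2*pi*l))\<^sup>2) =
    (\<Sum>k\<in>{-1..1::int}. if \<bar>y\<bar> < 2*pi/3 then (F (x + 2*pi*k) y)\<^sup>2 else (F (x + 2*pi*k) y)\<^sup>2 + (F (x + 2*pi*k) (partner y))\<^sup>2)"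
    by (intro sum.cong refl sum_shifts) (use n assms F_outside in auto)
  also have "\<dots> = (if \<bar>x\<bar> < 2*pi/3
      then if \<bar>y\<bar> < 2*pi/3 then (F x y)\<^sup>2 else (F x y)\<^sup>2 + (F x (partner y))\<^sup>2
      else (if \<bar>y\<bar> < 2*pi/3 then (F x y)\<^sup>2 else (F x y)\<^sup>2 + (F x (partner y))\<^sup>2)
         + (if \<bar>y\<bar> < 2*pi/3 then (F (partner x) y)\<^sup>2 else (F (partner x) y)\<^sup>2 + (F (partner x) (partner y))\<^sup>2))"
    by (rule sum_shifts) (use n assms F_outside in auto)
  also have "\<dots> = 1"
  proof (cases "\<bar>x\<bar> < 2*pi/3"; cases "\<bar>y\<bar> < 2*pi/3")
    assume x: "\<bar>x\<bar> < 2*pi/3" and y: "\<bar>y\<bar> < 2*pi/3"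
    then show ?thesis using F_center[OF assms(1) x y] by simp
  next
    assume x: "\<bar>x\<bar> < 2*pi/3" and y: "\<not> \<bar>y\<bar> < 2*pi/3"
    then have "2*pi/3 < \<bar>y\<bar>" using n(4) by linarith
    then show ?thesis using edge_sum[OF assms(1) x _ assms(3)] x y by simp
  next
    assume x: "\<not> \<bar>x\<bar> < 2*pi/3" and y: "\<bar>y\<bar> < 2*pi/3"
    then have "2*pi/3 < \<bar>x\<bar>" using n(3) by linarith
    then show ?thesis using swap.edge_sum[OF assms(1) y _ assms(2)] x y by simp
  next
    assume x: "\<not> \<bar>x\<bar> < 2*pi/3" and y: "\<not> \<bar>y\<bar> < 2*pi/3"
    then have "2*pi/3 < \<bar>x\<bar>" "2*pi/3 < \<bar>y\<bar>" using n(3,4) by linarith+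
    then show ?thesis using corner_sum[OF assms(1) _ assms(2) _ assms(3)] x y by simp
  qed
  finally show ?thesis .
qed

lemma exists_shift:
  obtains m :: int where "\<bar>t + 2*pi*m\<bar> \<le> pi"
proof
  let ?m = "- \<lfloor>t / (2*pi) + 1/2\<rfloor>"
  have "t / (2*pi) + 1/2 + of_int ?m \<ge> 0" "t / (2*pi) + 1/2 + of_int ?m \<le> 1"
    by linarith+
  then have "2*pi * (t / (2*pi) + 1/2 + of_int ?m) \<ge> 2*pi*0" "2*pi * (t / (2*pi) + 1/2 + of_int ?m) \<le> 2*pi*1"
    by (intro mult_left_mono; simp)+
  then show "\<bar>t + 2*pi*?m\<bar> \<le> pi"
    by (simp add: algebra_simps abs_le_iff)
qed

text \<open>A sum of squares equal to 1 has a nonzero term. This makes the periodic quotients by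
  \<open>F\<close> meaningful on the good set.\<close>

lemma nonzero_shift:
  assumes "G x y"
  shows "\<exists>(m::int) (n::int). F (x + 2*pi*m) (y + 2*pi*n) \<noteq> 0"
proof -
  obtain m :: int where m: "\<bar>x + 2*pi*m\<bar> \<le> pi"
    by (rule exists_shift)
  obtain n :: int where n: "\<bar>y + 2*pi*n\<bar> \<le> pi"
    by (rule exists_shift)
  note mn = m n
  then have "\<bar>x + 2*pi*m\<bar> < 4*pi/3" "\<bar>y + 2*pi*n\<bar> < 4*pi/3"
    using pi_gt_zero by linarith+
  note s = sum_squares[OF G_shift[OF assms, of m n] this]
  have sh: "t + 2*pi*k + 2*pi*l = t + 2*pi*(k + l :: int)" for t k l
    by (simp add: algebra_simps)
  have "\<exists>(k::int) (l::int). F (x + 2*pi*(m + k)) (y + 2*pi*(n + l)) \<noteq> 0"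
  proof (rule ccontr)
    assume "\<not> ?thesis"
    then show False using s unfolding sh by simp
  qed
  then show ?thesis by blast
qed

text \<open>If doubling does not already leave the support, the value 1 in the centre puts a zero of
  \<open>F\<close> into the edge strip, where the edge or doubling condition ties
  \<open>F x y\<close> to \<open>F (2*x) y\<close>.\<close>

lemma F_zero_imp:
  assumes "G x y" "F x y = 0"
  shows "F (2*x) y = 0"
proof (cases "\<bar>x\<bar> < 2*pi/3 \<and> \<bar>y\<bar> < 4*pi/3")
  case True
  then have y: "2*pi/3 < \<bar>y\<bar>" "\<bar>y\<bar> < 4*pi/3"
    using F_center[OF assms(1)] assms(2) G_bounds[OF assms(1)] by force+
  show ?thesis
    using F_double1[OF assms(1) _ y] F_edge1[OF assms(1) _ _ y] True G_bounds[OF assms(1)] assms(2)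
    by (cases "\<bar>x\<bar> < pi/3") auto
qed (auto intro!: F_outside)

text \<open>This is the cross relation that makes \<open>F (2*x) y\<close> over \<open>F x y\<close>
  periodic. If the first coordinate moves, both points have |x| > 2 pi / 3 and both numerators
  vanish; if only the second moves, it moves to the partner, and edge or doubling gives the same
  ratio.\<close>

lemma refinement_cross:
  fixes m n :: int
  assumes "G x y"
  shows "F (2*x) y * F (x + 2*pi*m) (y + 2*pi*n) = F (2 * (x + 2*pi*m)) (y + 2*pi*n) * F x y"
proof (cases "F x y = 0 \<or> F (x + 2*pi*m) (y + 2*pi*n) = 0")
  case True
  then show ?thesis
    using F_zero_imp[OF assms] F_zero_imp[OF G_shift[OF assms, of m n]] by auto
next
  case False
  then have xy: "\<bar>x\<bar> < 4*pi/3" "\<bar>y\<bar> < 4*pi/3" "\<bar>x + 2*pi*m\<bar> < 4*pi/3" "\<bar>y + 2*pi*n\<bar> < 4*pi/3"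
    using F_support by blast+
  show ?thesis
  proof (cases "m = 0")
    case False
    then have "2*pi/3 < \<bar>x\<bar>" "2*pi/3 < \<bar>x + 2*pi*m\<bar>"
      using shift_eq_partner[OF xy(1,3) False] partner_range[OF _ xy(1)] by auto
    then have "4*pi/3 \<le> \<bar>2*x\<bar>" "4*pi/3 \<le> \<bar>2 * (x + 2*pi*m)\<bar>"
      unfolding abs_mult by simp_all
    then have "F (2*x) y = 0" "F (2 * (x + 2*pi*m)) (y + 2*pi*n) = 0"
      by (blast intro: F_outside)+
    then show ?thesis by simp
  next
    case m0: True
    show ?thesis
    proof (cases "n = 0 \<or> 2*pi/3 < \<bar>x\<bar>")
      case True
      then show ?thesis
        using m0 F_outside[of "2*x" y] F_outside[of "2*x" "y + 2*pi*n"] by (auto simp: abs_mult)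
    next
      case False
      then have x: "\<bar>x\<bar> < 2*pi/3" using G_bounds(3)[OF assms] by linarith
      have y': "y + 2*pi*n = partner y" and y: "2*pi/3 < \<bar>y\<bar>"
        using shift_eq_partner[OF xy(2,4)] False by auto
      note py = partner_range[OF y xy(2)]
      have "F (2*x) y * F x (partner y) = F (2*x) (partner y) * F x y"
      proof (cases "\<bar>x\<bar> < pi/3")
        case True
        then show ?thesis
          using F_double1[OF assms True y xy(2)] F_double1[OF G_partner(1)[OF assms] True] py by simp
      next
        case False
        then have x': "pi/3 < \<bar>x\<bar>" using G_bounds(1)[OF assms] by linarith
        \<comment> \<open>The common denominator of the edge conditions at \<open>y\<close> and at
          its partner; it cancels from the ratio.\<close>
        define R where "R = (F (2*x) y)\<^sup>2 + (F (2*x) (partner y))\<^sup>2"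
        have 1: "(F (2*x) y)\<^sup>2 = (F x y)\<^sup>2 * R"
          using F_edge1[OF assms x' x y xy(2)] by (simp add: R_def)
        have 2: "(F (2*x) (partner y))\<^sup>2 = (F x (partner y))\<^sup>2 * R"
          using F_edge1[OF G_partner(1)[OF assms] x' x] py partner_partner[OF y xy(2)]
          by (simp add: add.commute R_def)
        show ?thesis
        proof (rule power2_eq_imp_eq)
          show "(F (2*x) y * F x (partner y))\<^sup>2 = (F (2*x) (partner y) * F x y)\<^sup>2"
            unfolding power_mult_distrib 1 2 by (simp add: mult_ac)
        qed (auto simp: F_nonneg)
      qed
      then show ?thesis using m0 y' by simp
    qed
  qed
qed

text \<open>The low-pass filter of the refinement equation in the first coordinate.\<close>

definition filter1 :: "real \<Rightarrow> real \<Rightarrow> real" where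
  "filter1 = periodic_quotient (\<lambda>x y. F (2*x) y) F"

lemma filter1_periodic: "filter1 (x + 2*pi * of_int m) (y + 2*pi * of_int n) = filter1 x y"
  unfolding filter1_def by (rule periodic_quotient_periodic)

lemma filter1:
  assumes "G x y"
  shows "filter1 x y * F x y = F (2*x) y"
  unfolding filter1_def
  by (rule periodic_quotient_mult[of F x y "\<lambda>x y. F (2*x) y", OF nonzero_shift[OF assms] refinement_cross[OF assms]])

text \<open>No translate of x lies within 2 pi / 3 of the origin, so at a translate where
  \<open>F\<close> is nonzero the doubled point is outside the support.\<close>

lemma filter1_zero:
  assumes "G x y" "2*pi/3 < \<bar>x\<bar>" "\<bar>x\<bar> \<le> pi"
  shows "filter1 x y = 0"
proof -
  obtain m n :: int where nz: "F (x + 2*pi*m) (y + 2*pi*n) \<noteq> 0"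
    using nonzero_shift[OF assms(1)] by blast
  have "2*pi/3 \<le> \<bar>x + 2*pi*m\<bar>"
  proof (cases "m = 0")
    case False
    then have "1 \<le> \<bar>real_of_int m\<bar>" by linarith
    then have "2*pi*1 \<le> 2*pi*\<bar>real_of_int m\<bar>" by (intro mult_left_mono) auto
    also have "\<dots> = \<bar>2*pi*m\<bar>" by (simp add: abs_mult)
    finally show ?thesis using assms(3) pi_gt_zero by linarith
  qed (use assms(2) in auto)
  then have "4*pi/3 \<le> \<bar>2 * (x + 2*pi*m)\<bar>" unfolding abs_mult by simp
  then have "F (2 * (x + 2*pi*m)) (y + 2*pi*n) = 0" by (blast intro: F_outside)
  then show ?thesis
    using filter1[OF G_shift[OF assms(1), of m n]] nz by (simp add: filter1_periodic)
qed

interpretation swap: scaling_profile "\<lambda>x y. F y x" "\<lambda>x y. G y x"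
  by (rule swap)

definition filter2 :: "real \<Rightarrow> real \<Rightarrow> real" where
  "filter2 x y = swap.filter1 y x"

lemma filter2_periodic: "filter2 (x + 2*pi * of_int m) (y + 2*pi * of_int n) = filter2 x y"
  by (simp only: filter2_def swap.filter1_periodic)

lemma filter2: "G x y \<Longrightarrow> filter2 x y * F x y = F x (2*y)"
  by (simp only: filter2_def swap.filter1)

lemma filter2_zero: "G x y \<Longrightarrow> 2*pi/3 < \<bar>y\<bar> \<Longrightarrow> \<bar>y\<bar> \<le> pi \<Longrightarrow> filter2 x y = 0"
  by (simp only: filter2_def swap.filter1_zero)

text \<open>In the centre F = 1, so the filters are plain values of \<open>F\<close> at points with
  one doubled coordinate. Four cases according to whether each coordinate is below pi / 3; only the
  last one lands in a corner square and uses the product relation there.\<close>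

lemma filters_commute_center:
  assumes "G x y" "\<bar>x\<bar> < 2*pi/3" "\<bar>y\<bar> < 2*pi/3"
  shows "filter1 x y * filter2 x y = filter2 (2*x) y * filter1 x (2*y)"
proof -
  have G2: "G (2*x) y" "G x (2*y)" "G (2*x) (2*y)"
    using G_scale[OF assms(1), of 2 1] G_scale[OF assms(1), of 1 2] G_scale[OF assms(1), of 2 2] by simp_all
  have F1: "F x y = 1" by (rule F_center[OF assms])
  have m1: "filter1 x y = F (2*x) y" and m2: "filter2 x y = F x (2*y)"
    using filter1[OF assms(1)] filter2[OF assms(1)] F1 by auto
  have m3: "filter2 (2*x) y * F (2*x) y = F (2*x) (2*y)" and m4: "filter1 x (2*y) * F x (2*y) = F (2*x) (2*y)"
    using filter2[OF G2(1)] filter1[OF G2(2)] by auto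
  have d2: "2*pi/3 < \<bar>2*t\<bar> \<longleftrightarrow> pi/3 < \<bar>t\<bar>" "\<bar>2*t\<bar> < 4*pi/3 \<longleftrightarrow> \<bar>t\<bar> < 2*pi/3" "\<bar>2*t\<bar> < 2*pi/3 \<longleftrightarrow> \<bar>t\<bar> < pi/3" for t :: real
    by (auto simp: abs_mult)
  consider "\<bar>x\<bar> < pi/3" "\<bar>y\<bar> < pi/3" | "\<bar>x\<bar> < pi/3" "pi/3 < \<bar>y\<bar>" | "pi/3 < \<bar>x\<bar>" "\<bar>y\<bar> < pi/3" | "pi/3 < \<bar>x\<bar>" "pi/3 < \<bar>y\<bar>"
    using G_bounds(1,2)[OF assms(1)] by linarith
  then show ?thesis
  proof cases
    case 1
    then have "F (2*x) y = 1" "F x (2*y) = 1" "F (2*x) (2*y) = 1"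
      using assms(2,3) by (auto intro!: F_center G2 simp: d2)
    then show ?thesis using m1 m2 m3 m4 by simp
  next
    case 2
    have "F (2*x) y = 1"
      using assms(3) 2 by (auto intro!: F_center G2 simp: d2)
    moreover have "F x (2*y) = F (2*x) (2*y)"
      using assms(3) 2 by (intro F_double1 G2) (auto simp: d2)
    ultimately show ?thesis using m1 m2 m3 m4 by (simp add: mult.commute)
  next
    case 3
    have "F x (2*y) = 1"
      using assms(2) 3 by (auto intro!: F_center G2 simp: d2)
    moreover have "F (2*x) y = F (2*x) (2*y)"
      using assms(2) 3 by (intro F_double2 G2) (auto simp: d2)
    ultimately show ?thesis using m1 m2 m3 m4 by (simp add: mult.commute)
  next
    case 4
    have c: "2*pi/3 < \<bar>2*x\<bar>" "\<bar>2*x\<bar> < 4*pi/3" "2*pi/3 < \<bar>2*y\<bar>" "\<bar>2*y\<bar> < 4*pi/3"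
      using 4 assms(2,3) by (simp_all only: d2)
    \<comment> \<open>Aim: \<open>?a * ?b = ?c\<close>. The edge conditions express
      \<open>?a\<close> and \<open>?b\<close> through the marginals \<open>R1\<close> and
      \<open>R2\<close> of the corner value \<open>?c\<close>, and independence says that the square
      of \<open>?c\<close> is their product. Nonvanishing of \<open>?c\<close> then allows the
      divisions.\<close>
    let ?a = "F (2*x) y" and ?b = "F x (2*y)" and ?c = "F (2*x) (2*y)"
    define R1 where "R1 = ?c\<^sup>2 + (F (partner (2*x)) (2*y))\<^sup>2"
    define R2 where "R2 = ?c\<^sup>2 + (F (2*x) (partner (2*y)))\<^sup>2"
    have cR: "?c\<^sup>2 = R2 * R1" "?c \<noteq> 0"
      using corner_marginals[OF G2(3) c] by (simp_all add: R1_def R2_def)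
    have b: "?b\<^sup>2 * R2 = ?c\<^sup>2"
      using F_edge1[OF G2(2) 4(1) assms(2) c(3,4)] by (simp add: R2_def)
    have a: "?a\<^sup>2 * R1 = ?c\<^sup>2"
      using F_edge2[OF G2(1) c(1,2) 4(2) assms(3)] by (simp add: R1_def)
    have "(?a * ?b)\<^sup>2 * ?c\<^sup>2 = (?a\<^sup>2 * R1) * (?b\<^sup>2 * R2)"
      unfolding cR(1) by (simp add: power_mult_distrib mult_ac)
    then have "(?a * ?b)\<^sup>2 * ?c\<^sup>2 = ?c\<^sup>2 * ?c\<^sup>2"
      unfolding a b .
    moreover have "?c\<^sup>2 \<noteq> 0"
      using cR(2) by simp
    ultimately have "(?a * ?b)\<^sup>2 = ?c\<^sup>2"
      by (metis mult_right_cancel)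
    then have ab: "?a * ?b = ?c"
      by (rule power2_eq_imp_eq) (auto simp: F_nonneg)
    then have "?a \<noteq> 0" "?b \<noteq> 0" using cR(2) by auto
    then have "filter2 (2*x) y = ?b" "filter1 x (2*y) = ?a"
      using m3 m4 ab by (metis mult.commute mult_right_cancel)+
    then show ?thesis using m1 m2 by (simp add: mult.commute)
  qed
qed

text \<open>Periodicity moves the point into the square of half-width pi. If it is not in the
  centre, some coordinate exceeds 2 pi / 3 and the filter for that coordinate vanishes on both
  sides.\<close>

lemma filters_commute:
  assumes "G x y"
  shows "filter1 x y * filter2 x y = filter2 (2*x) y * filter1 x (2*y)"
proof -
  obtain m :: int where m: "\<bar>x + 2*pi*m\<bar> \<le> pi"
    by (rule exists_shift)
  obtain n :: int where n: "\<bar>y + 2*pi*n\<bar> \<le> pi"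
    by (rule exists_shift)
  note mn = m n
  define x' where "x' = x + 2*pi*m" define y' where "y' = y + 2*pi*n"
  have G': "G x' y'" unfolding x'_def y'_def by (rule G_shift[OF assms])
  have "filter1 x' y' * filter2 x' y' = filter2 (2*x') y' * filter1 x' (2*y')"
  proof (cases "\<bar>x'\<bar> < 2*pi/3 \<and> \<bar>y'\<bar> < 2*pi/3")
    case True
    then show ?thesis using filters_commute_center[OF G'] by blast
  next
    case False
    have G2: "G (2*x') y'" "G x' (2*y')"
      using G_scale[OF G', of 2 1] G_scale[OF G', of 1 2] by simp_all
    have "2*pi/3 < \<bar>x'\<bar> \<or> 2*pi/3 < \<bar>y'\<bar>"
      using False G_bounds(3,4)[OF G'] by linarith
    then show ?thesis
      using filter1_zero[OF G'] filter2_zero[OF G'] filter1_zero[OF G2(2)] filter2_zero[OF G2(1)] mn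
      by (auto simp: x'_def y'_def)
  qed
  moreover have "2 * x' = 2 * x + 2*pi * of_int (2 * m)" "2 * y' = 2 * y + 2*pi * of_int (2 * n)"
    by (simp_all add: x'_def y'_def algebra_simps)
  moreover have "filter2 (2 * x + 2*pi * of_int (2 * m)) y' = filter2 (2*x) y"
    unfolding x'_def y'_def by (rule filter2_periodic)
  moreover have "filter1 x' (2 * y + 2*pi * of_int (2 * n)) = filter1 x (2*y)"
    unfolding x'_def y'_def by (rule filter1_periodic)
  moreover have "filter1 x' y' = filter1 x y" "filter2 x' y' = filter2 x y"
    unfolding x'_def y'_def by (rule filter1_periodic filter2_periodic)+
  ultimately show ?thesis by simp
qed

end

section \<open>The space spanned by the translates\<close>

lemma two_pi_pos: "0 < 2 * pi"
  by simp

abbreviation shift :: "int \<times> int \<Rightarrow> real^2 \<Rightarrow> real^2" where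
  "shift k \<equiv> aff 1 1 (2*pi * of_int (fst k)) (2*pi * of_int (snd k))"

lemma shift_eq: "shift k \<xi> = \<xi> + (2*pi) *\<^sub>R lattice_vec k"
  by (simp add: vec2_eq_iff)

lemma shift_shift: "shift k (shift l \<xi>) = shift (k + l) \<xi>"
  by (simp add: vec2_eq_iff algebra_simps)

lemma AE_shifts: "AE \<xi> in lborel. P \<xi> \<Longrightarrow> AE \<xi> in lborel. \<forall>k. P (shift k \<xi>)"
  unfolding AE_all_countable by (intro allI AE_aff) auto

definition periodic2 :: "(real \<Rightarrow> real \<Rightarrow> 'a) \<Rightarrow> bool" where
  "periodic2 m \<longleftrightarrow> (\<forall>x y. \<forall>k l :: int. m (x + 2*pi * of_int k) (y + 2*pi * of_int l) = m x y)"

lemma periodic2_shift: "periodic2 m \<Longrightarrow> m (shift k \<xi> $ 1) (shift k \<xi> $ 2) = m (\<xi>$1) (\<xi>$2)"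
  by (simp add: periodic2_def)

text \<open>Adds the measure theory to the pointwise algebra of
  \<open>scaling_profile\<close>.\<close>

locale frequency_profile = scaling_profile F G for F G +
  assumes F_measurable: "(\<lambda>\<xi>::real^2. F (\<xi>$1) (\<xi>$2)) \<in> borel_measurable borel"
    and AE_G: "AE \<xi>::real^2 in lborel. G (\<xi>$1) (\<xi>$2)"
begin

definition \<Phi> :: "real^2 \<Rightarrow> complex" where
  "\<Phi> \<xi> = of_real (F (\<xi>$1) (\<xi>$2))"

lemma measurable_\<Phi> [measurable]: "\<Phi> \<in> borel_measurable borel"
  unfolding \<Phi>_def using F_measurable by measurable

lemma cmod_\<Phi>: "cmod (\<Phi> \<xi>) \<le> 1"
  using F_le_1 F_nonneg by (simp add: \<Phi>_def)

lemma cnj_\<Phi> [simp]: "cnj (\<Phi> \<xi>) = \<Phi> \<xi>"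
  by (simp add: \<Phi>_def)

lemma \<Phi>_support: "\<Phi> \<xi> \<noteq> 0 \<Longrightarrow> \<bar>\<xi>$1\<bar> < 4*pi/3 \<and> \<bar>\<xi>$2\<bar> < 4*pi/3"
  using F_support by (simp add: \<Phi>_def)

text \<open>Every shift that carries one point of the support to another lies in this set, so nine
  terms capture all periodizations.\<close>

definition K :: "(int \<times> int) set" where "K = {-1..1} \<times> {-1..1}"

lemma finite_K [simp]: "finite K" by (simp add: K_def)

lemma uminus_K: "bij_betw uminus K K"
  by (rule bij_betwI[of _ _ _ uminus]) (auto simp: K_def)

lemma support_K:
  assumes "\<bar>\<xi>$1\<bar> < 4*pi/3" "\<bar>\<xi>$2\<bar> < 4*pi/3" "\<Phi> (shift k \<xi>) \<noteq> 0"
  shows "k \<in> K"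
proof -
  have "\<bar>k\<bar> \<le> 1" if "\<bar>t\<bar> < 4*pi/3" "\<bar>t + 2*pi * of_int k\<bar> < 4*pi/3" for t and k :: int
  proof -
    have "\<bar>2*pi*k\<bar> < 2*pi*2"
      using that pi_gt_zero by linarith
    then have "2*pi*\<bar>real_of_int k\<bar> < 2*pi*2"
      by (simp add: abs_mult)
    then have "\<bar>real_of_int k\<bar> < 2" by simp
    then show ?thesis by linarith
  qed
  from this[of "\<xi>$1" "fst k"] this[of "\<xi>$2" "snd k"] show ?thesis
    using \<Phi>_support[OF assms(3)] assms(1,2) by (auto simp: K_def mem_Times_iff abs_le_iff)
qed

lemma sum_squares_\<Phi>:
  assumes "G (\<xi>$1) (\<xi>$2)" "\<bar>\<xi>$1\<bar> < 4*pi/3" "\<bar>\<xi>$2\<bar> < 4*pi/3"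
  shows "(\<Sum>k\<in>K. (\<Phi> (shift k \<xi>))\<^sup>2) = 1"
proof -
  have "(\<Sum>k\<in>K. (F (\<xi>$1 + 2*pi * of_int (fst k)) (\<xi>$2 + 2*pi * of_int (snd k)))\<^sup>2) = 1"
    unfolding K_def using sum_squares[OF assms] by (simp add: sum.cartesian_product' split_beta)
  then have "complex_of_real (\<Sum>k\<in>K. (F (\<xi>$1 + 2*pi * of_int (fst k)) (\<xi>$2 + 2*pi * of_int (snd k)))\<^sup>2) = 1"
    by simp
  then show ?thesis by (simp add: \<Phi>_def)
qed

text \<open>Cross-multiplied form of periodicity of f / \<Phi>: it is linear in \<open>f\<close>,
  passes to limits almost everywhere, and mentions no choice of the periodic factor.\<close>

definition S :: "L2 set" where
  "S = {f. \<forall>k. AE \<xi> in lborel. rep_L2 f \<xi> * \<Phi> (shift k \<xi>) = rep_L2 f (shift k \<xi>) * \<Phi> \<xi>}"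

lemma subspace_S: "L2.subspace S"
proof (rule L2.subspaceI)
  show "0 \<in> S"
    using rep_L2_0 AE_shifts[OF rep_L2_0] by (auto simp: S_def elim!: AE_mp)
next
  fix f g assume fg: "f \<in> S" "g \<in> S"
  show "f + g \<in> S"
    unfolding S_def
  proof (intro CollectI allI)
    fix k
    have "AE \<xi> in lborel. rep_L2 f \<xi> * \<Phi> (shift k \<xi>) = rep_L2 f (shift k \<xi>) * \<Phi> \<xi>"
      "AE \<xi> in lborel. rep_L2 g \<xi> * \<Phi> (shift k \<xi>) = rep_L2 g (shift k \<xi>) * \<Phi> \<xi>"
      using fg by (auto simp: S_def)
    then show "AE \<xi> in lborel. rep_L2 (f + g) \<xi> * \<Phi> (shift k \<xi>) = rep_L2 (f + g) (shift k \<xi>) * \<Phi> \<xi>"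
      using rep_L2_add[of f g] AE_shifts[OF rep_L2_add[of f g]]
      by eventually_elim (simp add: distrib_right)
  qed
next
  fix c f assume f: "f \<in> S"
  show "c *\<^sub>C f \<in> S"
    unfolding S_def
  proof (intro CollectI allI)
    fix k
    have "AE \<xi> in lborel. rep_L2 f \<xi> * \<Phi> (shift k \<xi>) = rep_L2 f (shift k \<xi>) * \<Phi> \<xi>"
      using f by (auto simp: S_def)
    then show "AE \<xi> in lborel. rep_L2 (c *\<^sub>C f) \<xi> * \<Phi> (shift k \<xi>) = rep_L2 (c *\<^sub>C f) (shift k \<xi>) * \<Phi> \<xi>"
      using rep_L2_scaleC[of c f] AE_shifts[OF rep_L2_scaleC[of c f]]
      by eventually_elim simp
  qed
qed

lemma closed_S: "closed S"
  unfolding closed_sequential_limits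
proof (intro allI impI, elim conjE)
  fix X l assume X: "\<forall>n. X n \<in> S" "X \<longlonglongrightarrow> l"
  obtain r where lim: "AE \<xi> in lborel. (\<lambda>n. rep_L2 (X (r n)) \<xi>) \<longlonglongrightarrow> rep_L2 l \<xi>"
    using L2_AE_subseq[OF X(2)] .
  show "l \<in> S"
    unfolding S_def
  proof (intro CollectI allI)
    fix k
    have "AE \<xi> in lborel. \<forall>n. rep_L2 (X (r n)) \<xi> * \<Phi> (shift k \<xi>) = rep_L2 (X (r n)) (shift k \<xi>) * \<Phi> \<xi>"
      unfolding AE_all_countable using X(1) by (auto simp: S_def)
    then show "AE \<xi> in lborel. rep_L2 l \<xi> * \<Phi> (shift k \<xi>) = rep_L2 l (shift k \<xi>) * \<Phi> \<xi>"
      using lim AE_shifts[OF lim]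
    proof eventually_elim
      case (elim \<xi>)
      have "(\<lambda>n. rep_L2 (X (r n)) \<xi> * \<Phi> (shift k \<xi>)) \<longlonglongrightarrow> rep_L2 l \<xi> * \<Phi> (shift k \<xi>)"
        by (intro tendsto_intros elim(2))
      moreover have "(\<lambda>n. rep_L2 (X (r n)) (shift k \<xi>) * \<Phi> \<xi>) \<longlonglongrightarrow> rep_L2 l (shift k \<xi>) * \<Phi> \<xi>"
        by (intro tendsto_intros elim(3)[rule_format])
      ultimately show ?case
        unfolding elim(1)[rule_format] by (rule LIMSEQ_unique)
    qed
  qed
qed

text \<open>The factor \<open>m\<close> is a pointwise choice; integrals below are formed with
  representatives of elements of \<open>S\<close>, and \<open>m\<close> enters only through
  pointwise identities.\<close>

lemma S_factor:
  assumes "f \<in> S"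
  obtains m :: "real \<Rightarrow> real \<Rightarrow> complex" where "periodic2 m" "AE \<xi> in lborel. rep_L2 f \<xi> = m (\<xi>$1) (\<xi>$2) * \<Phi> \<xi>"
proof
  let ?N = "\<lambda>x y. rep_L2 f (vector [x, y])"
  let ?D = "\<lambda>x y. complex_of_real (F x y)"
  let ?m = "periodic_quotient ?N ?D"
  show "periodic2 ?m"
    unfolding periodic2_def using periodic_quotient_periodic[of ?N ?D] by blast
  have "AE \<xi> in lborel. \<forall>k. rep_L2 f \<xi> * \<Phi> (shift k \<xi>) = rep_L2 f (shift k \<xi>) * \<Phi> \<xi>"
    unfolding AE_all_countable using assms by (auto simp: S_def)
  then show "AE \<xi> in lborel. rep_L2 f \<xi> = ?m (\<xi>$1) (\<xi>$2) * \<Phi> \<xi>"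
    using AE_G
  proof eventually_elim
    case (elim \<xi>)
    have v: "vector [\<xi>$1, \<xi>$2] = \<xi>" by (simp add: vec2_eq_iff)
    have "?m (\<xi>$1) (\<xi>$2) * ?D (\<xi>$1) (\<xi>$2) = ?N (\<xi>$1) (\<xi>$2)"
    proof (rule periodic_quotient_mult)
      show "\<exists>(m::int) (n::int). complex_of_real (F (\<xi>$1 + 2*pi*m) (\<xi>$2 + 2*pi*n)) \<noteq> 0"
        using nonzero_shift[OF elim(2)] by simp
      fix m n :: int
      have "shift (m, n) \<xi> = vector [\<xi>$1 + 2*pi*m, \<xi>$2 + 2*pi*n]"
        by (simp add: vec2_eq_iff)
      then show "?N (\<xi>$1) (\<xi>$2) * ?D (\<xi>$1 + 2*pi*m) (\<xi>$2 + 2*pi*n) = ?N (\<xi>$1 + 2*pi*m) (\<xi>$2 + 2*pi*n) * ?D (\<xi>$1) (\<xi>$2)"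
        using elim(1)[rule_format, of "(m, n)"] unfolding v by (simp add: \<Phi>_def)
    qed
    then show ?case unfolding v by (simp add: \<Phi>_def)
  qed
qed

lemma S_I:
  assumes "periodic2 m" and m: "AE \<xi> in lborel. rep_L2 f \<xi> = m (\<xi>$1) (\<xi>$2) * \<Phi> \<xi>"
  shows "f \<in> S"
  unfolding S_def
proof (intro CollectI allI)
  fix k
  show "AE \<xi> in lborel. rep_L2 f \<xi> * \<Phi> (shift k \<xi>) = rep_L2 f (shift k \<xi>) * \<Phi> \<xi>"
    using m AE_shifts[OF m]
  proof eventually_elim
    case (elim \<xi>)
    then show ?case
      using periodic2_shift[OF assms(1), of k \<xi>] by simp
  qed
qed

lemma square_integrable_\<Phi>: "square_integrable \<Phi>"
proof -
  \<comment> \<open>The wave of frequency zero, a multiple of the indicator of a cell containing the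
    support, since 4 pi / 3 < 2 pi.\<close>
  have "square_integrable (\<lambda>\<xi>. indicator (cell (4*pi)) \<xi> *\<^sub>R (of_real (1 / (4*pi)) * wave ((2 * pi / (4*pi)) *\<^sub>R lattice_vec 0) \<xi>))"
    by (rule square_integrable_cell_wave) simp
  then have "square_integrable (\<lambda>\<xi>. of_real (4*pi) * (indicator (cell (4*pi)) \<xi> *\<^sub>R (of_real (1 / (4*pi)) * wave ((2 * pi / (4*pi)) *\<^sub>R lattice_vec 0) \<xi>)))"
    by (rule square_integrable_scale)
  moreover have "lattice_vec 0 = 0" by (simp add: vec2_eq_iff)
  ultimately have "square_integrable (\<lambda>\<xi>. indicator (cell (4*pi)) \<xi> *\<^sub>R (1::complex))"
    by simp
  then have "square_integrable (\<lambda>\<xi>. \<Phi> \<xi> * (indicator (cell (4*pi)) \<xi> *\<^sub>R (1::complex)))"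
    by (rule square_integrable_bounded_mult[OF _ _ cmod_\<Phi>]) measurable
  moreover have "\<Phi> \<xi> * (indicator (cell (4*pi)) \<xi> *\<^sub>R (1::complex)) = \<Phi> \<xi>" for \<xi>
    using \<Phi>_support[of \<xi>] by (cases "\<Phi> \<xi> = 0") (auto simp: cell_def indicator_def abs_less_iff)
  ultimately show ?thesis by simp
qed

text \<open>The Fourier transforms of the integer translates of the scaling function: translations
  become modulations, and 2 pi undoes the normalisation of \<Phi>.\<close>

definition basis :: "int \<times> int \<Rightarrow> L2" where
  "basis k = modulate (- lattice_vec k) (abs_L2 (\<lambda>\<xi>. \<Phi> \<xi> / (2*pi)))"

lemma rep_basis: "AE \<xi> in lborel. rep_L2 (basis k) \<xi> = wave (- lattice_vec k) \<xi> / (2*pi) * \<Phi> \<xi>"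
proof -
  have "square_integrable (\<lambda>\<xi>. \<Phi> \<xi> / (2*pi))"
    using square_integrable_scale[OF square_integrable_\<Phi>, of "1 / (2*pi)"] by simp
  then have "AE \<xi> in lborel. rep_L2 (abs_L2 (\<lambda>\<xi>. \<Phi> \<xi> / (2*pi))) \<xi> = \<Phi> \<xi> / (2*pi)"
    by (rule rep_L2_abs_L2)
  then show ?thesis
    using rep_modulate[of "- lattice_vec k" "abs_L2 (\<lambda>\<xi>. \<Phi> \<xi> / (2*pi))"]
    unfolding basis_def[symmetric] by eventually_elim simp
qed

lemma wave_lattice_shift: "wave (lattice_vec k) (shift l \<xi>) = wave (lattice_vec k) \<xi>"
  using wave_periodic[OF two_pi_pos, of k \<xi> l] by (simp add: shift_eq)

lemma tiles_K:
  assumes "\<bar>\<xi>$1\<bar> < 4*pi/3" "\<bar>\<xi>$2\<bar> < 4*pi/3"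
  shows "\<exists>k\<in>K. \<xi> - (2*pi) *\<^sub>R lattice_vec k \<in> cell (2*pi)"
proof -
  define k where "k = (\<lfloor>\<xi>$1 / (2*pi) + 1/2\<rfloor>, \<lfloor>\<xi>$2 / (2*pi) + 1/2\<rfloor>)"
  have "\<xi> + (2*pi) *\<^sub>R lattice_vec (- k) \<in> cell (2*pi)"
    unfolding cell_unique[OF two_pi_pos] by (simp add: k_def)
  moreover have "\<xi> + (2*pi) *\<^sub>R lattice_vec (- k) = \<xi> - (2*pi) *\<^sub>R lattice_vec k"
    by (simp add: vec2_eq_iff)
  moreover have "k \<in> K"
  proof -
    have "-(2*pi) \<le> \<xi>$1" "\<xi>$1 < 2*pi" "-(2*pi) \<le> \<xi>$2" "\<xi>$2 < 2*pi"
      using assms pi_gt_zero by linarith+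
    then show ?thesis
      using cell_index_bounds[of "2*pi" "\<xi>$1"] cell_index_bounds[of "2*pi" "\<xi>$2"] by (simp add: k_def K_def)
  qed
  ultimately show ?thesis by metis
qed

lemma cell_bounds: "\<xi> \<in> cell (2*pi) \<Longrightarrow> \<bar>\<xi>$1\<bar> < 4*pi/3 \<and> \<bar>\<xi>$2\<bar> < 4*pi/3"
  using pi_gt_zero by (auto simp: cell_def abs_less_iff)

text \<open>Folds an integral over the plane into the period cell; the support of \<Phi> leaves only
  the shifts in \<open>K\<close>.\<close>

lemma integral_profile:
  fixes H :: "real^2 \<Rightarrow> complex"
  assumes H: "integrable lborel H" "\<And>\<xi>. \<Phi> \<xi> = 0 \<Longrightarrow> H \<xi> = 0"
  shows "integrable lborel (\<lambda>\<xi>. indicator (cell (2*pi)) \<xi> *\<^sub>R (\<Sum>k\<in>K. H (shift k \<xi>)))"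
    and "(LINT \<xi>|lborel. H \<xi>) = (LINT \<xi>|lborel. indicator (cell (2*pi)) \<xi> *\<^sub>R (\<Sum>k\<in>K. H (shift k \<xi>)))"
  unfolding shift_eq
  by (rule integral_tiling[OF two_pi_pos H(1) finite_K]; use \<Phi>_support H(2) tiles_K in blast)+

text \<open>Folding gathers the squares of \<Phi> into a factor 1 and leaves exponentials on the
  period cell, whose area is 4 pi^2.\<close>

lemma basis_orthonormal: "cinner (basis k) (basis l) = (if k = l then 1 else 0)"
proof -
  let ?H = "\<lambda>\<xi>. wave (lattice_vec (l - k)) \<xi> / (4*pi\<^sup>2) * (\<Phi> \<xi>)\<^sup>2"
  have d: "lattice_vec (l - k) = lattice_vec l - lattice_vec k" for l k
    by (simp add: vec2_eq_iff)
  have int\<Phi>: "integrable lborel (\<lambda>\<xi>. (\<Phi> \<xi>)\<^sup>2)"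
    using square_integrable_mult[OF square_integrable_\<Phi> square_integrable_\<Phi>] by (simp add: power2_eq_square)
  have "cinner (basis k) (basis l) = (LINT \<xi>|lborel. ?H \<xi>)"
    unfolding cinner_rep
  proof (rule integral_cong_AE)
    show "AE \<xi> in lborel. rep_L2 (basis k) \<xi> * cnj (rep_L2 (basis l) \<xi>) = ?H \<xi>"
      using rep_basis[of k] rep_basis[of l]
      by eventually_elim (simp add: d wave_diff_left wave_minus power2_eq_square)
  qed (auto intro!: borel_measurable_times measurable_compose[OF measurable_rep_L2 measurable_cnj])
  also have "\<dots> = (LINT \<xi>|lborel. indicator (cell (2*pi)) \<xi> *\<^sub>R (\<Sum>j\<in>K. ?H (shift j \<xi>)))"
  proof (rule integral_profile(2))
    have "integrable lborel (\<lambda>\<xi>. 1 / (4*pi\<^sup>2) * (wave (lattice_vec (l - k)) \<xi> * (\<Phi> \<xi>)\<^sup>2))"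
      by (intro integrable_mult_right integrable_wave_mult' int\<Phi>)
    then show "integrable lborel ?H" by (simp add: mult_ac)
  qed simp
  also have "\<dots> = (LINT \<xi>|lborel. indicator (cell (2*pi)) \<xi> *\<^sub>R wave (lattice_vec (l - k)) \<xi> / (4*pi\<^sup>2))"
  proof (rule integral_cong_AE)
    show "AE \<xi> in lborel. indicator (cell (2*pi)) \<xi> *\<^sub>R (\<Sum>j\<in>K. ?H (shift j \<xi>))
        = indicator (cell (2*pi)) \<xi> *\<^sub>R wave (lattice_vec (l - k)) \<xi> / (4*pi\<^sup>2)"
      using AE_G
    proof eventually_elim
      case (elim \<xi>)
      show ?case
      proof (cases "\<xi> \<in> cell (2*pi)")
        case True
        have "(\<Sum>j\<in>K. ?H (shift j \<xi>)) = wave (lattice_vec (l - k)) \<xi> / (4*pi\<^sup>2) * (\<Sum>j\<in>K. (\<Phi> (shift j \<xi>))\<^sup>2)"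
          by (simp only: wave_lattice_shift sum_distrib_left)
        also have "(\<Sum>j\<in>K. (\<Phi> (shift j \<xi>))\<^sup>2) = 1"
          using cell_bounds[OF True] elim by (intro sum_squares_\<Phi>) auto
        finally show ?thesis using True by simp
      qed simp
    qed
  qed measurable
  also have "\<dots> = (LINT \<xi>|lborel. indicator (cell (2*pi)) \<xi> *\<^sub>R wave (lattice_vec (l - k)) \<xi>) / (4*pi\<^sup>2)"
    by (rule integral_divide_zero)
  also have "\<dots> = (if k = l then 1 else 0)"
  proof (cases "k = l")
    case True
    have z: "lattice_vec 0 = 0" by (simp add: vec2_eq_iff)
    have "(LINT \<xi>|lborel. indicator (cell (2*pi)) \<xi> *\<^sub>R (1::complex)) = of_real ((2*pi)\<^sup>2)"
      by (simp add: emeasure_cell measure_def scaleR_conv_of_real)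
    then show ?thesis using True z by (simp add: power_mult_distrib)
  next
    case False
    then show ?thesis using integral_wave_cell[OF two_pi_pos, of "l - k"] by simp
  qed
  finally show ?thesis .
qed

text \<open>For f = m \<Phi> the inner products with the basis are, up to a constant, the Fourier
  coefficients of \<open>m\<close> on the period cell; if all vanish then so does
  \<open>m\<close>.\<close>

lemma closure_span_basis: "closure (L2.span (range basis)) = S"
proof (rule closed_span_eqI[OF subspace_S closed_S])
  show "basis k \<in> S" for k
  proof (rule S_I)
    show "AE \<xi> in lborel. rep_L2 (basis k) \<xi> = (\<lambda>x y. wave (- lattice_vec k) (vector [x, y]) / (2*pi)) (\<xi>$1) (\<xi>$2) * \<Phi> \<xi>"
      using rep_basis[of k]
    proof eventually_elim
      case (elim \<xi>)
      have "vector [\<xi>$1, \<xi>$2] = \<xi>" by (simp add: vec2_eq_iff)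
      with elim show ?case by simp
    qed
    have v: "vector [x + 2*pi * of_int m, y + 2*pi * of_int n] = shift (m, n) (vector [x, y])" for x y m n
      by (simp add: vec2_eq_iff)
    show "periodic2 (\<lambda>x y. wave (- lattice_vec k) (vector [x, y]) / (2*pi))"
      unfolding periodic2_def v wave_minus wave_lattice_shift by simp
  qed
  fix f assume f: "f \<in> S" "\<And>k. cinner f (basis k) = 0"
  obtain m where m: "periodic2 m" "AE \<xi> in lborel. rep_L2 f \<xi> = m (\<xi>$1) (\<xi>$2) * \<Phi> \<xi>"
    using S_factor[OF f(1)] .
  define H where "H \<xi> = rep_L2 f \<xi> * \<Phi> \<xi>" for \<xi>
  have intH: "integrable lborel H"
    unfolding H_def using square_integrable_mult[OF square_integrable_rep_L2[of f] square_integrable_\<Phi>] by simp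
  have H0: "\<Phi> \<xi> = 0 \<Longrightarrow> H \<xi> = 0" for \<xi> by (simp add: H_def)
  \<comment> \<open>The periodization of f \<Phi> = m \<Phi>^2, which equals \<open>m\<close> almost
    everywhere on the cell, but is integrable by construction.\<close>
  define p where "p \<xi> = indicator (cell (2*pi)) \<xi> *\<^sub>R (\<Sum>k\<in>K. H (shift k \<xi>))" for \<xi>
  have "AE \<xi> in lborel. p \<xi> = 0"
  proof (rule fourier_coeffs_unique[OF two_pi_pos])
    show "integrable lborel p" unfolding p_def by (rule integral_profile(1)[OF intH H0])
    show "p \<xi> = 0" if "\<xi> \<notin> cell (2*pi)" for \<xi> using that by (simp add: p_def)
    fix k
    have "0 = cinner f (basis k)" using f(2) by simp
    also have "\<dots> = (LINT \<xi>|lborel. 1 / (2*pi) * (H \<xi> * wave (lattice_vec k) \<xi>))"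
      unfolding cinner_rep
    proof (rule integral_cong_AE)
      show "AE \<xi> in lborel. rep_L2 f \<xi> * cnj (rep_L2 (basis k) \<xi>) = 1 / (2*pi) * (H \<xi> * wave (lattice_vec k) \<xi>)"
        using rep_basis[of k] by eventually_elim (simp add: H_def wave_minus)
      show "(\<lambda>\<xi>. 1 / (2*pi) * (H \<xi> * wave (lattice_vec k) \<xi>)) \<in> borel_measurable lborel"
        unfolding H_def by measurable
    qed (auto intro!: borel_measurable_times measurable_compose[OF measurable_rep_L2 measurable_cnj])
    also have "\<dots> = 1 / (2*pi) * (LINT \<xi>|lborel. H \<xi> * wave (lattice_vec k) \<xi>)"
      by (rule integral_mult_right_zero)
    also have "(LINT \<xi>|lborel. H \<xi> * wave (lattice_vec k) \<xi>) = (LINT \<xi>|lborel. p \<xi> * wave (lattice_vec k) \<xi>)"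
    proof -
      have "(LINT \<xi>|lborel. H \<xi> * wave (lattice_vec k) \<xi>) =
          (LINT \<xi>|lborel. indicator (cell (2*pi)) \<xi> *\<^sub>R (\<Sum>l\<in>K. H (shift l \<xi>) * wave (lattice_vec k) (shift l \<xi>)))"
        by (rule integral_profile(2)[OF integrable_wave_mult[OF intH]]) (simp add: H0)
      then show ?thesis
        by (simp add: wave_lattice_shift p_def sum_distrib_right[symmetric])
    qed
    finally show "(LINT \<xi>|lborel. p \<xi> * wave ((2 * pi / (2 * pi)) *\<^sub>R lattice_vec k) \<xi>) = 0"
      by simp
  qed
  then have "AE \<xi> in lborel. \<xi> \<in> cell (2*pi) \<longrightarrow> m (\<xi>$1) (\<xi>$2) = 0"
    using AE_G AE_shifts[OF m(2)]
  proof eventually_elim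
    case (elim \<xi>)
    show ?case
    proof
      assume c: "\<xi> \<in> cell (2*pi)"
      have "(\<Sum>k\<in>K. H (shift k \<xi>)) = (\<Sum>k\<in>K. m (\<xi>$1) (\<xi>$2) * (\<Phi> (shift k \<xi>))\<^sup>2)"
      proof (rule sum.cong[OF refl])
        fix k
        have "H (shift k \<xi>) = m (shift k \<xi> $ 1) (shift k \<xi> $ 2) * \<Phi> (shift k \<xi>) * \<Phi> (shift k \<xi>)"
          unfolding H_def elim(3)[rule_format] ..
        then show "H (shift k \<xi>) = m (\<xi>$1) (\<xi>$2) * (\<Phi> (shift k \<xi>))\<^sup>2"
          unfolding periodic2_shift[OF m(1)] by (simp only: power2_eq_square mult.assoc)
      qed
      also have "\<dots> = m (\<xi>$1) (\<xi>$2)"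
        using sum_squares_\<Phi>[OF elim(2)] cell_bounds[OF c] by (simp flip: sum_distrib_left)
      finally show "m (\<xi>$1) (\<xi>$2) = 0" using elim(1) c by (simp add: p_def)
    qed
  qed
  \<comment> \<open>Periodicity spreads the vanishing of \<open>m\<close> from the cell to the
    plane.\<close>
  from AE_shifts[OF this] m(2) have "AE \<xi> in lborel. rep_L2 f \<xi> = 0"
  proof eventually_elim
    case (elim \<xi>)
    define k where "k = (- \<lfloor>\<xi>$1 / (2*pi) + 1/2\<rfloor>, - \<lfloor>\<xi>$2 / (2*pi) + 1/2\<rfloor>)"
    have "shift k \<xi> \<in> cell (2*pi)"
      unfolding shift_eq cell_unique[OF two_pi_pos] k_def ..
    then have "m (\<xi>$1) (\<xi>$2) = 0"
      using elim(1)[rule_format, of k] unfolding periodic2_shift[OF m(1)] by blast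
    then show ?case using elim(2) by simp
  qed
  then show "f = 0" by (simp add: L2_eq_0_iff)
qed

end

section \<open>The projections commute\<close>

context frequency_profile
begin

text \<open>The set \<open>K\<close> is not invariant under shifts; indexing by the nonvanishing
  translates makes the sum periodic at every point.\<close>

definition shift_sum :: "(real^2 \<Rightarrow> complex) \<Rightarrow> real^2 \<Rightarrow> complex" where
  "shift_sum h \<xi> = (\<Sum>k | \<Phi> (shift k \<xi>) \<noteq> 0. h (shift k \<xi>))"

lemma shift_sum_shift: "shift_sum h (shift l \<xi>) = shift_sum h \<xi>"
  unfolding shift_sum_def
  by (rule sum.reindex_bij_witness[of _ "\<lambda>k. k - l" "\<lambda>k. k + l"]) (auto simp: shift_shift)

lemma shift_sum_K:
  assumes "\<Phi> \<xi> \<noteq> 0" "\<And>\<eta>. \<Phi> \<eta> = 0 \<Longrightarrow> h \<eta> = 0"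
  shows "(\<Sum>k\<in>K. h (shift k \<xi>)) = shift_sum h \<xi>"
  unfolding shift_sum_def
proof (rule sum.mono_neutral_right)
  show "{k. \<Phi> (shift k \<xi>) \<noteq> 0} \<subseteq> K"
    using support_K \<Phi>_support[OF assms(1)] by blast
qed (use assms(2) in auto)

definition proj_term :: "int \<times> int \<Rightarrow> L2 \<Rightarrow> L2" where
  "proj_term k = wcomp (\<lambda>\<xi>. \<Phi> \<xi> * \<Phi> (shift k \<xi>)) 1 1 (2*pi * of_int (fst k)) (2*pi * of_int (snd k))"

definition proj :: "L2 \<Rightarrow> L2" where
  "proj f = (\<Sum>k\<in>K. proj_term k f)"

lemma rep_proj_term: "AE \<xi> in lborel. rep_L2 (proj_term k f) \<xi> = \<Phi> \<xi> * \<Phi> (shift k \<xi>) * rep_L2 f (shift k \<xi>)"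
proof -
  interpret weighted_composition "\<lambda>\<xi>. \<Phi> \<xi> * \<Phi> (shift k \<xi>)" 1 1 "1 * 1"
  proof
    show "cmod (\<Phi> \<xi> * \<Phi> (shift k \<xi>)) \<le> 1 * 1" for \<xi>
      unfolding norm_mult by (rule mult_mono) (auto simp: cmod_\<Phi>)
  qed auto
  show ?thesis unfolding proj_term_def by (rule rep_wcomp)
qed

lemma rep_proj: "AE \<xi> in lborel. rep_L2 (proj f) \<xi> = \<Phi> \<xi> * shift_sum (\<lambda>\<eta>. \<Phi> \<eta> * rep_L2 f \<eta>) \<xi>"
proof -
  have "AE \<xi> in lborel. \<forall>k. rep_L2 (proj_term k f) \<xi> = \<Phi> \<xi> * \<Phi> (shift k \<xi>) * rep_L2 f (shift k \<xi>)"
    unfolding AE_all_countable using rep_proj_term by blast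
  then show ?thesis
    using rep_L2_sum[of "\<lambda>k. proj_term k f" K] unfolding proj_def[symmetric]
  proof eventually_elim
    case (elim \<xi>)
    have "rep_L2 (proj f) \<xi> = \<Phi> \<xi> * (\<Sum>k\<in>K. \<Phi> (shift k \<xi>) * rep_L2 f (shift k \<xi>))"
      unfolding elim(2) elim(1)[rule_format] sum_distrib_left mult.assoc ..
    then show ?case
      using shift_sum_K[of \<xi> "\<lambda>\<eta>. \<Phi> \<eta> * rep_L2 f \<eta>"] by (cases "\<Phi> \<xi> = 0") auto
  qed
qed

lemma proj_in_S: "proj f \<in> S"
proof (rule S_I)
  let ?m = "\<lambda>x y. shift_sum (\<lambda>\<eta>. \<Phi> \<eta> * rep_L2 f \<eta>) (vector [x, y])"
  have v: "vector [x + 2*pi * of_int k, y + 2*pi * of_int l] = shift (k, l) (vector [x, y])" for x y k l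
    by (simp add: vec2_eq_iff)
  show "periodic2 ?m"
    unfolding periodic2_def v shift_sum_shift by simp
  show "AE \<xi> in lborel. rep_L2 (proj f) \<xi> = ?m (\<xi>$1) (\<xi>$2) * \<Phi> \<xi>"
    using rep_proj[of f]
  proof eventually_elim
    case (elim \<xi>)
    have "vector [\<xi>$1, \<xi>$2] = \<xi>" by (simp add: vec2_eq_iff)
    with elim show ?case by simp
  qed
qed

lemma proj_fixes_S:
  assumes "f \<in> S"
  shows "proj f = f"
proof -
  obtain m where m: "periodic2 m" "AE \<xi> in lborel. rep_L2 f \<xi> = m (\<xi>$1) (\<xi>$2) * \<Phi> \<xi>"
    using S_factor[OF assms] .
  show ?thesis
    unfolding L2_eq_iff using rep_proj[of f] AE_shifts[OF m(2)] m(2) AE_G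
  proof eventually_elim
    case (elim \<xi>)
    show ?case
    proof (cases "\<Phi> \<xi> = 0")
      case False
      have "shift_sum (\<lambda>\<eta>. \<Phi> \<eta> * rep_L2 f \<eta>) \<xi> = (\<Sum>k\<in>K. \<Phi> (shift k \<xi>) * rep_L2 f (shift k \<xi>))"
        by (rule shift_sum_K[OF False, symmetric]) simp
      also have "\<dots> = (\<Sum>k\<in>K. m (\<xi>$1) (\<xi>$2) * (\<Phi> (shift k \<xi>))\<^sup>2)"
        unfolding elim(2)[rule_format] periodic2_shift[OF m(1)]
        by (simp only: power2_eq_square mult_ac)
      also have "\<dots> = m (\<xi>$1) (\<xi>$2)"
        using sum_squares_\<Phi>[OF elim(4)] \<Phi>_support[OF False] by (simp flip: sum_distrib_left)
      finally show ?thesis using elim by simp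
    qed (use elim in simp)
  qed
qed

text \<open>Translating by the shift -k moves the shift from \<open>f\<close> to \<open>g\<close>;
  the weight is symmetric in the two points and real.\<close>

lemma proj_term_adjoint: "cinner (proj_term k f) g = cinner f (proj_term (- k) g)"
proof -
  let ?h = "\<lambda>\<xi>. \<Phi> \<xi> * \<Phi> (shift k \<xi>) * rep_L2 f (shift k \<xi>) * cnj (rep_L2 g \<xi>)"
  have [measurable]: "(\<lambda>\<xi>. cnj (rep_L2 h \<xi>)) \<in> borel_measurable borel" for h
    by (rule measurable_compose[OF measurable_rep_L2 measurable_cnj])
  have "cinner (proj_term k f) g = (LINT \<xi>|lborel. ?h \<xi>)"
    unfolding cinner_rep
  proof (rule integral_cong_AE)
    show "AE \<xi> in lborel. rep_L2 (proj_term k f) \<xi> * cnj (rep_L2 g \<xi>) = ?h \<xi>"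
      using rep_proj_term[of k f] by eventually_elim simp
  qed measurable
  also have "\<dots> = (LINT \<xi>|lborel. ?h (shift (- k) \<xi>))"
    using integral_aff[of ?h 1 1 "2*pi * of_int (fst (- k))" "2*pi * of_int (snd (- k))"] by simp
  also have "\<dots> = cinner f (proj_term (- k) g)"
    unfolding cinner_rep
  proof (rule integral_cong_AE)
    have "?h (shift (- k) \<xi>) = \<Phi> (shift (- k) \<xi>) * \<Phi> \<xi> * rep_L2 f \<xi> * cnj (rep_L2 g (shift (- k) \<xi>))" for \<xi>
      by (simp only: shift_shift) simp
    note hk = this
    show "AE \<xi> in lborel. ?h (shift (- k) \<xi>) = rep_L2 f \<xi> * cnj (rep_L2 (proj_term (- k) g) \<xi>)"
      using rep_proj_term[of "- k" g]
    proof eventually_elim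
      case (elim \<xi>)
      have "cnj (rep_L2 (proj_term (- k) g) \<xi>) = \<Phi> \<xi> * \<Phi> (shift (- k) \<xi>) * cnj (rep_L2 g (shift (- k) \<xi>))"
        unfolding elim complex_cnj_mult cnj_\<Phi> ..
      then show ?case unfolding hk by (simp only: mult_ac)
    qed
  qed measurable
  finally show ?thesis .
qed

lemma proj_symmetric: "cinner (proj f) g = cinner f (proj g)"
proof -
  have "cinner (proj f) g = (\<Sum>k\<in>K. cinner f (proj_term (- k) g))"
    by (simp add: proj_def cinner_sum_left proj_term_adjoint)
  also have "\<dots> = (\<Sum>k\<in>K. cinner f (proj_term k g))"
    by (rule sum.reindex_bij_betw[OF uminus_K])
  finally show ?thesis by (simp add: proj_def cinner_sum_right)
qed

text \<open>Against an element of \<open>S\<close>, symmetry moves \<open>proj\<close> onto that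
  element, which it fixes.\<close>

lemma orth_proj_S: "orth_proj S f = proj f"
  by (rule orth_proj_eqI[OF subspace_S proj_in_S])
     (simp add: cinner_diff_left proj_symmetric proj_fixes_S)

lemma filter1_complex: "G x y \<Longrightarrow> complex_of_real (F (2*x) y) = of_real (filter1 x y) * of_real (F x y)"
  using filter1[of x y] by (simp flip: of_real_mult)

lemma filter2_complex: "G x y \<Longrightarrow> complex_of_real (F x (2*y)) = of_real (filter2 x y) * of_real (F x y)"
  using filter2[of x y] by (simp flip: of_real_mult)

text \<open>The refinement equation multiplies the dilated periodic factor by a filter, again
  periodic. This is nestedness on the Fourier side, one step in each direction.\<close>

lemma dil_S:
  assumes f: "f \<in> S"
  shows "dil 2 1 f \<in> S" "dil 1 2 f \<in> S"
proof -
  obtain m where m: "periodic2 m" "AE \<xi> in lborel. rep_L2 f \<xi> = m (\<xi>$1) (\<xi>$2) * \<Phi> \<xi>"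
    using S_factor[OF f] .
  have p: "m (2 * (x + 2*pi * of_int k)) (y + 2*pi * of_int l) = m (2 * x) y"
    "m (x + 2*pi * of_int k) (2 * (y + 2*pi * of_int l)) = m x (2 * y)" for x y and k l :: int
    using m(1)[unfolded periodic2_def, rule_format, of "2 * x" "2 * k" y l]
      m(1)[unfolded periodic2_def, rule_format, of x k "2 * y" "2 * l"]
    by (simp_all add: algebra_simps)
  show "dil 2 1 f \<in> S"
  proof (rule S_I)
    show "periodic2 (\<lambda>x y. sqrt (2 * 1) * m (2 * x) y * filter1 x y)"
      unfolding periodic2_def by (simp only: p filter1_periodic simp_thms)
    have "AE \<xi> in lborel. rep_L2 (dil 2 1 f) \<xi> = of_real (sqrt (2 * 1)) * rep_L2 f (aff 2 1 0 0 \<xi>)"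
      by (rule rep_dil) auto
    moreover have "AE \<xi> in lborel. rep_L2 f (aff 2 1 0 0 \<xi>) = m (2 * \<xi>$1) (\<xi>$2) * \<Phi> (aff 2 1 0 0 \<xi>)"
      using AE_aff[OF m(2), of 2 1 0 0] by simp
    ultimately show "AE \<xi> in lborel. rep_L2 (dil 2 1 f) \<xi> = sqrt (2 * 1) * m (2 * \<xi>$1) (\<xi>$2) * filter1 (\<xi>$1) (\<xi>$2) * \<Phi> \<xi>"
      using AE_G by eventually_elim (simp add: \<Phi>_def filter1_complex)
  qed
  show "dil 1 2 f \<in> S"
  proof (rule S_I)
    show "periodic2 (\<lambda>x y. sqrt (1 * 2) * m x (2 * y) * filter2 x y)"
      unfolding periodic2_def by (simp only: p filter2_periodic simp_thms)
    have "AE \<xi> in lborel. rep_L2 (dil 1 2 f) \<xi> = of_real (sqrt (1 * 2)) * rep_L2 f (aff 1 2 0 0 \<xi>)"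
      by (rule rep_dil) auto
    moreover have "AE \<xi> in lborel. rep_L2 f (aff 1 2 0 0 \<xi>) = m (\<xi>$1) (2 * \<xi>$2) * \<Phi> (aff 1 2 0 0 \<xi>)"
      using AE_aff[OF m(2), of 1 2 0 0] by simp
    ultimately show "AE \<xi> in lborel. rep_L2 (dil 1 2 f) \<xi> = sqrt (1 * 2) * m (\<xi>$1) (2 * \<xi>$2) * filter2 (\<xi>$1) (\<xi>$2) * \<Phi> \<xi>"
      using AE_G by eventually_elim (simp add: \<Phi>_def filter2_complex)
  qed
qed

lemma dil_power_S: "f \<in> S \<Longrightarrow> dil (2 ^ m) (2 ^ n) f \<in> S"
proof -
  have 1: "dil (2 ^ m) 1 f \<in> S" if "f \<in> S" for f
  proof (induction m)
    case (Suc m)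
    have "dil (2 ^ Suc m) 1 f = dil 2 1 (dil (2 ^ m) 1 f)" by (simp add: dil_dil)
    then show ?case using dil_S(1)[OF Suc] by simp
  qed (use that in simp)
  have 2: "dil 1 (2 ^ n) f \<in> S" if "f \<in> S" for f
  proof (induction n)
    case (Suc n)
    have "dil 1 (2 ^ Suc n) f = dil 1 2 (dil 1 (2 ^ n) f)" by (simp add: dil_dil)
    then show ?case using dil_S(2)[OF Suc] by simp
  qed (use that in simp)
  assume "f \<in> S"
  then have "dil (2 ^ m) 1 (dil 1 (2 ^ n) f) \<in> S" by (intro 1 2)
  then show "dil (2 ^ m) (2 ^ n) f \<in> S" by (simp add: dil_dil)
qed

text \<open>Sorting the translates in the second coordinate by the parity of their multiple of \<open>\<pi>\<close>.\<close>

lemma sum_half_shifts: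
  fixes w :: "real \<Rightarrow> complex"
  assumes "G x y" "\<bar>x\<bar> < 4*pi/3" "\<bar>y\<bar> < 2*pi/3" and w: "\<And>t. w (t + 2*pi) = w t"
  shows "(\<Sum>k\<in>K. w (y + pi * of_int (snd k)) *
      (of_real (F (x + 2*pi * of_int (fst k)) (y + pi * of_int (snd k))))\<^sup>2) = w y + w (y + pi)"
proof -
  have I: "{-1..1::int} = {-1, 0, 1}" by auto
  \<comment> \<open>Periodization of the square of \<open>F\<close> in the first coordinate alone;
    its own periodization in the second is 1.\<close>
  define Q where "Q t = (\<Sum>k\<in>{-1..1::int}. (F (x + 2*pi*k) t)\<^sup>2)" for t
  have Q0: "Q t = 0" if "4*pi/3 \<le> \<bar>t\<bar>" for t
    unfolding Q_def using that F_outside by simp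
  have Qsum: "Q t + Q (t - 2*pi) + Q (t + 2*pi) = 1" if "G x t" "\<bar>t\<bar> < 4*pi/3" for t
  proof -
    have "(\<Sum>l\<in>{-1..1::int}. Q (t + 2*pi*l)) = 1"
      unfolding Q_def by (subst sum.swap) (rule sum_squares[OF that(1) assms(2) that(2)])
    then show ?thesis unfolding I by (simp add: add_ac)
  qed
  \<comment> \<open>Since |y| < 2 pi / 3, the points at distance 2 pi from \<open>y\<close> are
    outside the support.\<close>
  have 1: "Q y = 1"
    using Qsum[OF assms(1)] Q0[of "y - 2*pi"] Q0[of "y + 2*pi"] assms(3) pi_gt_zero
    by (simp add: abs_if split: if_splits)
  \<comment> \<open>The two odd shifts differ by one full period and are the only ones of their
    class inside the support; the sign of \<open>y\<close> decides which of them is certain to lie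
    there.\<close>
  have 2: "Q (y + pi) + Q (y - pi) = 1"
  proof (cases "y > 0")
    case True
    have "G x (y - pi)" using G_affine[OF assms(1), of 1 1 0 "-1"] by simp
    then have "Q (y - pi) + Q (y - pi - 2*pi) + Q (y - pi + 2*pi) = 1"
      using True assms(3) pi_gt_zero by (intro Qsum) (auto simp: abs_if)
    moreover have "Q (y - pi - 2*pi) = 0"
      using True assms(3) pi_gt_zero by (intro Q0) (auto simp: abs_if)
    moreover have "y - pi + 2*pi = y + pi" by simp
    ultimately show ?thesis by simp
  next
    case False
    have "G x (y + pi)" using G_affine[OF assms(1), of 1 1 0 1] by simp
    then have "Q (y + pi) + Q (y + pi - 2*pi) + Q (y + pi + 2*pi) = 1"
      using False assms(3) pi_gt_zero by (intro Qsum) (auto simp: abs_if split: if_splits)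
    moreover have "Q (y + pi + 2*pi) = 0"
      using False assms(3) pi_gt_zero by (intro Q0) (auto simp: abs_if split: if_splits)
    moreover have "y + pi - 2*pi = y - pi" by simp
    ultimately show ?thesis by simp
  qed
  have w': "w (y - pi) = w (y + pi)" using w[of "y - pi"] by (simp add: algebra_simps)
  have "(\<Sum>k\<in>K. w (y + pi * of_int (snd k)) *
      (of_real (F (x + 2*pi * of_int (fst k)) (y + pi * of_int (snd k))))\<^sup>2) =
    (\<Sum>k\<in>{-1..1}. \<Sum>l\<in>{-1..1}. w (y + pi * of_int l) * (of_real (F (x + 2*pi * of_int k) (y + pi * of_int l)))\<^sup>2)"
    unfolding K_def by (simp add: sum.cartesian_product' split_beta)
  also have "\<dots> = (\<Sum>l\<in>{-1..1}. \<Sum>k\<in>{-1..1}. w (y + pi * of_int l) * (of_real (F (x + 2*pi * of_int k) (y + pi * of_int l)))\<^sup>2)"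
    by (rule sum.swap)
  also have "\<dots> = (\<Sum>l\<in>{-1..1::int}. w (y + pi * of_int l) * of_real (Q (y + pi * of_int l)))"
    by (simp add: Q_def sum_distrib_left)
  also have "\<dots> = w y * of_real (Q y) + w (y + pi) * of_real (Q (y + pi) + Q (y - pi))"
    unfolding I using w' by (simp add: distrib_left)
  finally show ?thesis unfolding 1 2 by simp
qed

text \<open>Rescaled form of the inclusion that yields commutation. By the refinement equations each
  term of the projection contains the square of \<open>F\<close> times both filters; after
  \<open>filters_commute\<close> the factor \<open>filter1 x (2 * y)\<close> is common to all terms,
  and the remaining sum collapses by \<open>sum_half_shifts\<close>.\<close>

lemma proj_dil_S:
  assumes s: "s \<in> S"
  shows "dil (1/2) 1 (proj (dil 2 (1/2) s)) \<in> S"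
proof -
  obtain m where m: "periodic2 m" "AE \<xi> in lborel. rep_L2 s \<xi> = m (\<xi>$1) (\<xi>$2) * \<Phi> \<xi>"
    using S_factor[OF s] .
  define n where "n x y = m x y * of_real (filter2 x y)" for x y
  have n_per: "n (x + 2*pi * of_int k) (y + 2*pi * of_int l) = n x y" for x y k l
    using m(1) unfolding n_def by (simp only: filter2_periodic periodic2_def)
  \<comment> \<open>The sum over the two halves of the second coordinate: adding 2 pi to
    \<open>y\<close> only exchanges the summands, so halving does not destroy periodicity.\<close>
  define \<nu> where "\<nu> x y = n x (y / 2) + n x (y / 2 + pi)" for x y
  have "periodic2 \<nu>"
    unfolding periodic2_def
  proof (intro allI)
    fix x y :: real and k l :: int
    show "\<nu> (x + 2*pi * of_int k) (y + 2*pi * of_int l) = \<nu> x y"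
    proof (cases "even l")
      case True
      then obtain j where "l = 2 * j" by blast
      then have "(y + 2*pi * of_int l) / 2 = y / 2 + 2*pi * of_int j" "(y + 2*pi * of_int l) / 2 + pi = (y / 2 + pi) + 2*pi * of_int j"
        by (simp_all add: field_simps)
      then show ?thesis unfolding \<nu>_def by (simp only: n_per)
    next
      case False
      then obtain j where "l = 2 * j + 1" by (meson oddE)
      then have "(y + 2*pi * of_int l) / 2 = (y / 2 + pi) + 2*pi * of_int j" "(y + 2*pi * of_int l) / 2 + pi = y / 2 + 2*pi * of_int (j + 1)"
        by (simp_all add: field_simps)
      then show ?thesis unfolding \<nu>_def by (simp only: n_per add.commute)
    qed
  qed
  let ?g = "dil 2 (1/2) s"
  have half: "AE \<xi>::real^2 in lborel. G (\<xi>$1) (\<xi>$2 / 2)"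
    using AE_G by eventually_elim (use G_scale[of _ _ 1 "1/2"] in auto)
  have "AE \<xi> in lborel. rep_L2 ?g \<xi> = of_real (sqrt (2 * (1/2))) * rep_L2 s (aff 2 (1/2) 0 0 \<xi>)"
    by (rule rep_dil) auto
  moreover have "AE \<xi> in lborel. rep_L2 s (aff 2 (1/2) 0 0 \<xi>) = m (2 * \<xi>$1) (\<xi>$2 / 2) * \<Phi> (aff 2 (1/2) 0 0 \<xi>)"
    using AE_aff[OF m(2), of 2 "1/2" 0 0] by simp
  ultimately have g: "AE \<xi> in lborel. rep_L2 ?g \<xi> = m (2 * \<xi>$1) (\<xi>$2 / 2) * of_real (F (2 * \<xi>$1) (\<xi>$2 / 2))"
    by eventually_elim (simp add: \<Phi>_def)
  have key: "AE \<xi> in lborel. rep_L2 (proj ?g) \<xi> = of_real (F (2 * \<xi>$1) (\<xi>$2)) * \<nu> (2 * \<xi>$1) (\<xi>$2)"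
    using rep_proj[of ?g] AE_shifts[OF g] AE_G AE_shifts[OF half]
  proof eventually_elim
    case (elim \<xi>)
    define x y where xy: "x = \<xi>$1" "y = \<xi>$2 / 2"
    show ?case
    proof (cases "\<Phi> \<xi> = 0")
      case True
      then have "F (2 * \<xi>$1) (\<xi>$2) = 0"
        using F_zero_imp[OF elim(3)] by (simp add: \<Phi>_def)
      then show ?thesis using True elim(1) by simp
    next
      case False
      have G0: "G x y" using elim(4)[rule_format, of 0] by (simp add: xy)
      have G': "G (x + 2*pi * of_int k) (y + pi * of_int l)" for k l :: int
        using elim(4)[rule_format, of "(k, l)"] by (simp add: xy add_divide_distrib)
      have bounds: "\<bar>x\<bar> < 4*pi/3" "\<bar>y\<bar> < 2*pi/3"
        using \<Phi>_support[OF False] by (auto simp: xy)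
      have summand: "\<Phi> (shift k \<xi>) * rep_L2 ?g (shift k \<xi>) =
          of_real (filter1 x (2 * y)) * (n (2 * x) (y + pi * of_int (snd k)) *
            (of_real (F (x + 2*pi * of_int (fst k)) (y + pi * of_int (snd k))))\<^sup>2)" for k
      proof -
        define x' y' where xy': "x' = x + 2*pi * of_int (fst k)" "y' = y + pi * of_int (snd k)"
        have Gk: "G x' y'" unfolding xy' by (rule G')
        have a: "\<Phi> (shift k \<xi>) = of_real (filter2 x' y') * of_real (F x' y')"
          using filter2_complex[OF Gk] by (simp add: \<Phi>_def xy xy' algebra_simps)
        have "rep_L2 ?g (shift k \<xi>) = m (2 * x') y' * of_real (F (2 * x') y')"
          using elim(2)[rule_format, of k] by (simp add: xy xy' add_divide_distrib)
        also have "m (2 * x') y' = m (2 * x) y'"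
          using m(1)[unfolded periodic2_def, rule_format, of "2 * x" "2 * fst k" y' 0]
          by (simp add: xy' algebra_simps)
        finally have b: "rep_L2 ?g (shift k \<xi>) = m (2 * x) y' * (of_real (filter1 x' y') * of_real (F x' y'))"
          unfolding filter1_complex[OF Gk] .
        \<comment> \<open>The right-hand side is written at the unshifted \<open>x\<close> and
          \<open>2 * y\<close>: doubling turns the shifts by multiples of pi in the second
          coordinate into full periods.\<close>
        have "filter1 x' y' * filter2 x' y' = filter2 (2 * x) y' * filter1 x (2 * y)"
        proof -
          have e: "2 * x' = 2 * x + 2*pi * of_int (2 * fst k)" "2 * y' = 2 * y + 2*pi * of_int (snd k)"
            "y' = y' + 2*pi * of_int 0"
            by (simp_all add: xy' algebra_simps)
          have "filter2 (2 * x') y' = filter2 (2 * x) y'"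
            by (subst e(1), subst e(3), rule filter2_periodic)
          moreover have "filter1 x' (2 * y') = filter1 x (2 * y)"
            unfolding e(2) unfolding xy'(1) by (rule filter1_periodic)
          ultimately show ?thesis using filters_commute[OF Gk] by simp
        qed
        then have c: "complex_of_real (filter1 x' y') * of_real (filter2 x' y') = of_real (filter2 (2 * x) y') * of_real (filter1 x (2 * y))"
          by (metis of_real_mult)
        have "\<Phi> (shift k \<xi>) * rep_L2 ?g (shift k \<xi>) =
            m (2 * x) y' * (complex_of_real (filter1 x' y') * of_real (filter2 x' y')) * (of_real (F x' y'))\<^sup>2"
          unfolding a b by (simp add: power2_eq_square mult_ac)
        then show ?thesis
          unfolding c by (simp add: n_def xy' mult_ac)
      qed
      have "shift_sum (\<lambda>\<eta>. \<Phi> \<eta> * rep_L2 ?g \<eta>) \<xi> = (\<Sum>k\<in>K. \<Phi> (shift k \<xi>) * rep_L2 ?g (shift k \<xi>))"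
        by (rule shift_sum_K[OF False, symmetric]) simp
      also have "\<dots> = of_real (filter1 x (2 * y)) * (\<Sum>k\<in>K. n (2 * x) (y + pi * of_int (snd k)) *
            (of_real (F (x + 2*pi * of_int (fst k)) (y + pi * of_int (snd k))))\<^sup>2)"
        unfolding summand by (simp only: sum_distrib_left)
      also have "\<dots> = of_real (filter1 x (2 * y)) * (n (2 * x) y + n (2 * x) (y + pi))"
        using n_per[of "2 * x" 0 _ 1] by (subst sum_half_shifts[OF G0 bounds]) simp_all
      finally have "rep_L2 (proj ?g) \<xi> = of_real (filter1 (\<xi>$1) (\<xi>$2)) * of_real (F (\<xi>$1) (\<xi>$2)) * \<nu> (2 * \<xi>$1) (\<xi>$2)"
        using elim(1) by (simp add: \<nu>_def xy \<Phi>_def mult_ac)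
      \<comment> \<open>The extracted filter meets the outer factor at (x, 2y) and produces the
        value of \<open>F\<close> at (2x, 2y).\<close>
      then show ?thesis unfolding filter1_complex[OF elim(3)] .
    qed
  qed
  show ?thesis
  proof (rule S_I)
    show "periodic2 (\<lambda>x y. complex_of_real (sqrt (1/2 * 1)) * \<nu> x y)"
      using \<open>periodic2 \<nu>\<close> by (simp add: periodic2_def)
    have "AE \<xi> in lborel. rep_L2 (dil (1/2) 1 (proj ?g)) \<xi> = of_real (sqrt (1/2 * 1)) * rep_L2 (proj ?g) (aff (1/2) 1 0 0 \<xi>)"
      by (rule rep_dil) auto
    moreover have "AE \<xi> in lborel. rep_L2 (proj ?g) (aff (1/2) 1 0 0 \<xi>) = of_real (F (\<xi>$1) (\<xi>$2)) * \<nu> (\<xi>$1) (\<xi>$2)"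
      using AE_aff[OF key, of "1/2" 1 0 0] by simp
    ultimately show "AE \<xi> in lborel. rep_L2 (dil (1/2) 1 (proj ?g)) \<xi> = of_real (sqrt (1/2 * 1)) * \<nu> (\<xi>$1) (\<xi>$2) * \<Phi> \<xi>"
      by eventually_elim (simp add: \<Phi>_def)
  qed
qed

text \<open>The Fourier image of the space with indices i and j; the exponents are negative because
  the Fourier transform inverts dilations.\<close>

definition W :: "int \<Rightarrow> int \<Rightarrow> L2 set" where
  "W i j = dil (2 powi (- i)) (2 powi (- j)) ` S"

lemma powi_pos: "0 < (2::real) powi i"
  by simp

lemma W_mem_iff: "f \<in> W i j \<longleftrightarrow> dil (2 powi i) (2 powi j) f \<in> S"
proof -
  have "dil (2 powi i) (2 powi j) (dil (2 powi (- i)) (2 powi (- j)) g) = g"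
    "dil (2 powi (- i)) (2 powi (- j)) (dil (2 powi i) (2 powi j) g) = g" for g
    by (simp_all add: dil_dil flip: power_int_add)
  then show ?thesis unfolding W_def by (metis image_iff)
qed

lemma subspace_W: "L2.subspace (W i j)"
  unfolding W_def by (intro unitary_image_subspace unitary_dil subspace_S) auto

lemma closed_W: "closed (W i j)"
  unfolding W_def by (intro unitary_image_closed unitary_dil closed_S) auto

lemma W_mono:
  assumes "i \<le> l" "j \<le> m"
  shows "W i j \<subseteq> W l m"
proof
  fix f assume "f \<in> W i j"
  then have "dil (2 powi i) (2 powi j) f \<in> S" by (simp add: W_mem_iff)
  then have "dil (2 ^ nat (l - i)) (2 ^ nat (m - j)) (dil (2 powi i) (2 powi j) f) \<in> S"
    by (rule dil_power_S)
  moreover have "2 ^ nat (l - i) * 2 powi i = (2::real) powi l" "2 ^ nat (m - j) * 2 powi j = (2::real) powi m"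
    using assms by (simp_all flip: power_int_of_nat power_int_add)
  ultimately show "f \<in> W l m" by (simp add: W_mem_iff dil_dil)
qed

lemma W_key:
  assumes "f \<in> W i (j + 1)"
  shows "orth_proj (W (i + 1) j) f \<in> W i j"
proof -
  let ?D = "dil (2 powi (- (i + 1))) (2 powi (- j))"
  let ?s = "dil (2 powi i) (2 powi (j + 1)) f"
  have s: "?s \<in> S" using assms by (simp add: W_mem_iff)
  have e0: "2 powi (l + 1) = (2::real) powi l * 2" for l
    by (simp add: power_int_add_1)
  have e: "2 powi (- (i + 1)) = inverse ((2::real) powi i * 2)" "2 powi (- j) = inverse ((2::real) powi j)"
    "2 powi (j + 1) = (2::real) powi j * 2"
    by (simp_all only: power_int_minus e0)
  \<comment> \<open>Pulling back by the unitary that carries \<open>S\<close> to the space with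
    indices i + 1 and j leaves a dilation by 2 and 1/2, independent of the indices.\<close>
  have f: "f = ?D (dil 2 (1/2) ?s)"
    unfolding e by (simp add: dil_dil)
  have "orth_proj (W (i + 1) j) f = ?D (proj (dil 2 (1/2) ?s))"
    unfolding W_def by (subst f, subst unitary_orth_proj[OF unitary_dil subspace_S closed_S])
      (simp_all only: powi_pos orth_proj_S)
  moreover have "dil (2 powi i) (2 powi j) (?D g) = dil (1/2) 1 g" for g
    unfolding e by (simp add: dil_dil)
  ultimately show ?thesis
    using proj_dil_S[OF s] by (simp add: W_mem_iff)
qed

lemma W_commute: "orth_proj (W i j) \<circ> orth_proj (W l m) = orth_proj (W l m) \<circ> orth_proj (W i j)"
  by (rule orth_proj_commuting[where V = W, OF subspace_W closed_W W_mono W_key])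

text \<open>Membership at index (-n, -n) confines the support to |2^n \<xi>_1| < 4 pi / 3; over all
  n only a null line is left.\<close>

lemma W_Inter: "(\<Inter>i. \<Inter>j. W i j) = {0}"
proof -
  have "0 \<in> W i j" for i j using L2.subspace_0[OF subspace_W] .
  moreover have "f = 0" if f: "\<And>i j. f \<in> W i j" for f
  proof -
    have "AE \<xi> in lborel. 4*pi/3 \<le> \<bar>2 ^ n * \<xi>$1\<bar> \<longrightarrow> rep_L2 f \<xi> = 0" for n
    proof -
      let ?g = "dil (2 powi (- int n)) (2 powi (- int n)) f"
      have "?g \<in> S" using f by (simp add: W_mem_iff)
      then obtain m where "periodic2 m" and m: "AE \<xi> in lborel. rep_L2 ?g \<xi> = m (\<xi>$1) (\<xi>$2) * \<Phi> \<xi>"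
        by (rule S_factor)
      have 1: "AE \<xi> in lborel. rep_L2 ?g (aff (2^n) (2^n) 0 0 \<xi>) = m (2^n * \<xi>$1) (2^n * \<xi>$2) * \<Phi> (aff (2^n) (2^n) 0 0 \<xi>)"
        using AE_aff[OF m, of "2^n" "2^n" 0 0] by simp
      have g: "f = dil (2^n) (2^n) ?g"
        by (simp add: dil_dil power_int_minus)
      have 2: "AE \<xi> in lborel. rep_L2 f \<xi> = of_real (sqrt (2^n * 2^n)) * rep_L2 ?g (aff (2^n) (2^n) 0 0 \<xi>)"
        by (subst (1) g, rule rep_dil) auto
      show ?thesis
        using 1 2
      proof eventually_elim
        case (elim \<xi>)
        then show ?case
          using \<Phi>_support[of "aff (2^n) (2^n) 0 0 \<xi>"] by auto
      qed
    qed
    then have "AE \<xi> in lborel. \<forall>n. 4*pi/3 \<le> \<bar>2 ^ n * \<xi>$1\<bar> \<longrightarrow> rep_L2 f \<xi> = 0"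
      unfolding AE_all_countable by blast
    then have "AE \<xi> in lborel. rep_L2 f \<xi> = 0"
      using AE_G
    proof eventually_elim
      case (elim \<xi>)
      have pos: "\<bar>\<xi>$1\<bar> > 0" using G_bounds(7)[OF elim(2)] by simp
      obtain n where "4*pi/3 / \<bar>\<xi>$1\<bar> < 2^n" using real_arch_pow[of 2 "4*pi/3 / \<bar>\<xi>$1\<bar>"] by auto
      then have "4*pi/3 \<le> \<bar>2 ^ n * \<xi>$1\<bar>" using pos by (simp add: abs_mult field_simps)
      then show ?case using elim(1) by blast
    qed
    then show ?thesis by (simp add: L2_eq_0_iff)
  qed
  ultimately show ?thesis by auto
qed

text \<open>A point of the central square has no other translate in the support of \<Phi>, so for
  every nonzero shift both sides of the defining relation vanish.\<close>

lemma S_center: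
  assumes h: "AE \<xi> in lborel. rep_L2 h \<xi> \<noteq> 0 \<longrightarrow> \<bar>\<xi>$1\<bar> < 2*pi/3 \<and> \<bar>\<xi>$2\<bar> < 2*pi/3"
  shows "h \<in> S"
  unfolding S_def
proof (intro CollectI allI)
  fix k
  have far: "4*pi/3 \<le> \<bar>t + 2*pi * of_int j\<bar>" if "\<bar>t\<bar> < 2*pi/3" "j \<noteq> 0" for t and j :: int
  proof -
    have "1 \<le> \<bar>real_of_int j\<bar>" using that(2) by linarith
    then have "2*pi*1 \<le> 2*pi*\<bar>real_of_int j\<bar>" by (intro mult_left_mono) auto
    also have "\<dots> = \<bar>2*pi * of_int j\<bar>" by (simp add: abs_mult)
    finally show ?thesis using that(1) by linarith
  qed
  have zero: "\<Phi> (shift k \<xi>) = 0" if "\<bar>\<xi>$1\<bar> < 2*pi/3" "\<bar>\<xi>$2\<bar> < 2*pi/3" "k \<noteq> 0" for \<xi> k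
  proof (rule ccontr)
    assume "\<Phi> (shift k \<xi>) \<noteq> 0"
    then have "\<bar>\<xi>$1 + 2*pi * of_int (fst k)\<bar> < 4*pi/3" "\<bar>\<xi>$2 + 2*pi * of_int (snd k)\<bar> < 4*pi/3"
      using \<Phi>_support[of "shift k \<xi>"] by auto
    then have "fst k = 0" "snd k = 0"
      using far[OF that(1), of "fst k"] far[OF that(2), of "snd k"] by linarith+
    then show False using that(3) by (simp add: prod_eq_iff)
  qed
  show "AE \<xi> in lborel. rep_L2 h \<xi> * \<Phi> (shift k \<xi>) = rep_L2 h (shift k \<xi>) * \<Phi> \<xi>"
  proof (cases "k = 0")
    case False
    show ?thesis
      using h AE_shifts[OF h]
    proof eventually_elim
      case (elim \<xi>)
      have 1: "rep_L2 h \<xi> * \<Phi> (shift k \<xi>) = 0"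
        using elim(1) zero[of \<xi> k] False by (cases "rep_L2 h \<xi> = 0") auto
      have "shift (- k) (shift k \<xi>) = \<xi>" by (simp only: shift_shift) simp
      then have 2: "rep_L2 h (shift k \<xi>) * \<Phi> \<xi> = 0"
        using elim(2)[rule_format, of k] zero[of "shift k \<xi>" "- k"] False
        by (cases "rep_L2 h (shift k \<xi>) = 0") (simp_all only: neg_equal_0_iff_equal mult_zero_left mult_zero_right simp_thms)
      show ?case unfolding 1 2 ..
    qed
  qed simp
qed

text \<open>A truncation becomes supported in the central square after enough doublings, so it lies
  in some \<open>W N N\<close>; truncations are dense.\<close>

lemma W_dense: "closure (\<Union>i. \<Union>j. W i j) = UNIV"
proof -
  have "g \<in> closure (\<Union>i. \<Union>j. W i j)" for g
  proof -
    have mem: "abs_L2 (cut n g) \<in> (\<Union>i. \<Union>j. W i j)" for n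
    proof -
      obtain N where N: "real n + 1 < 2^N" using real_arch_pow[of 2 "real n + 1"] by auto
      let ?h = "dil (2^N) (2^N) (abs_L2 (cut n g))"
      have 1: "AE \<xi> in lborel. rep_L2 ?h \<xi> = of_real (sqrt (2^N * 2^N)) * rep_L2 (abs_L2 (cut n g)) (aff (2^N) (2^N) 0 0 \<xi>)"
        by (rule rep_dil) auto
      have 2: "AE \<xi> in lborel. rep_L2 (abs_L2 (cut n g)) (aff (2^N) (2^N) 0 0 \<xi>) = cut n g (aff (2^N) (2^N) 0 0 \<xi>)"
        by (rule AE_aff[OF rep_L2_abs_L2]) auto
      have "?h \<in> S"
      proof (rule S_center)
        show "AE \<xi> in lborel. rep_L2 ?h \<xi> \<noteq> 0 \<longrightarrow> \<bar>\<xi>$1\<bar> < 2*pi/3 \<and> \<bar>\<xi>$2\<bar> < 2*pi/3"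
          using 1 2
        proof eventually_elim
          case (elim \<xi>)
          show ?case
          proof
            assume "rep_L2 ?h \<xi> \<noteq> 0"
            then have "aff (2^N) (2^N) 0 0 \<xi> \<in> cell (real n + 1)"
              using elim by (auto simp: cut_def indicator_def split: if_splits)
            then have b: "\<bar>2^N * \<xi>$1\<bar> \<le> (real n + 1) / 2" "\<bar>2^N * \<xi>$2\<bar> \<le> (real n + 1) / 2"
              by (auto simp: cell_def abs_le_iff)
            have small: "\<bar>t\<bar> < 2*pi/3" if "\<bar>2^N * t\<bar> \<le> (real n + 1) / 2" for t :: real
            proof -
              have "2^N * \<bar>t\<bar> \<le> (real n + 1) / 2" using that by (simp add: abs_mult)
              also have "\<dots> < 2^N * (1/2)" using N by simp
              finally have "\<bar>t\<bar> < 1/2" by simp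
              then show ?thesis using pi_gt3 by linarith
            qed
            show "\<bar>\<xi>$1\<bar> < 2*pi/3 \<and> \<bar>\<xi>$2\<bar> < 2*pi/3" using small b by blast
          qed
        qed
      qed
      then have "abs_L2 (cut n g) \<in> W (int N) (int N)" by (simp add: W_mem_iff)
      then show ?thesis by blast
    qed
    show ?thesis
      unfolding closure_sequential
      by (intro exI[of _ "\<lambda>n. abs_L2 (cut n g)"] conjI allI mem tendsto_cut)
  qed
  then show ?thesis by blast
qed

end

section \<open>Passing to a rationally invariant set of full measure\<close>

lemma AE_not_vertical: "AE \<xi>::real^2 in lborel. \<xi> $ i \<noteq> c"
proof -
  have "negligible {\<xi>::real^2. \<xi> \<bullet> axis i 1 = c}"
    by (rule negligible_standard_hyperplane) (simp add: axis_in_Basis_iff)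
  then have "negligible {\<xi>::real^2. \<xi> $ i = c}"
    by (simp add: inner_axis)
  moreover have "{\<xi>::real^2. \<xi> $ i = c} \<in> sets lborel"
    by measurable
  ultimately have "{\<xi>::real^2. \<xi> $ i = c} \<in> null_sets lborel"
    by (simp add: negligible_iff_null_sets null_sets_completion_iff)
  then show ?thesis by (rule AE_I') auto
qed

text \<open>The rational diagonal affine maps, with translations in rational multiples of pi, are
  countable and closed under composition. Avoiding the preimages of one Borel null set under all of
  them is therefore measurable, of full measure and invariant.\<close>

lemma rational_affine_invariant_AE:
  fixes P :: "real^2 \<Rightarrow> bool"
  assumes "AE \<xi> in lborel. P \<xi>"
  obtains Q where "{\<xi>. Q \<xi>} \<in> sets borel" "AE \<xi> in lborel. Q \<xi>" "\<And>\<xi>. Q \<xi> \<Longrightarrow> P \<xi>"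
    "\<And>\<xi> a b p q. Q \<xi> \<Longrightarrow> a \<in> \<rat> \<Longrightarrow> b \<in> \<rat> \<Longrightarrow> p \<in> \<rat> \<Longrightarrow> q \<in> \<rat> \<Longrightarrow> a \<noteq> 0 \<Longrightarrow> b \<noteq> 0 \<Longrightarrow>
      Q (aff a b (p * pi) (q * pi) \<xi>)"
proof -
  obtain N where N: "N \<in> null_sets lborel" "{\<xi> \<in> space lborel. \<not> P \<xi>} \<subseteq> N"
    using assms by (auto simp: eventually_ae_filter)
  have [measurable]: "N \<in> sets borel" using N(1) by auto
  let ?t = "\<lambda>a b p q. aff (of_rat a) (of_rat b) (of_rat p * pi) (of_rat q * pi)"
  define Q where "Q \<xi> \<longleftrightarrow> (\<forall>a b p q. a \<noteq> 0 \<longrightarrow> b \<noteq> 0 \<longrightarrow> ?t a b p q \<xi> \<notin> N)" for \<xi>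
  show thesis
  proof
    show "{\<xi>. Q \<xi>} \<in> sets borel"
      unfolding Q_def by measurable
    have "AE \<xi> in lborel. a \<noteq> 0 \<longrightarrow> b \<noteq> 0 \<longrightarrow> ?t a b p q \<xi> \<notin> N" for a b p q
      using AE_aff[OF AE_not_in[OF N(1)], of "of_rat a" "of_rat b" "of_rat p * pi" "of_rat q * pi"]
      by (cases "a = 0 \<or> b = 0") auto
    then show "AE \<xi> in lborel. Q \<xi>"
      unfolding Q_def AE_all_countable by blast
    show "P \<xi>" if "Q \<xi>" for \<xi>
    proof -
      have "?t 1 1 0 0 \<xi> \<notin> N" using that unfolding Q_def by (metis zero_neq_one)
      then show ?thesis using N(2) by auto
    qed
    fix \<xi> and a b p q :: real
    assume *: "Q \<xi>" "a \<in> \<rat>" "b \<in> \<rat>" "p \<in> \<rat>" "q \<in> \<rat>" "a \<noteq> 0" "b \<noteq> 0"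
    obtain a' b' p' q' where r: "a = of_rat a'" "b = of_rat b'" "p = of_rat p'" "q = of_rat q'"
      using *(2-5) by (elim Rats_cases) auto
    have ne: "a' \<noteq> 0" "b' \<noteq> 0" using *(6,7) r by auto
    show "Q (aff a b (p * pi) (q * pi) \<xi>)"
      unfolding Q_def
    proof (intro allI impI)
      fix c d u v :: rat assume "c \<noteq> 0" "d \<noteq> 0"
      have "?t c d u v (aff a b (p * pi) (q * pi) \<xi>) = ?t (c * a') (d * b') (c * p' + u) (d * q' + v) \<xi>"
        by (simp add: r vec2_eq_iff of_rat_mult of_rat_add algebra_simps)
      then show "?t c d u v (aff a b (p * pi) (q * pi) \<xi>) \<notin> N"
        using *(1) \<open>c \<noteq> 0\<close> \<open>d \<noteq> 0\<close> ne unfolding Q_def by (metis no_zero_divisors)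
    qed
  qed
qed

text \<open>Clears the fraction and the common factor 2 pi from the edge condition, and passes from
  complex to real values.\<close>

lemma edge_ratio_real:
  fixes a b c :: real and u v w :: complex
  assumes "u = complex_of_real (a / (2*pi))" "v = complex_of_real (b / (2*pi))" "w = complex_of_real (c / (2*pi))"
    and "u\<^sup>2 + v\<^sup>2 \<noteq> 0" "w\<^sup>2 = (1 / (2*pi))\<^sup>2 * (u\<^sup>2 / (u\<^sup>2 + v\<^sup>2))"
  shows "a\<^sup>2 + b\<^sup>2 \<noteq> 0 \<and> c\<^sup>2 * (a\<^sup>2 + b\<^sup>2) = a\<^sup>2"
proof -
  have uv: "u\<^sup>2 + v\<^sup>2 = complex_of_real ((a\<^sup>2 + b\<^sup>2) / (2*pi)\<^sup>2)"
    unfolding assms(1,2) by (simp add: power_divide add_divide_distrib)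
  then have ne: "a\<^sup>2 + b\<^sup>2 \<noteq> 0"
    using assms(4) by auto
  have "w\<^sup>2 * (u\<^sup>2 + v\<^sup>2) = (1 / (2*pi))\<^sup>2 * u\<^sup>2"
    using assms(4,5) by simp
  then have "w\<^sup>2 * complex_of_real ((a\<^sup>2 + b\<^sup>2) / (2*pi)\<^sup>2) = (1 / (2*pi))\<^sup>2 * u\<^sup>2"
    by (simp only: uv)
  then have "complex_of_real ((c / (2*pi))\<^sup>2 * ((a\<^sup>2 + b\<^sup>2) / (2*pi)\<^sup>2)) = complex_of_real ((1 / (2*pi))\<^sup>2 * (a / (2*pi))\<^sup>2)"
    unfolding assms(1,3) by simp
  then have "(c / (2*pi))\<^sup>2 * ((a\<^sup>2 + b\<^sup>2) / (2*pi)\<^sup>2) = (1 / (2*pi))\<^sup>2 * (a / (2*pi))\<^sup>2"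
    unfolding of_real_eq_iff .
  then have "c\<^sup>2 * (a\<^sup>2 + b\<^sup>2) = a\<^sup>2"
    by (simp add: power_divide)
  with ne show ?thesis by blast
qed

lemma unitary_image_closure_span:
  assumes U: "unitary U"
  shows "U ` closure (L2.span A) = closure (L2.span (U ` A))"
proof -
  interpret Vector_Spaces.linear scaleC scaleC U
    using U by (simp add: unitary_def)
  have "U ` closure (L2.span A) = closure (U ` L2.span A)"
  proof
    show "U ` closure (L2.span A) \<subseteq> closure (U ` L2.span A)"
    proof
      fix g assume "g \<in> U ` closure (L2.span A)"
      then obtain l where l: "l \<in> closure (L2.span A)" "g = U l"
        by blast
      from l(1) obtain X where X: "\<And>n. X n \<in> L2.span A" "X \<longlonglongrightarrow> l"
        unfolding closure_sequential by blast
      have "(\<lambda>n. U (X n)) \<longlonglongrightarrow> U l"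
        using X(2) by (simp add: tendsto_iff dist_norm unitary_isometry[OF U])
      then show "g \<in> closure (U ` L2.span A)"
        unfolding closure_sequential l(2) using X(1) by (intro exI[of _ "\<lambda>n. U (X n)"]) auto
    qed
    show "closure (U ` L2.span A) \<subseteq> U ` closure (L2.span A)"
      by (intro closure_minimal image_mono closure_subset unitary_image_closed[OF U] closed_closure)
  qed
  then show ?thesis by (simp only: span_image)
qed

text \<open>The Fourier transform is unitary and carries each \<open>V i j\<close> to
  \<open>W i j\<close>, so every condition is pulled back from the frequency side.\<close>

theorem (in frequency_profile) BMRA_if_profile:
  fixes V :: "int \<Rightarrow> int \<Rightarrow> L2 set"
  assumes hat: "fourier \<phi> = abs_L2 (\<lambda>\<xi>. \<Phi> \<xi> / (2*pi))"
    and V: "\<And>i j. V i j = dil (2 powi i) (2 powi j) ` closure (L2.span (range (int_translate \<phi>)))"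
    and A: "dilation A = dil 2 1" and B: "dilation B = dil 1 2"
  shows "BMRA A B \<phi> V"
proof -
  note Uf = unitary_fourier
  let ?V0 = "closure (L2.span (range (int_translate \<phi>)))"
  have it: "fourier (int_translate \<phi> k) = basis k" for k
  proof -
    have "int_translate \<phi> k = translation (lattice_vec k) \<phi>"
      by (simp add: int_translate_def lattice_vec_def split_beta)
    then show ?thesis
      by (simp add: fourier_translation hat basis_def)
  qed
  have V0: "fourier ` ?V0 = S"
    unfolding unitary_image_closure_span[OF Uf] closure_span_basis[symmetric]
    by (simp add: image_image it)
  have sub0: "L2.subspace ?V0" "closed ?V0"
    by (auto intro: subspace_closure L2.subspace_span)
  have subV: "L2.subspace (V i j)" "closed (V i j)" for i j
    unfolding V by (auto intro!: unitary_image_subspace unitary_image_closed unitary_dil sub0)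
  have VW: "fourier ` V i j = W i j" for i j
  proof -
    have "fourier ` V i j = dil (1 / 2 powi i) (1 / 2 powi j) ` fourier ` ?V0"
      unfolding V image_image by (intro image_cong refl fourier_dil) auto
    then show ?thesis
      unfolding V0 W_def by (simp add: power_int_minus inverse_eq_divide)
  qed
  have mem: "f \<in> V i j \<longleftrightarrow> fourier f \<in> W i j" for f i j
    unfolding VW[symmetric] using unitary_inj[OF Uf] by (auto dest: injD)
  have op: "(op_power_int (dilation A) i \<circ> op_power_int (dilation B) j) f = dil (2 powi i) (2 powi j) f" for i j f
    by (simp add: A B op_power_int_dil dil_dil)
  have V00: "V 0 0 = ?V0" by (simp add: V)
  have Inter: "(\<Inter>i. \<Inter>j. V i j) = {0}"
  proof -
    have "f \<in> (\<Inter>i. \<Inter>j. V i j) \<longleftrightarrow> fourier f \<in> (\<Inter>i. \<Inter>j. W i j)" for f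
      by (simp add: mem)
    then have "f \<in> (\<Inter>i. \<Inter>j. V i j) \<longleftrightarrow> f = 0" for f
      unfolding W_Inter using unitary_norm[OF Uf, of f] unitary_zero[OF Uf] by auto
    then show ?thesis by blast
  qed
  have dense: "closure (\<Union>i. \<Union>j. V i j) = UNIV"
  proof -
    have "f \<in> closure (\<Union>i. \<Union>j. V i j)" for f
      unfolding closure_approachable
    proof (intro allI impI)
      fix e :: real assume "e > 0"
      have "fourier f \<in> closure (\<Union>i. \<Union>j. W i j)" unfolding W_dense by simp
      then obtain w where w: "w \<in> (\<Union>i. \<Union>j. W i j)" "dist w (fourier f) < e"
        using \<open>e > 0\<close> unfolding closure_approachable by blast
      obtain v where v: "w = fourier v" using unitary_surj[OF Uf] by (metis surjD)
      have "v \<in> (\<Union>i. \<Union>j. V i j)" using w(1) v by (simp add: mem)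
      moreover have "dist v f < e" using w(2) v by (simp add: dist_norm unitary_isometry[OF Uf])
      ultimately show "\<exists>y\<in>(\<Union>i. \<Union>j. V i j). dist y f < e" by blast
    qed
    then show ?thesis by blast
  qed
  have proj: "fourier (orth_proj (V i j) f) = orth_proj (W i j) (fourier f)" for i j f
    unfolding VW[symmetric] by (rule unitary_orth_proj[OF Uf subV, symmetric])
  have commute: "orth_proj (V i j) \<circ> orth_proj (V l m) = orth_proj (V l m) \<circ> orth_proj (V i j)" for i j l m
  proof
    fix f
    have "fourier ((orth_proj (V i j) \<circ> orth_proj (V l m)) f) = (orth_proj (W i j) \<circ> orth_proj (W l m)) (fourier f)"
      by (simp add: proj)
    also have "\<dots> = (orth_proj (W l m) \<circ> orth_proj (W i j)) (fourier f)"
      by (simp only: W_commute[of i j l m])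
    also have "\<dots> = fourier ((orth_proj (V l m) \<circ> orth_proj (V i j)) f)"
      by (simp add: proj)
    finally show "(orth_proj (V i j) \<circ> orth_proj (V l m)) f = (orth_proj (V l m) \<circ> orth_proj (V i j)) f"
      by (rule injD[OF unitary_inj[OF Uf]])
  qed
  have on: "cinner (int_translate \<phi> k) (int_translate \<phi> l) = (if k = l then 1 else 0)" for k l
    using unitary_cinner[OF Uf, of "int_translate \<phi> k" "int_translate \<phi> l"] by (simp add: it basis_orthonormal)
  have mono: "V i j \<subseteq> V l m" if "i \<le> l" "j \<le> m" for i j l m
    using W_mono[OF that] mem by blast
  have dilV: "(op_power_int (dilation A) i \<circ> op_power_int (dilation B) j) ` V 0 0 = V i j" for i j
    unfolding V00 V[of i j] by (rule image_cong[OF refl op])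
  show ?thesis
    unfolding BMRA_def orthonormal_basis_of_def V00
    using subV mono Inter dense commute on dilV[unfolded V00] by blast
qed

theorem theorem7p2:
  fixes A B :: "real^2^2"
    and \<phi> :: L2
    and \<phi>h :: "real^2 \<Rightarrow> complex"
    and \<theta>1 \<theta>2 :: "nat \<Rightarrow> nat \<Rightarrow> nat \<Rightarrow> real^2 \<Rightarrow> complex"
    and V00 :: "L2 set"
    and V :: "int \<Rightarrow> int \<Rightarrow> L2 set"
  assumes A_def: "A = vector [vector [2, 0], vector [0, 1]]"
    and B_def: "B = vector [vector [1, 0], vector [0, 2]]"
    and sq: "square_integrable \<phi>h"
    and FT: "fourier \<phi> = abs_L2 \<phi>h"
    and a: "AE \<xi> in lborel. \<phi>h \<xi> \<in> \<real> \<and> 0 \<le> Re (\<phi>h \<xi>) \<and> Re (\<phi>h \<xi>) \<le> 1 / (2 * pi)"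
    and b: "AE \<xi> in lborel. \<xi> \<in> open_square (- (2 * pi / 3)) (2 * pi / 3) \<longrightarrow>
              \<phi>h \<xi> = 1 / (2 * pi)"
    and c: "AE \<xi> in lborel. \<xi> \<notin> open_square (- (4 * pi / 3)) (4 * pi / 3) \<longrightarrow> \<phi>h \<xi> = 0"
    and d: "AE \<xi> in lborel. \<xi> \<in> open_square (2 * pi / 3) (4 * pi / 3) \<longrightarrow>
              \<phi>h \<xi> \<noteq> 0 \<and>
              (\<Sum>i\<in>{0, 1::nat}. \<Sum>j\<in>{0, 1::nat}.
                 (cmod (\<phi>h (vector [\<xi>$1 - 2 * pi * real i, \<xi>$2 - 2 * pi * real j])))\<^sup>2)
              = 1 / (4 * pi\<^sup>2)"
    and \<theta>1_def: "\<And>i j k \<xi>. \<theta>1 i j k \<xi> = \<phi>h (vector [2^(1 - k) * \<xi>$1, 2^k * \<xi>$2])"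
    and \<theta>2_def: "\<And>i j k \<xi>. \<theta>2 i j k \<xi> =
              \<phi>h (vector [2^(1 - k) * \<xi>$1 - 2 * pi * (-1)^i * real k,
                          2^k * \<xi>$2 - 2 * pi * (-1)^j * real (1 - k)])"
    and e: "\<And>i j k. i \<in> {0, 1} \<Longrightarrow> j \<in> {0, 1} \<Longrightarrow> k \<in> {0, 1} \<Longrightarrow>
              AE \<xi> in lborel. \<xi> \<in> rect_I i j k \<longrightarrow>
                (\<theta>1 i j k \<xi>)\<^sup>2 + (\<theta>2 i j k \<xi>)\<^sup>2 \<noteq> 0 \<and>
                (\<phi>h \<xi>)\<^sup>2 = (1 / (2 * pi))\<^sup>2 *
                  ((\<theta>1 i j k \<xi>)\<^sup>2 / ((\<theta>1 i j k \<xi>)\<^sup>2 + (\<theta>2 i j k \<xi>)\<^sup>2))"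
    and f: "\<And>i j. i \<in> {0, 1} \<Longrightarrow> j \<in> {0, 1} \<Longrightarrow>
              AE \<xi> in lborel. \<xi> \<in> rect_J i j \<longrightarrow>
                \<phi>h \<xi> = \<phi>h (vector [2^(1 - i) * \<xi>$1, 2^i * \<xi>$2])"
    and g: "AE \<xi> in lborel. \<xi> \<in> open_square (2 * pi / 3) (4 * pi / 3) \<longrightarrow>
              (\<phi>h \<xi> * \<phi>h (vector [\<xi>$1 - 2 * pi, \<xi>$2 - 2 * pi]))\<^sup>2
              - (\<phi>h (vector [\<xi>$1 - 2 * pi, \<xi>$2]) * \<phi>h (vector [\<xi>$1, \<xi>$2 - 2 * pi]))\<^sup>2 = 0"
    and V00_def: "V00 = closure (L2.span (range (int_translate \<phi>)))"
    and V_def: "\<And>i j. V i j =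
              (op_power_int (dilation A) i \<circ> op_power_int (dilation B) j) ` V00"
  shows "BMRA A B \<phi> V"
proof -
  \<comment> \<open>The boundary lines of all squares and rectangles, and the axes, are among these
    countably many null lines.\<close>
  have rat: "AE \<xi>::real^2 in lborel. \<forall>q::rat. \<xi>$1 \<noteq> of_rat q * pi \<and> \<xi>$2 \<noteq> of_rat q * pi"
    unfolding AE_all_countable AE_conj_iff by (intro allI conjI AE_not_vertical)
  have e': "AE \<xi> in lborel. \<forall>i\<in>{0,1}. \<forall>j\<in>{0,1}. \<forall>k\<in>{0,1}. \<xi> \<in> rect_I i j k \<longrightarrow>
      (\<theta>1 i j k \<xi>)\<^sup>2 + (\<theta>2 i j k \<xi>)\<^sup>2 \<noteq> 0 \<and>
      (\<phi>h \<xi>)\<^sup>2 = (1 / (2 * pi))\<^sup>2 * ((\<theta>1 i j k \<xi>)\<^sup>2 / ((\<theta>1 i j k \<xi>)\<^sup>2 + (\<theta>2 i j k \<xi>)\<^sup>2))"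
    by (intro eventually_ball_finite ballI e) auto
  have f': "AE \<xi> in lborel. \<forall>i\<in>{0,1}. \<forall>j\<in>{0,1}. \<xi> \<in> rect_J i j \<longrightarrow>
      \<phi>h \<xi> = \<phi>h (vector [2^(1 - i) * \<xi>$1, 2^i * \<xi>$2])"
    by (intro eventually_ball_finite ballI f) auto
  have all: "AE \<xi> in lborel. (\<phi>h \<xi> \<in> \<real> \<and> 0 \<le> Re (\<phi>h \<xi>) \<and> Re (\<phi>h \<xi>) \<le> 1 / (2 * pi)) \<and>
      (\<xi> \<in> open_square (- (2 * pi / 3)) (2 * pi / 3) \<longrightarrow> \<phi>h \<xi> = 1 / (2 * pi)) \<and>
      (\<xi> \<notin> open_square (- (4 * pi / 3)) (4 * pi / 3) \<longrightarrow> \<phi>h \<xi> = 0) \<and>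
      (\<xi> \<in> open_square (2 * pi / 3) (4 * pi / 3) \<longrightarrow>
        (\<Sum>i\<in>{0, 1::nat}. \<Sum>j\<in>{0, 1::nat}.
           (cmod (\<phi>h (vector [\<xi>$1 - 2 * pi * real i, \<xi>$2 - 2 * pi * real j])))\<^sup>2) = 1 / (4 * pi\<^sup>2) \<and>
        (\<phi>h \<xi> * \<phi>h (vector [\<xi>$1 - 2 * pi, \<xi>$2 - 2 * pi]))\<^sup>2
          - (\<phi>h (vector [\<xi>$1 - 2 * pi, \<xi>$2]) * \<phi>h (vector [\<xi>$1, \<xi>$2 - 2 * pi]))\<^sup>2 = 0) \<and>
      (\<forall>i\<in>{0,1}. \<forall>j\<in>{0,1}. \<forall>k\<in>{0,1}. \<xi> \<in> rect_I i j k \<longrightarrow>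
        (\<theta>1 i j k \<xi>)\<^sup>2 + (\<theta>2 i j k \<xi>)\<^sup>2 \<noteq> 0 \<and>
        (\<phi>h \<xi>)\<^sup>2 = (1 / (2 * pi))\<^sup>2 * ((\<theta>1 i j k \<xi>)\<^sup>2 / ((\<theta>1 i j k \<xi>)\<^sup>2 + (\<theta>2 i j k \<xi>)\<^sup>2))) \<and>
      (\<forall>i\<in>{0,1}. \<forall>j\<in>{0,1}. \<xi> \<in> rect_J i j \<longrightarrow>
        \<phi>h \<xi> = \<phi>h (vector [2^(1 - i) * \<xi>$1, 2^i * \<xi>$2])) \<and>
      (\<forall>q::rat. \<xi>$1 \<noteq> of_rat q * pi \<and> \<xi>$2 \<noteq> of_rat q * pi)" (is "AE \<xi> in lborel. ?P \<xi>")
    using a b c d e' f' g rat by eventually_elim blast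
  obtain Q where Q: "{\<xi>. Q \<xi>} \<in> sets borel" "AE \<xi> in lborel. Q \<xi>" and QP: "\<And>\<xi>. Q \<xi> \<Longrightarrow> ?P \<xi>"
    and Q_aff: "\<And>\<xi> a b p q. Q \<xi> \<Longrightarrow> a \<in> \<rat> \<Longrightarrow> b \<in> \<rat> \<Longrightarrow> p \<in> \<rat> \<Longrightarrow> q \<in> \<rat> \<Longrightarrow> a \<noteq> 0 \<Longrightarrow> b \<noteq> 0 \<Longrightarrow>
      Q (aff a b (p * pi) (q * pi) \<xi>)"
    using rational_affine_invariant_AE[OF all] by blast
  define G where "G x y \<longleftrightarrow> Q (vector [x, y])" for x y
  \<comment> \<open>Set to zero off the good set and off the large square, so that the sign, the
    upper bound and the support condition hold everywhere, not just almost everywhere.\<close>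
  define F where "F x y = (if G x y \<and> \<bar>x\<bar> < 4*pi/3 \<and> \<bar>y\<bar> < 4*pi/3 then 2 * pi * Re (\<phi>h (vector [x, y])) else 0)" for x y
  have G_aff: "G (a * x + p * pi) (b * y + q * pi)"
    if "G x y" "a \<in> \<rat>" "b \<in> \<rat>" "p \<in> \<rat>" "q \<in> \<rat>" "a \<noteq> 0" "b \<noteq> 0" for x y a b p q
  proof -
    have "aff a b (p * pi) (q * pi) (vector [x, y]) = vector [a * x + p * pi, b * y + q * pi]"
      by (simp add: vec2_eq_iff)
    then show ?thesis using Q_aff[OF that(1)[unfolded G_def] that(2-7)] by (simp add: G_def)
  qed
  have G_shift: "G (x + 2*pi*m) (y + 2*pi*n)" if "G x y" for x y and m n :: int
    using G_aff[OF that, of 1 1 "2 * of_int m" "2 * of_int n"] by (simp add: mult_ac)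
  have G_irr: "x \<noteq> q * pi \<and> y \<noteq> q * pi" if Gxy: "G x y" and q: "q \<in> \<rat>" for x y q
  proof -
    have *: "\<forall>q::rat. x \<noteq> of_rat q * pi \<and> y \<noteq> of_rat q * pi"
      using QP[OF Gxy[unfolded G_def]] by simp
    obtain q' where "q = of_rat q'" using q by (rule Rats_cases)
    then show ?thesis using * by blast
  qed
  have real: "\<phi>h (vector [x, y]) \<in> \<real> \<and> 0 \<le> Re (\<phi>h (vector [x, y])) \<and> Re (\<phi>h (vector [x, y])) \<le> 1 / (2 * pi)" if "G x y" for x y
    using QP[OF that[unfolded G_def]] by blast
  have val: "\<phi>h (vector [x, y]) = of_real (F x y / (2 * pi))" if "G x y" for x y
  proof (cases "\<bar>x\<bar> < 4*pi/3 \<and> \<bar>y\<bar> < 4*pi/3")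
    case True
    have "\<phi>h (vector [x, y]) = of_real (Re (\<phi>h (vector [x, y])))"
      using real[OF that] by (simp add: complex_is_Real_iff complex_eq_iff)
    then show ?thesis using True that by (simp add: F_def)
  next
    case False
    then have "vector [x, y] \<notin> open_square (- (4 * pi / 3)) (4 * pi / 3)"
      by (auto simp: open_square_def)
    then have "\<phi>h (vector [x, y]) = 0"
      using QP[OF that[unfolded G_def]] by blast
    then show ?thesis using False by (auto simp: F_def)
  qed
  have Fge: "0 \<le> F x y" for x y
    using real[of x y] by (simp add: F_def)
  have scale: "G (a * x) (b * y)" if "G x y" "a \<in> \<rat>" "b \<in> \<rat>" "a \<noteq> 0" "b \<noteq> 0" for x y a b
    using G_aff[OF that(1,2,3) Rats_0 Rats_0 that(4,5)] by simp
  have G_part: "G x (partner y)" "G (partner x) y" if "G x y" for x y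
    using G_shift[OF that, of 0 1] G_shift[OF that, of 0 "-1"] G_shift[OF that, of 1 0] G_shift[OF that, of "-1" 0]
    by (auto simp: partner_def)
  have edge: "(\<theta>1 i j k \<xi>)\<^sup>2 + (\<theta>2 i j k \<xi>)\<^sup>2 \<noteq> 0 \<and>
        (\<phi>h \<xi>)\<^sup>2 = (1 / (2 * pi))\<^sup>2 * ((\<theta>1 i j k \<xi>)\<^sup>2 / ((\<theta>1 i j k \<xi>)\<^sup>2 + (\<theta>2 i j k \<xi>)\<^sup>2))"
    if "Q \<xi>" "i \<in> {0,1}" "j \<in> {0,1}" "k \<in> {0,1}" "\<xi> \<in> rect_I i j k" for i j k \<xi>
    using QP[OF that(1)] that(2-) by blast
  have double: "\<phi>h \<xi> = \<phi>h (vector [2^(1 - i) * \<xi>$1, 2^i * \<xi>$2])"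
    if "Q \<xi>" "i \<in> {0,1}" "j \<in> {0,1}" "\<xi> \<in> rect_J i j" for i j \<xi>
    using QP[OF that(1)] that(2-) by blast
  \<comment> \<open>The index 0 or 1 whose power of -1 is the sign of \<open>t\<close>; it selects
    the rectangle that contains a given point.\<close>
  define sg :: "real \<Rightarrow> nat" where "sg t = (if t > 0 then 0 else 1)" for t
  have sg: "sg t \<in> {0,1}" for t by (simp add: sg_def)
  have partner_sg: "t - 2 * pi * (-1) ^ sg t = partner t" for t
    by (simp add: sg_def partner_def)
  interpret scaling_profile F G
  proof (rule scaling_profile.intro)
    fix x y a b p q
    show "G x y \<Longrightarrow> a \<in> \<rat> \<Longrightarrow> b \<in> \<rat> \<Longrightarrow> p \<in> \<rat> \<Longrightarrow> q \<in> \<rat> \<Longrightarrow> a \<noteq> 0 \<Longrightarrow> b \<noteq> 0 \<Longrightarrow> G (a * x + p * pi) (b * y + q * pi)"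
      by (rule G_aff)
    show "G x y \<Longrightarrow> q \<in> \<rat> \<Longrightarrow> x \<noteq> q * pi \<and> y \<noteq> q * pi" by (rule G_irr)
    show "0 \<le> F x y" by (rule Fge)
    show "F x y \<le> 1"
      using real[of x y] by (auto simp: F_def field_simps)
    show "F x y \<noteq> 0 \<Longrightarrow> \<bar>x\<bar> < 4*pi/3 \<and> \<bar>y\<bar> < 4*pi/3"
      by (auto simp: F_def split: if_splits)
  next
    fix x y assume *: "G x y" "\<bar>x\<bar> < 2*pi/3" "\<bar>y\<bar> < 2*pi/3"
    then have "vector [x, y] \<in> open_square (- (2 * pi / 3)) (2 * pi / 3)"
      by (auto simp: open_square_def)
    then have "\<phi>h (vector [x, y]) = 1 / (2 * pi)"
      using QP[OF *(1)[unfolded G_def]] by blast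
    then have "complex_of_real (F x y / (2 * pi)) = complex_of_real (1 / (2 * pi))"
      unfolding val[OF *(1)] by simp
    then have "F x y / (2 * pi) = 1 / (2 * pi)" unfolding of_real_eq_iff .
    then show "F x y = 1" by simp
  next
    fix x y assume *: "G x y" "2*pi/3 < x" "x < 4*pi/3" "2*pi/3 < y" "y < 4*pi/3"
    then have sq: "vector [x, y] \<in> open_square (2 * pi / 3) (4 * pi / 3)"
      by (auto simp: open_square_def)
    have Gs: "G (x - 2*pi) y" "G x (y - 2*pi)" "G (x - 2*pi) (y - 2*pi)"
      using G_shift[OF *(1), of "-1" 0] G_shift[OF *(1), of 0 "-1"] G_shift[OF *(1), of "-1" "-1"] by auto
    note v = val[OF *(1)] val[OF Gs(1)] val[OF Gs(2)] val[OF Gs(3)]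
    have "(\<Sum>i\<in>{0, 1::nat}. \<Sum>j\<in>{0, 1::nat}.
           (cmod (\<phi>h (vector [x - 2 * pi * real i, y - 2 * pi * real j])))\<^sup>2) = 1 / (4 * pi\<^sup>2)"
      using QP[OF *(1)[unfolded G_def]] sq by simp
    then have "(F x y)\<^sup>2 / (4 * pi\<^sup>2) + (F x (y - 2*pi))\<^sup>2 / (4 * pi\<^sup>2) +
        ((F (x - 2*pi) y)\<^sup>2 / (4 * pi\<^sup>2) + (F (x - 2*pi) (y - 2*pi))\<^sup>2 / (4 * pi\<^sup>2)) = 1 / (4 * pi\<^sup>2)"
      by (simp add: v norm_divide power_divide power_mult_distrib)
    then have 1: "(F x y)\<^sup>2 + (F x (y - 2*pi))\<^sup>2 + (F (x - 2*pi) y)\<^sup>2 + (F (x - 2*pi) (y - 2*pi))\<^sup>2 = 1"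
      by (simp add: add_divide_distrib[symmetric])
    have "(\<phi>h (vector [x, y]) * \<phi>h (vector [x - 2 * pi, y - 2 * pi]))\<^sup>2
          - (\<phi>h (vector [x - 2 * pi, y]) * \<phi>h (vector [x, y - 2 * pi]))\<^sup>2 = 0"
      using QP[OF *(1)[unfolded G_def]] sq by simp
    then have "complex_of_real ((F x y / (2*pi) * (F (x - 2*pi) (y - 2*pi) / (2*pi)))\<^sup>2) =
        complex_of_real ((F (x - 2*pi) y / (2*pi) * (F x (y - 2*pi) / (2*pi)))\<^sup>2)"
      unfolding v by (simp only: of_real_mult of_real_power right_minus_eq)
    then have "(F x y / (2*pi) * (F (x - 2*pi) (y - 2*pi) / (2*pi)))\<^sup>2 =
        (F (x - 2*pi) y / (2*pi) * (F x (y - 2*pi) / (2*pi)))\<^sup>2"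
      unfolding of_real_eq_iff .
    \<comment> \<open>Nonnegativity removes the squares from condition (g).\<close>
    then have "F x y / (2*pi) * (F (x - 2*pi) (y - 2*pi) / (2*pi)) = F (x - 2*pi) y / (2*pi) * (F x (y - 2*pi) / (2*pi))"
      by (rule power2_eq_imp_eq) (simp_all add: Fge)
    then have "F x y * F (x - 2*pi) (y - 2*pi) = F (x - 2*pi) y * F x (y - 2*pi)"
      by simp
    with 1 show "(F x y)\<^sup>2 + (F x (y - 2*pi))\<^sup>2 + (F (x - 2*pi) y)\<^sup>2 + (F (x - 2*pi) (y - 2*pi))\<^sup>2 = 1 \<and>
      F x y * F (x - 2*pi) (y - 2*pi) = F (x - 2*pi) y * F x (y - 2*pi)" ..
  next
    fix x y assume *: "G x y" "pi/3 < \<bar>x\<bar>" "\<bar>x\<bar> < 2*pi/3" "2*pi/3 < \<bar>y\<bar>" "\<bar>y\<bar> < 4*pi/3"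
    have G2: "G (2*x) y" using scale[OF *(1), of 2 1] by simp
    \<comment> \<open>For k = 0 the four rectangles have pi/3 < |x| < 2 pi/3 and 2 pi/3 < |y| < 4
      pi/3; k = 1 exchanges the coordinates.\<close>
    have r: "vector [x, y] \<in> rect_I (sg x) (sg y) 0"
      using *(2-) pi_gt_zero by (auto simp: rect_I_def sg_def abs_if split: if_splits)
    have "\<theta>1 (sg x) (sg y) 0 (vector [x, y]) = of_real (F (2*x) y / (2*pi))"
      unfolding \<theta>1_def val[OF G2, symmetric] by simp
    moreover have "\<theta>2 (sg x) (sg y) 0 (vector [x, y]) = of_real (F (2*x) (partner y) / (2*pi))"
      unfolding \<theta>2_def val[OF G_part(1)[OF G2], symmetric] by (simp add: partner_sg)
    ultimately show "(F (2*x) y)\<^sup>2 + (F (2*x) (partner y))\<^sup>2 \<noteq> 0 \<and>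
      (F x y)\<^sup>2 * ((F (2*x) y)\<^sup>2 + (F (2*x) (partner y))\<^sup>2) = (F (2*x) y)\<^sup>2"
      using edge[OF *(1)[unfolded G_def] sg sg _ r] val[OF *(1)] by (intro edge_ratio_real) auto
  next
    fix x y assume *: "G x y" "2*pi/3 < \<bar>x\<bar>" "\<bar>x\<bar> < 4*pi/3" "pi/3 < \<bar>y\<bar>" "\<bar>y\<bar> < 2*pi/3"
    have G2: "G x (2*y)" using scale[OF *(1), of 1 2] by simp
    have r: "vector [x, y] \<in> rect_I (sg x) (sg y) 1"
      using *(2-) pi_gt_zero by (auto simp: rect_I_def sg_def abs_if split: if_splits)
    have "\<theta>1 (sg x) (sg y) 1 (vector [x, y]) = of_real (F x (2*y) / (2*pi))"
      unfolding \<theta>1_def val[OF G2, symmetric] by simp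
    moreover have "\<theta>2 (sg x) (sg y) 1 (vector [x, y]) = of_real (F (partner x) (2*y) / (2*pi))"
      unfolding \<theta>2_def val[OF G_part(2)[OF G2], symmetric] by (simp add: partner_sg)
    ultimately show "(F x (2*y))\<^sup>2 + (F (partner x) (2*y))\<^sup>2 \<noteq> 0 \<and>
      (F x y)\<^sup>2 * ((F x (2*y))\<^sup>2 + (F (partner x) (2*y))\<^sup>2) = (F x (2*y))\<^sup>2"
      using edge[OF *(1)[unfolded G_def] sg sg _ r] val[OF *(1)] by (intro edge_ratio_real) auto
  next
    fix x y assume *: "G x y" "\<bar>x\<bar> < pi/3" "2*pi/3 < \<bar>y\<bar>" "\<bar>y\<bar> < 4*pi/3"
    have G2: "G (2*x) y" using scale[OF *(1), of 2 1] by simp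
    \<comment> \<open>These squares have half-width pi/3 and are centred at distance pi from the
      origin on the second axis.\<close>
    have r: "vector [x, y] \<in> rect_J 0 (sg y)"
      using *(2-) pi_gt_zero by (auto simp: rect_J_def sg_def abs_if split: if_splits)
    have "\<phi>h (vector [x, y]) = \<phi>h (vector [2 * x, y])"
      using double[OF *(1)[unfolded G_def] _ sg r] by simp
    then show "F x y = F (2*x) y"
      unfolding val[OF *(1)] val[OF G2] of_real_eq_iff by simp
  next
    fix x y assume *: "G x y" "2*pi/3 < \<bar>x\<bar>" "\<bar>x\<bar> < 4*pi/3" "\<bar>y\<bar> < pi/3"
    have G2: "G x (2*y)" using scale[OF *(1), of 1 2] by simp
    have r: "vector [x, y] \<in> rect_J 1 (sg x)"
      using *(2-) pi_gt_zero by (auto simp: rect_J_def sg_def abs_if split: if_splits)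
    have "\<phi>h (vector [x, y]) = \<phi>h (vector [x, 2 * y])"
      using double[OF *(1)[unfolded G_def] _ sg r] by simp
    then show "F x y = F x (2*y)"
      unfolding val[OF *(1)] val[OF G2] of_real_eq_iff by simp
  qed
  have vec: "vector [\<xi>$1, \<xi>$2] = \<xi>" for \<xi> :: "real^2"
    by (simp add: vec2_eq_iff)
  interpret frequency_profile F G
  proof
    have [measurable]: "\<phi>h \<in> borel_measurable borel" using sq by measurable
    have [measurable]: "Measurable.pred borel Q" using Q(1) by (simp add: pred_def)
    show "(\<lambda>\<xi>::real^2. F (\<xi>$1) (\<xi>$2)) \<in> borel_measurable borel"
      unfolding F_def G_def vec by measurable
    show "AE \<xi>::real^2 in lborel. G (\<xi>$1) (\<xi>$2)"
      unfolding G_def vec by (rule Q(2))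
  qed
  have "abs_L2 \<phi>h = abs_L2 (\<lambda>\<xi>. \<Phi> \<xi> / (2*pi))"
  proof (subst abs_L2_eq_iff)
    show "square_integrable (\<lambda>\<xi>. \<Phi> \<xi> / (2*pi))"
      using square_integrable_scale[OF square_integrable_\<Phi>, of "1 / (2*pi)"] by simp
    show "AE \<xi> in lborel. \<phi>h \<xi> = \<Phi> \<xi> / (2*pi)"
      using Q(2)
    proof eventually_elim
      case (elim \<xi>)
      then have "G (\<xi>$1) (\<xi>$2)" by (simp add: G_def vec)
      from val[OF this] show ?case by (simp add: vec \<Phi>_def)
    qed
  qed (fact sq)
  then have hat: "fourier \<phi> = abs_L2 (\<lambda>\<xi>. \<Phi> \<xi> / (2*pi))"
    using FT by simp
  have A: "dilation A = dil 2 1" and B: "dilation B = dil 1 2"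
    unfolding A_def B_def by (rule dilation_diag; simp)+
  have "V i j = dil (2 powi i) (2 powi j) ` closure (L2.span (range (int_translate \<phi>)))" for i j
    unfolding V_def V00_def A B
    by (intro image_cong refl) (simp add: op_power_int_dil dil_dil)
  then show ?thesis
    by (intro BMRA_if_profile hat A B)
qed

end
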